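(* Let $m\ge 2$ and let $F_n$ be the free group of rank $n$ with basis $x_1,\dots,x_n$. For each $k\ge 1$, the set of classes modulo $\mathfrak{J}_{F_n}^{k+1}$ of the elements of $$T_k := \Big\{ \prod_{\substack{1\le i,j\le m\\ (i,j)\ne(m,m)}} \prod_{l=1}^n s_{ij}(x_l)^{e_{ij,l}} \;\Big|\; e_{ij,l}\ge 0,\ \sum_{\substack{1\le i,j\le m\\ (i,j)\ne(m,m)}}\sum_{l=1}^n e_{ij,l}=k\Big\}\subset \mathfrak{J}_{F_n}^k$$ (indexed by the tuples $(e_{ij,l})$) forms a basis of $\mathrm{gr}^k(\mathfrak{J}_{F_n})=\mathfrak{J}_{F_n}^k/\mathfrak{J}_{F_n}^{k+1}$ as a $\mathbf{Q}$-vector space. Furthermore, for any $n\ge 2$ and $k\ge 1$, $$\mathrm{gr}^k(\mathfrak{J}_{F_n})\cong \bigoplus_{(e_{ij})}\ \bigotimes_{\substack{1\le i,j\le m\\ (i,j)\ne(m,m)}} S^{e_{ij}}H_{\mathbf{Q}}$$ as a $\mathrm{GL}(n,\mathbf{Z})$-module, where the direct sum runs over all tuples $(e_{ij})$ of non-negative integers indexed by $1\le i,j\le m$, $(i,j)\ne(m,m)$, whose sum is equal to $k$.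
   Context: For a group $G$ generated by $x_1,\dots,x_n$ and $m\ge 2$, let $R^m(G)=\mathrm{Hom}(G,\mathrm{SL}(m,\mathbf{C}))$ and let $\mathcal{F}(R^m(G),\mathbf{C})$ be the $\mathbf{C}$-algebra of all functions $R^m(G)\to\mathbf{C}$ with pointwise operations. For $x\in G$ and $1\le i,j\le m$, let $a_{ij}(x)\in\mathcal{F}(R^m(G),\mathbf{C})$ be the function $\rho\mapsto$ the $(i,j)$-component of $\rho(x)$. Let $\mathfrak{R}^m_{\mathbf{Q}}(G)$ be the $\mathbf{Q}$-subalgebra generated by all $a_{ij}(x)$, $x\in G$, $1\le i,j\le m$. Put $s_{ij}(x)=a_{ij}(x)-\delta_{ij}$ ($\delta$ the Kronecker delta), and let $\mathfrak{J}_G$ be the ideal of $\mathfrak{R}^m_{\mathbf{Q}}(G)$ generated by $s_{ij}(x_l)$ for $1\le i,j\le m$, $1\le l\le n$. Put $\mathrm{gr}^k(\mathfrak{J}_G)=\mathfrak{J}_G^k/\mathfrak{J}_G^{k+1}$. $\mathrm{Aut}\,G$ acts on $G$ from the right, written $x^\sigma$, and acts from the right on $\mathfrak{R}^m_{\mathbf{Q}}(G)$ by algebra automorphisms with $a_{ij}(x)^\sigma=a_{ij}(x^\sigma)$. The ideal $\mathfrak{J}_G$ and its powers are $\mathrm{Aut}\,G$-invariant, so $\mathrm{Aut}\,G$ acts on $\mathrm{gr}^k(\mathfrak{J}_G)$. $H=F_n/[F_n,F_n]$ is the abelianization of $F_n$, $H_{\mathbf{Q}}=H\otimes_{\mathbf{Z}}\mathbf{Q}$,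 and $S^eH_{\mathbf{Q}}$ is the $e$-th symmetric power. The kernel $\mathrm{IA}(F_n)$ of $\mathrm{Aut}\,F_n\to\mathrm{Aut}\,H$ acts trivially on $\mathrm{gr}^k(\mathfrak{J}_{F_n})$, so this space is a module over $\mathrm{Aut}\,F_n/\mathrm{IA}(F_n)\cong\mathrm{Aut}\,H\cong\mathrm{GL}(n,\mathbf{Z})$; the right-hand side carries the natural action induced from that on $H$. *)

theory Defs
  imports
    "HOL-Algebra.Generated_Groups"
    "HOL-Algebra.Bij"
    "HOL-Algebra.Subrings"
    "HOL-Algebra.Ideal_Product"
    "HOL-Library.Poly_Mapping"
    "HOL-Combinatorics.Permutations"
    "Jordan_Normal_Form.VS_Connect"
    "Jordan_Normal_Form.Determinant"
begin

text \<open>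
  Conventions. The indices of matrix entries and of basis elements start at 0, so the basis of the
  free group is \<open>x 0, \<dots>, x (n - 1)\<close> and the entry \<open>(m, m)\<close> of the usual notation is
  \<open>(m - 1, m - 1)\<close>. Rational vector spaces are modules over \<open>class_ring :: rat ring\<close>.
\<close>

section \<open>Free groups\<close>

text \<open>Words in the letters \<open>x i\<close> (flag \<open>True\<close>) and \<open>(x i)\<inverse>\<close> (flag \<open>False\<close>).\<close>

definition word_value :: "('g, 'b) monoid_scheme \<Rightarrow> (nat \<Rightarrow> 'g) \<Rightarrow> (nat \<times> bool) list \<Rightarrow> 'g" where
  "word_value G x w =
     foldr (\<lambda>(i, b) y. (if b then x i else inv\<^bsub>G\<^esub> (x i)) \<otimes>\<^bsub>G\<^esub> y) w \<one>\<^bsub>G\<^esub>"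

definition reduced_word :: "(nat \<times> bool) list \<Rightarrow> bool" where
  "reduced_word w \<longleftrightarrow>
     (\<forall>t. Suc t < length w \<longrightarrow> \<not> (fst (w ! t) = fst (w ! Suc t) \<and> snd (w ! t) \<noteq> snd (w ! Suc t)))"

definition free_group_with_basis :: "('g, 'b) monoid_scheme \<Rightarrow> nat \<Rightarrow> (nat \<Rightarrow> 'g) \<Rightarrow> bool" where
  "free_group_with_basis G n x \<longleftrightarrow>
     group G \<and> x ` {..<n} \<subseteq> carrier G \<and> generate G (x ` {..<n}) = carrier G \<and>
     (\<forall>w. fst ` set w \<subseteq> {..<n} \<and> reduced_word w \<and> w \<noteq> [] \<longrightarrow> word_value G x w \<noteq> \<one>\<^bsub>G\<^esub>)"

section \<open>Representations and functions on them\<close>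

definition SL_group :: "nat \<Rightarrow> complex mat monoid" where
  "SL_group m = \<lparr>carrier = {A \<in> carrier_mat m m. det A = 1}, monoid.mult = (*), one = 1\<^sub>m m\<rparr>"

text \<open>Homomorphisms are made extensional, so that they are determined by their values on the group.\<close>

definition reps :: "nat \<Rightarrow> ('g, 'b) monoid_scheme \<Rightarrow> ('g \<Rightarrow> complex mat) set" where
  "reps m G = hom G (SL_group m) \<inter> extensional (carrier G)"

definition fun_algebra :: "'r set \<Rightarrow> (complex, 'r \<Rightarrow> complex) module" where
  "fun_algebra B =
     \<lparr>carrier = B \<rightarrow>\<^sub>E UNIV,
      monoid.mult = (\<lambda>f g. \<lambda>r\<in>B. f r * g r),
      one = (\<lambda>r\<in>B. 1),
      ring.zero = (\<lambda>r\<in>B. 0),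
      add = (\<lambda>f g. \<lambda>r\<in>B. f r + g r),
      smult = (\<lambda>c f. \<lambda>r\<in>B. c * f r)\<rparr>"

definition rat_subalgebra :: "(complex, 'a) module \<Rightarrow> 'a set \<Rightarrow> bool" where
  "rat_subalgebra F V \<longleftrightarrow> subring V F \<and> (\<forall>q. \<forall>v\<in>V. of_rat q \<odot>\<^bsub>F\<^esub> v \<in> V)"

definition rat_algebra_generated :: "(complex, 'a) module \<Rightarrow> 'a set \<Rightarrow> (rat, 'a) module" where
  "rat_algebra_generated F S =
     \<lparr>carrier = \<Inter> {V. rat_subalgebra F V \<and> S \<subseteq> V},
      monoid.mult = monoid.mult F, one = one F, ring.zero = zero F, add = add F,
      smult = (\<lambda>q v. of_rat q \<odot>\<^bsub>F\<^esub> v)\<rparr>"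

definition entry_fun :: "nat \<Rightarrow> ('g, 'b) monoid_scheme \<Rightarrow> nat \<times> nat \<Rightarrow> 'g \<Rightarrow>
    ('g \<Rightarrow> complex mat) \<Rightarrow> complex" where
  "entry_fun m G p y = (\<lambda>\<rho>\<in>reps m G. \<rho> y $$ p)"

definition rep_ring :: "nat \<Rightarrow> ('g, 'b) monoid_scheme \<Rightarrow>
    (rat, ('g \<Rightarrow> complex mat) \<Rightarrow> complex) module" where
  "rep_ring m G = rat_algebra_generated (fun_algebra (reps m G))
     {entry_fun m G p y | p y. p \<in> {..<m} \<times> {..<m} \<and> y \<in> carrier G}"

definition s_fun :: "nat \<Rightarrow> ('g, 'b) monoid_scheme \<Rightarrow> nat \<times> nat \<Rightarrow> 'g \<Rightarrow>
    ('g \<Rightarrow> complex mat) \<Rightarrow> complex" where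
  "s_fun m G p y = entry_fun m G p y \<ominus>\<^bsub>rep_ring m G\<^esub>
     (if fst p = snd p then \<one>\<^bsub>rep_ring m G\<^esub> else \<zero>\<^bsub>rep_ring m G\<^esub>)"

definition J_ideal :: "nat \<Rightarrow> ('g, 'b) monoid_scheme \<Rightarrow> nat \<Rightarrow> (nat \<Rightarrow> 'g) \<Rightarrow>
    (('g \<Rightarrow> complex mat) \<Rightarrow> complex) set" where
  "J_ideal m G n x = genideal (rep_ring m G)
     {s_fun m G p (x l) | p l. p \<in> {..<m} \<times> {..<m} \<and> l < n}"

definition J_power :: "nat \<Rightarrow> ('g, 'b) monoid_scheme \<Rightarrow> nat \<Rightarrow> (nat \<Rightarrow> 'g) \<Rightarrow> nat \<Rightarrow>
    (('g \<Rightarrow> complex mat) \<Rightarrow> complex) set" where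
  "J_power m G n x k = J_ideal m G n x [^]\<^bsub>ideals_set (rep_ring m G)\<^esub> k"

section \<open>Quotient modules and the graded quotients\<close>

text \<open>Scalar multiplication is \<open>c \<cdot> (N + v) = N + c \<cdot> v\<close>. The multiplicative fields of the
  record carry no information.\<close>

definition quot_module :: "('a, 'v) module \<Rightarrow> 'v set \<Rightarrow> ('a, 'v set) module" where
  "quot_module M N =
     \<lparr>carrier = a_rcosets\<^bsub>M\<^esub> N, monoid.mult = undefined, one = undefined,
      ring.zero = N, add = set_add M,
      smult = (\<lambda>c C. \<Union>v\<in>C. N +>\<^bsub>M\<^esub> (c \<odot>\<^bsub>M\<^esub> v))\<rparr>"

text \<open>The map \<open>N + v \<mapsto> N + f v\<close> induced by an endomorphism \<open>f\<close> of \<open>M\<close> with \<open>f ` N \<subseteq> N\<close>.\<close>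

definition quot_map :: "('a, 'v) module \<Rightarrow> 'v set \<Rightarrow> ('v \<Rightarrow> 'v) \<Rightarrow> 'v set \<Rightarrow> 'v set" where
  "quot_map M N f C = (\<Union>v\<in>C. N +>\<^bsub>M\<^esub> f v)"

definition gr_J :: "nat \<Rightarrow> ('g, 'b) monoid_scheme \<Rightarrow> nat \<Rightarrow> (nat \<Rightarrow> 'g) \<Rightarrow> nat \<Rightarrow>
    (rat, (('g \<Rightarrow> complex mat) \<Rightarrow> complex) set) module" where
  "gr_J m G n x k =
     quot_module ((rep_ring m G)\<lparr>carrier := J_power m G n x k\<rparr>) (J_power m G n x (Suc k))"

definition gr_class :: "nat \<Rightarrow> ('g, 'b) monoid_scheme \<Rightarrow> nat \<Rightarrow> (nat \<Rightarrow> 'g) \<Rightarrow> nat \<Rightarrow>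
    (('g \<Rightarrow> complex mat) \<Rightarrow> complex) \<Rightarrow> (('g \<Rightarrow> complex mat) \<Rightarrow> complex) set" where
  "gr_class m G n x k f = J_power m G n x (Suc k) +>\<^bsub>rep_ring m G\<^esub> f"

definition entry_positions :: "nat \<Rightarrow> (nat \<times> nat) set" where
  "entry_positions m = {..<m} \<times> {..<m} - {(m - 1, m - 1)}"

definition monomial_exponents :: "nat \<Rightarrow> nat \<Rightarrow> nat \<Rightarrow> ((nat \<times> nat) \<times> nat \<Rightarrow> nat) set" where
  "monomial_exponents m n k =
     {e \<in> entry_positions m \<times> {..<n} \<rightarrow>\<^sub>E UNIV.
        (\<Sum>p\<in>entry_positions m. \<Sum>l<n. e (p, l)) = k}"

definition s_monomial :: "nat \<Rightarrow> ('g, 'b) monoid_scheme \<Rightarrow> nat \<Rightarrow> (nat \<Rightarrow> 'g) \<Rightarrow>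
    ((nat \<times> nat) \<times> nat \<Rightarrow> nat) \<Rightarrow> ('g \<Rightarrow> complex mat) \<Rightarrow> complex" where
  "s_monomial m G n x e =
     (\<Otimes>\<^bsub>rep_ring m G\<^esub>p\<in>entry_positions m. \<Otimes>\<^bsub>rep_ring m G\<^esub>l\<in>{..<n}.
        s_fun m G p (x l) [^]\<^bsub>rep_ring m G\<^esub> e (p, l))"

section \<open>Symmetric powers, tensor products and direct sums\<close>

definition free_module :: "'x set \<Rightarrow> (rat, 'x \<Rightarrow>\<^sub>0 rat) module" where
  "free_module B =
     \<lparr>carrier = {f. Poly_Mapping.keys f \<subseteq> B}, monoid.mult = undefined, one = undefined,
      ring.zero = 0, add = (+), smult = (\<lambda>c. Poly_Mapping.map ((*) c))\<rparr>"

definition free_map :: "('x \<Rightarrow> 'x) \<Rightarrow> ('x \<Rightarrow>\<^sub>0 rat) \<Rightarrow> ('x \<Rightarrow>\<^sub>0 rat)" where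
  "free_map g f =
     (\<Sum>x\<in>Poly_Mapping.keys f. Poly_Mapping.single (g x) (Poly_Mapping.lookup f x))"

definition presented_module :: "'x set \<Rightarrow> ('x \<Rightarrow>\<^sub>0 rat) set \<Rightarrow> (rat, ('x \<Rightarrow>\<^sub>0 rat) set) module" where
  "presented_module B rels =
     quot_module (free_module B) (LinearCombinations.module.span class_ring (free_module B) rels)"

definition presented_map :: "'x set \<Rightarrow> ('x \<Rightarrow>\<^sub>0 rat) set \<Rightarrow> ('x \<Rightarrow> 'x) \<Rightarrow>
    ('x \<Rightarrow>\<^sub>0 rat) set \<Rightarrow> ('x \<Rightarrow>\<^sub>0 rat) set" where
  "presented_map B rels g =
     quot_map (free_module B) (LinearCombinations.module.span class_ring (free_module B) rels)
       (free_map g)"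

text \<open>Extension of scalars \<open>A \<otimes>\<^bsub>\<int>\<^esub> \<rat>\<close> of a multiplicatively written abelian group \<open>A\<close>: the symbol
  \<open>single (a, q) 1\<close> stands for \<open>a \<otimes> q\<close>, and the last set of relations is the action of the
  rationals on the right factor.\<close>

definition rat_extension_rels :: "('a, 'b) monoid_scheme \<Rightarrow> ('a \<times> rat \<Rightarrow>\<^sub>0 rat) set" where
  "rat_extension_rels A =
     {Poly_Mapping.single (a \<otimes>\<^bsub>A\<^esub> b, q) 1
        - Poly_Mapping.single (a, q) 1 - Poly_Mapping.single (b, q) 1
        | a b q. a \<in> carrier A \<and> b \<in> carrier A} \<union>
     {Poly_Mapping.single (a, q + r) 1
        - Poly_Mapping.single (a, q) 1 - Poly_Mapping.single (a, r) 1
        | a q r. a \<in> carrier A} \<union>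
     {Poly_Mapping.single (a, c * q) 1 - Poly_Mapping.single (a, q) c
        | a c q. a \<in> carrier A}"

definition rat_extension :: "('a, 'b) monoid_scheme \<Rightarrow> (rat, ('a \<times> rat \<Rightarrow>\<^sub>0 rat) set) module" where
  "rat_extension A = presented_module (carrier A \<times> UNIV) (rat_extension_rels A)"

definition rat_extension_map :: "('a, 'b) monoid_scheme \<Rightarrow> ('a \<Rightarrow> 'a) \<Rightarrow>
    ('a \<times> rat \<Rightarrow>\<^sub>0 rat) set \<Rightarrow> ('a \<times> rat \<Rightarrow>\<^sub>0 rat) set" where
  "rat_extension_map A \<alpha> =
     presented_map (carrier A \<times> UNIV) (rat_extension_rels A) (\<lambda>(a, q). (\<alpha> a, q))"

text \<open>Tensor product of a finite family \<open>V\<close> indexed by \<open>I\<close>: the symbol \<open>single v 1\<close> stands for the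
  pure tensor of the family \<open>v\<close>.\<close>

definition multilinear_rels :: "'i set \<Rightarrow> ('i \<Rightarrow> (rat, 'v) module) \<Rightarrow> (('i \<Rightarrow> 'v) \<Rightarrow>\<^sub>0 rat) set" where
  "multilinear_rels I V =
     {Poly_Mapping.single (v(i := a \<oplus>\<^bsub>V i\<^esub> b)) 1
        - Poly_Mapping.single (v(i := a)) 1 - Poly_Mapping.single (v(i := b)) 1
        | v i a b. v \<in> (\<Pi>\<^sub>E j\<in>I. carrier (V j)) \<and> i \<in> I \<and> a \<in> carrier (V i) \<and> b \<in> carrier (V i)} \<union>
     {Poly_Mapping.single (v(i := c \<odot>\<^bsub>V i\<^esub> a)) 1 - Poly_Mapping.single (v(i := a)) c
        | v i a c. v \<in> (\<Pi>\<^sub>E j\<in>I. carrier (V j)) \<and> i \<in> I \<and> a \<in> carrier (V i)}"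

definition tensor_product :: "'i set \<Rightarrow> ('i \<Rightarrow> (rat, 'v) module) \<Rightarrow>
    (rat, (('i \<Rightarrow> 'v) \<Rightarrow>\<^sub>0 rat) set) module" where
  "tensor_product I V = presented_module (\<Pi>\<^sub>E i\<in>I. carrier (V i)) (multilinear_rels I V)"

definition tensor_map :: "'i set \<Rightarrow> ('i \<Rightarrow> (rat, 'v) module) \<Rightarrow> ('i \<Rightarrow> 'v \<Rightarrow> 'v) \<Rightarrow>
    (('i \<Rightarrow> 'v) \<Rightarrow>\<^sub>0 rat) set \<Rightarrow> (('i \<Rightarrow> 'v) \<Rightarrow>\<^sub>0 rat) set" where
  "tensor_map I V f =
     presented_map (\<Pi>\<^sub>E i\<in>I. carrier (V i)) (multilinear_rels I V) (\<lambda>v. \<lambda>i\<in>I. f i (v i))"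

text \<open>The quotient of the \<open>e\<close>-fold tensor power by the permutations of the factors, formed in one
  step.\<close>

definition symmetric_rels :: "nat \<Rightarrow> (rat, 'v) module \<Rightarrow> ((nat \<Rightarrow> 'v) \<Rightarrow>\<^sub>0 rat) set" where
  "symmetric_rels e V = multilinear_rels {..<e} (\<lambda>_. V) \<union>
     {Poly_Mapping.single (v \<circ> \<pi>) 1 - Poly_Mapping.single v 1
        | v \<pi>. v \<in> ({..<e} \<rightarrow>\<^sub>E carrier V) \<and> \<pi> permutes {..<e}}"

definition symmetric_power :: "nat \<Rightarrow> (rat, 'v) module \<Rightarrow> (rat, ((nat \<Rightarrow> 'v) \<Rightarrow>\<^sub>0 rat) set) module" where
  "symmetric_power e V = presented_module ({..<e} \<rightarrow>\<^sub>E carrier V) (symmetric_rels e V)"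

definition symmetric_power_map :: "nat \<Rightarrow> (rat, 'v) module \<Rightarrow> ('v \<Rightarrow> 'v) \<Rightarrow>
    ((nat \<Rightarrow> 'v) \<Rightarrow>\<^sub>0 rat) set \<Rightarrow> ((nat \<Rightarrow> 'v) \<Rightarrow>\<^sub>0 rat) set" where
  "symmetric_power_map e V f =
     presented_map ({..<e} \<rightarrow>\<^sub>E carrier V) (symmetric_rels e V) (\<lambda>v. \<lambda>i\<in>{..<e}. f (v i))"

definition direct_sum_family :: "'i set \<Rightarrow> ('i \<Rightarrow> (rat, 'v) module) \<Rightarrow> (rat, 'i \<Rightarrow> 'v) module" where
  "direct_sum_family I V =
     \<lparr>carrier = {f \<in> \<Pi>\<^sub>E i\<in>I. carrier (V i). finite {i \<in> I. f i \<noteq> \<zero>\<^bsub>V i\<^esub>}},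
      monoid.mult = undefined, one = undefined,
      ring.zero = (\<lambda>i\<in>I. \<zero>\<^bsub>V i\<^esub>),
      add = (\<lambda>f g. \<lambda>i\<in>I. f i \<oplus>\<^bsub>V i\<^esub> g i),
      smult = (\<lambda>c f. \<lambda>i\<in>I. c \<odot>\<^bsub>V i\<^esub> f i)\<rparr>"

definition direct_sum_map :: "'i set \<Rightarrow> ('i \<Rightarrow> 'v \<Rightarrow> 'v) \<Rightarrow> ('i \<Rightarrow> 'v) \<Rightarrow> ('i \<Rightarrow> 'v)" where
  "direct_sum_map I F f = (\<lambda>i\<in>I. F i (f i))"

section \<open>The two modules over the general linear group\<close>

definition abelianization :: "('g, 'b) monoid_scheme \<Rightarrow> 'g set monoid" where
  "abelianization G = G Mod (derived G (carrier G))"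

definition ab_class :: "('g, 'b) monoid_scheme \<Rightarrow> 'g \<Rightarrow> 'g set" where
  "ab_class G y = derived G (carrier G) #>\<^bsub>G\<^esub> y"

text \<open>The automorphism of the abelianization induced by an automorphism of the group.\<close>

definition ab_aut :: "('g, 'b) monoid_scheme \<Rightarrow> ('g \<Rightarrow> 'g) \<Rightarrow> 'g set \<Rightarrow> 'g set" where
  "ab_aut G \<sigma> = (\<lambda>C\<in>carrier (abelianization G). \<sigma> ` C)"

definition GL_int :: "nat \<Rightarrow> int mat set" where
  "GL_int n = Units (ring_mat TYPE(int) n ())"

text \<open>The identification of \<open>GL(n, \<int>)\<close> with the automorphism group of the abelianization of a free
  group with basis \<open>x\<close>: the matrix \<open>A\<close> sends the class of \<open>x i\<close> to the product of the classes of
  \<open>x j\<close> with exponents the entries of row \<open>i\<close>. As automorphisms act from the right, this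
  convention turns matrix products into products of automorphisms.\<close>

definition GL_aut :: "('g, 'b) monoid_scheme \<Rightarrow> nat \<Rightarrow> (nat \<Rightarrow> 'g) \<Rightarrow> int mat \<Rightarrow> 'g set \<Rightarrow> 'g set" where
  "GL_aut G n x A = (THE \<alpha>. \<alpha> \<in> auto (abelianization G) \<and>
     (\<forall>i<n. \<alpha> (ab_class G (x i)) =
        (\<Otimes>\<^bsub>abelianization G\<^esub>j\<in>{..<n}. ab_class G (x j) [^]\<^bsub>abelianization G\<^esub> (A $$ (i, j)))))"

text \<open>The algebra automorphism of the ring of representations given by an automorphism \<open>\<sigma>\<close> of the
  group: it is precomposition of representations with \<open>\<sigma>\<close>, and sends \<open>entry_fun m G p y\<close> to
  \<open>entry_fun m G p (\<sigma> y)\<close>.\<close>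

definition aut_act :: "nat \<Rightarrow> ('g, 'b) monoid_scheme \<Rightarrow> ('g \<Rightarrow> 'g) \<Rightarrow>
    (('g \<Rightarrow> complex mat) \<Rightarrow> complex) \<Rightarrow> ('g \<Rightarrow> complex mat) \<Rightarrow> complex" where
  "aut_act m G \<sigma> f = (\<lambda>\<rho>\<in>reps m G. f (compose (carrier G) \<rho> \<sigma>))"

definition gr_aut_act :: "nat \<Rightarrow> ('g, 'b) monoid_scheme \<Rightarrow> nat \<Rightarrow> (nat \<Rightarrow> 'g) \<Rightarrow> nat \<Rightarrow> ('g \<Rightarrow> 'g) \<Rightarrow>
    (('g \<Rightarrow> complex mat) \<Rightarrow> complex) set \<Rightarrow> (('g \<Rightarrow> complex mat) \<Rightarrow> complex) set" where
  "gr_aut_act m G n x k \<sigma> =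
     quot_map ((rep_ring m G)\<lparr>carrier := J_power m G n x k\<rparr>) (J_power m G n x (Suc k))
       (aut_act m G \<sigma>)"

text \<open>An automorphism of the abelianization acts on the graded quotient through any of its lifts to
  the group. The description is proper only because lifts exist and all of them act in the same
  way.\<close>

definition gr_ab_act :: "nat \<Rightarrow> ('g, 'b) monoid_scheme \<Rightarrow> nat \<Rightarrow> (nat \<Rightarrow> 'g) \<Rightarrow> nat \<Rightarrow>
    ('g set \<Rightarrow> 'g set) \<Rightarrow>
    (('g \<Rightarrow> complex mat) \<Rightarrow> complex) set \<Rightarrow> (('g \<Rightarrow> complex mat) \<Rightarrow> complex) set" where
  "gr_ab_act m G n x k \<alpha> C =
     (THE D. \<forall>\<sigma>\<in>auto G. ab_aut G \<sigma> = \<alpha> \<longrightarrow> gr_aut_act m G n x k \<sigma> C = D)"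

definition entry_exponents :: "nat \<Rightarrow> nat \<Rightarrow> (nat \<times> nat \<Rightarrow> nat) set" where
  "entry_exponents m k =
     {e \<in> entry_positions m \<rightarrow>\<^sub>E UNIV. (\<Sum>p\<in>entry_positions m. e p) = k}"

abbreviation H_rat :: "('g, 'b) monoid_scheme \<Rightarrow> (rat, ('g set \<times> rat \<Rightarrow>\<^sub>0 rat) set) module" where
  "H_rat G \<equiv> rat_extension (abelianization G)"

definition sym_sum where
  "sym_sum m G k =
     direct_sum_family (entry_exponents m k)
       (\<lambda>e. tensor_product (entry_positions m) (\<lambda>p. symmetric_power (e p) (H_rat G)))"

definition sym_sum_act where
  "sym_sum_act m G k \<alpha> =
     direct_sum_map (entry_exponents m k)
       (\<lambda>e. tensor_map (entry_positions m) (\<lambda>p. symmetric_power (e p) (H_rat G))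
          (\<lambda>p. symmetric_power_map (e p) (H_rat G) (rat_extension_map (abelianization G) \<alpha>)))"

end

theory Submission
  imports Defs
begin

text \<open>
  Let \<open>P\<close> be the set of positions \<open>(i, j) \<noteq> (m - 1, m - 1)\<close>. The idea is that both sides of the
  isomorphism are the space of homogeneous polynomials of degree \<open>k\<close> with rational coefficients in
  variables \<open>a (p, l)\<close>, for \<open>p \<in> P\<close> and \<open>l < n\<close>, and that a matrix \<open>A\<close> acts on both by the linear
  substitution that replaces \<open>a (p, l)\<close> by the sum of the \<open>A l j * a (p, j)\<close>.

  For the graded quotient, choose for each point \<open>a\<close> a curve of representations through the trivial
  one, on which the entry of \<open>x l - 1\<close> in the position \<open>p \<in> P\<close> is \<open>t * a (p, l)\<close> up to second
  order in \<open>t\<close>; it exists because the group is free (\<open>universal_property\<close>, \<open>tendsto_sval_curve\<close>). Along it an element of the \<open>k\<close>-th power of the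
  ideal vanishes to order \<open>k\<close> (\<open>conv_J\<close>), and its coefficient of \<open>t\<^sup>k\<close> depends on the class in the graded
  quotient only. For a monomial in the \<open>s\<^bsub>ij\<^esub>(x\<^sub>l)\<close> this coefficient is the value at \<open>a\<close> of the
  same monomial in the coordinates. So the classes of the monomials are linearly independent, because
  monomial functions are (\<open>monomials_linearly_independent\<close>). That they span (\<open>J_spanned\<close>) rests on two
  facts: the ring is the sum of the rationals and the ideal (\<open>const_mod_J\<close>), and modulo the square of
  the ideal the equation \<open>det = 1\<close> says that the trace of \<open>S(y) = (s\<^bsub>ij\<^esub>(y))\<close> is zero
  (\<open>trace_mod_J2\<close>), which eliminates the position \<open>(m - 1, m - 1)\<close>.

  For the direct sum of tensor products of symmetric powers, the exponent sums of the classes in the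
  abelianization, weighted with the coordinates \<open>a (p, l)\<close>, give for each \<open>p\<close> a functional on
  \<open>H\<^bsub>\<rat>\<^esub>\<close>; products of these functionals respect the relations of symmetric powers and tensor
  products. Products of the classes of the \<open>x l\<close> span, and the functionals evaluate them to monomials in
  the coordinates (\<open>monomial_space_sym_sum\<close>). No dimension has to be computed in advance: a space
  spanned by a family on which functionals take the values of independent functions has that family as a
  basis, and two spaces with families and functionals of this kind are isomorphic, compatibly with the
  functionals (\<open>monomial_spaces_isomorphic\<close>).

  The actions are compared by the functionals too. An automorphism \<open>\<sigma>\<close> of the free group acts on the
  ring by \<open>s\<^bsub>ij\<^esub>(y) \<mapsto> s\<^bsub>ij\<^esub>(\<sigma> y)\<close>, and modulo the square of the ideal \<open>s\<^bsub>ij\<^esub>\<close> is additive in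
  \<open>y\<close> (\<open>lead_sval\<close>), whence the substitution. In particular the action on the graded quotients depends
  only on the induced automorphism of the abelianization. That each integer matrix with an integer inverse
  is induced by an automorphism of the free group is Euclid's algorithm, performed by Nielsen
  transformations (\<open>left_invertible_realizable\<close>).
\<close>

section \<open>Free groups\<close>

lemma word_value_Nil [simp]: "word_value G x [] = \<one>\<^bsub>G\<^esub>"
  by (simp add: word_value_def)

lemma word_value_Cons:
  "word_value G x ((i, b) # w) =
     (if b then x i else inv\<^bsub>G\<^esub> (x i)) \<otimes>\<^bsub>G\<^esub> word_value G x w"
  by (simp add: word_value_def)

definition inv_word :: "(nat \<times> bool) list \<Rightarrow> (nat \<times> bool) list" where
  "inv_word w = rev (map (\<lambda>(i, b). (i, \<not> b)) w)"

lemma letters_inv_word [simp]: "fst ` set (inv_word w) = fst ` set w"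
  by (force simp: inv_word_def)

context group
begin

lemma word_value_closed:
  assumes "x ` I \<subseteq> carrier G" "fst ` set w \<subseteq> I"
  shows "word_value G x w \<in> carrier G"
  using assms(2)
proof (induction w)
  case (Cons c w)
  obtain i b where "c = (i, b)" by force
  with Cons assms(1) show ?case by (auto simp: word_value_Cons)
qed simp

lemma word_value_append:
  assumes "x ` I \<subseteq> carrier G" "fst ` set u \<subseteq> I" "fst ` set v \<subseteq> I"
  shows "word_value G x (u @ v) = word_value G x u \<otimes> word_value G x v"
  using assms(2)
proof (induction u)
  case Nil
  then show ?case using word_value_closed[OF assms(1,3)] by simp
next
  case (Cons c u)
  obtain i b where c: "c = (i, b)" by force
  have "x i \<in> carrier G" "word_value G x u \<in> carrier G" "word_value G x v \<in> carrier G"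
    using Cons.prems c assms word_value_closed[OF assms(1)] by auto
  then show ?case using Cons c by (simp add: word_value_Cons m_assoc)
qed

lemma word_value_inv_word:
  assumes "x ` I \<subseteq> carrier G" "fst ` set w \<subseteq> I"
  shows "word_value G x (inv_word w) = inv (word_value G x w)"
  using assms(2)
proof (induction w)
  case Nil
  then show ?case by (simp add: inv_word_def)
next
  case (Cons c w)
  obtain i b where c: "c = (i, b)" by force
  have xi: "x i \<in> carrier G" and w: "word_value G x w \<in> carrier G"
    using Cons.prems c assms(1) word_value_closed[OF assms(1)] by auto
  have "inv_word (c # w) = inv_word w @ [(i, \<not> b)]"
    by (simp add: inv_word_def c)
  then have "word_value G x (inv_word (c # w)) =
      word_value G x (inv_word w) \<otimes> word_value G x [(i, \<not> b)]"
    using Cons.prems c by (simp add: word_value_append[OF assms(1)])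
  also have "\<dots> = inv (word_value G x (c # w))"
    using Cons c xi w by (auto simp: word_value_Cons inv_mult_group)
  finally show ?case .
qed

lemma word_value_cancel:
  assumes "x ` I \<subseteq> carrier G" "fst ` set u \<subseteq> I" "fst ` set v \<subseteq> I" "i \<in> I"
  shows "word_value G x (u @ (i, b) # (i, \<not> b) # v) = word_value G x (u @ v)"
proof -
  have "x i \<in> carrier G" "word_value G x v \<in> carrier G"
    using assms word_value_closed[OF assms(1)] by auto
  then have "word_value G x ((i, b) # (i, \<not> b) # v) = word_value G x v"
    by (auto simp: word_value_Cons m_assoc[symmetric])
  then show ?thesis
    using assms by (simp add: word_value_append[OF assms(1)])
qed

lemma generate_word_value:
  assumes "x ` I \<subseteq> carrier G" "y \<in> generate G (x ` I)"
  shows "\<exists>w. fst ` set w \<subseteq> I \<and> word_value G x w = y"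
  using assms(2)
proof induction
  case one
  then show ?case by (intro exI[of _ "[]"]) simp
next
  case (incl h)
  then obtain i where "i \<in> I" "h = x i" by auto
  then show ?case using assms(1)
    by (intro exI[of _ "[(i, True)]"]) (auto simp: word_value_Cons)
next
  case (inv h)
  then obtain i where "i \<in> I" "h = x i" by auto
  then show ?case using assms(1)
    by (intro exI[of _ "[(i, False)]"]) (auto simp: word_value_Cons)
next
  case (eng h1 h2)
  then obtain u v where "fst ` set u \<subseteq> I" "word_value G x u = h1"
    "fst ` set v \<subseteq> I" "word_value G x v = h2" by blast
  then show ?case
    by (intro exI[of _ "u @ v"]) (auto simp: word_value_append[OF assms(1)])
qed

end

lemma not_reduced_wordE:
  assumes "\<not> reduced_word w"
  obtains u i b v where "w = u @ (i, b) # (i, \<not> b) # v"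
proof -
  from assms obtain t where t: "Suc t < length w" "fst (w ! t) = fst (w ! Suc t)"
      "snd (w ! t) \<noteq> snd (w ! Suc t)"
    by (auto simp: reduced_word_def)
  have "w = take t w @ w ! t # w ! Suc t # drop (Suc (Suc t)) w"
    using t(1) by (metis Cons_nth_drop_Suc Suc_lessD append_take_drop_id)
  moreover have "w ! Suc t = (fst (w ! t), \<not> snd (w ! t))"
    using t(2,3) by (simp add: prod_eq_iff)
  ultimately show thesis
    using that by (metis prod.collapse)
qed

locale free_basis = group G for G (structure) +
  fixes n :: nat and x :: "nat \<Rightarrow> 'a"
  assumes free: "free_group_with_basis G n x"
begin

lemma x_closed [simp, intro]: "i < n \<Longrightarrow> x i \<in> carrier G"
  using free by (auto simp: free_group_with_basis_def)

lemma x_image: "x ` {..<n} \<subseteq> carrier G"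
  by auto

lemma generate_x: "generate G (x ` {..<n}) = carrier G"
  using free by (simp add: free_group_with_basis_def)

text \<open>A word representing \<open>\<one>\<close> in the free group is empty or contains a cancelling pair of letters,
  and deleting that pair changes its value in no group.\<close>

lemma word_value_one_transfer:
  assumes H: "group H" "h ` {..<n} \<subseteq> carrier H"
    and w: "fst ` set w \<subseteq> {..<n}" "word_value G x w = \<one>"
  shows "word_value H h w = \<one>\<^bsub>H\<^esub>"
  using w
proof (induction w rule: length_induct)
  case (1 w)
  show ?case
  proof (cases "w = []")
    case False
    then have "\<not> reduced_word w"
      using 1 free by (auto simp: free_group_with_basis_def)
    then obtain u i b v where w: "w = u @ (i, b) # (i, \<not> b) # v"
      by (rule not_reduced_wordE)
    have l: "fst ` set u \<subseteq> {..<n}" "fst ` set v \<subseteq> {..<n}" "i \<in> {..<n}"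
      using 1(2) w by auto
    have "word_value G x (u @ v) = \<one>"
      using 1(3) w word_value_cancel[OF x_image l] by simp
    then have "word_value H h (u @ v) = \<one>\<^bsub>H\<^esub>"
      using 1(1)[rule_format, of "u @ v"] l w by (simp add: image_Un)
    then show ?thesis
      using w group.word_value_cancel[OF H l] by simp
  qed simp
qed

text \<open>The value of a word representing an element does not depend on the word, by the previous lemma
  applied to quotients of words.\<close>

lemma universal_property:
  assumes H: "group H" "\<And>i. i < n \<Longrightarrow> h i \<in> carrier H"
  shows "\<exists>\<phi>\<in>hom G H. \<forall>i<n. \<phi> (x i) = h i"
proof -
  interpret H: group H by fact
  have hH: "h ` {..<n} \<subseteq> carrier H" using H(2) by auto
  define W where "W y w \<longleftrightarrow> fst ` set w \<subseteq> {..<n} \<and> word_value G x w = y" for y w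
  have ex: "\<exists>w. W y w" if "y \<in> carrier G" for y
    using generate_word_value[OF x_image] that generate_x by (auto simp: W_def)
  have uniq: "word_value H h u = word_value H h v" if "W y u" "W y v" for y u v
  proof -
    have y: "y \<in> carrier G" using that word_value_closed[OF x_image] by (auto simp: W_def)
    have l: "fst ` set (u @ inv_word v) \<subseteq> {..<n}"
      using that by (auto simp: W_def image_Un)
    have "word_value G x (u @ inv_word v) = \<one>"
      using that y by (simp add: W_def word_value_append[OF x_image] word_value_inv_word[OF x_image])
    from word_value_one_transfer[OF H(1) hH l this]
    have "word_value H h u \<otimes>\<^bsub>H\<^esub> inv\<^bsub>H\<^esub> word_value H h v = \<one>\<^bsub>H\<^esub>"
      using that by (simp add: W_def H.word_value_append[OF hH] H.word_value_inv_word[OF hH])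
    moreover have "word_value H h u \<in> carrier H" "word_value H h v \<in> carrier H"
      using that H.word_value_closed[OF hH] by (auto simp: W_def)
    ultimately show ?thesis
      by (metis H.inv_equality H.inv_inv H.inv_closed)
  qed
  define \<phi> where "\<phi> y = word_value H h (SOME w. W y w)" for y
  have \<phi>: "\<phi> y = word_value H h w" if "W y w" for y w
    unfolding \<phi>_def using that uniq someI[of "W y"] by blast
  show ?thesis
  proof (intro bexI ballI allI impI)
    fix i assume "i < n"
    then have "W (x i) [(i, True)]" by (simp add: W_def word_value_Cons)
    from \<phi>[OF this] show "\<phi> (x i) = h i"
      using H(2) \<open>i < n\<close> by (simp add: word_value_Cons)
  next
    show "\<phi> \<in> hom G H"
    proof (rule homI)
      fix y assume "y \<in> carrier G"
      with ex obtain w where "W y w" by blast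
      with \<phi> H.word_value_closed[OF hH] show "\<phi> y \<in> carrier H" by (auto simp: W_def)
    next
      fix y z assume "y \<in> carrier G" "z \<in> carrier G"
      with ex obtain u v where uv: "W y u" "W z v" by blast
      then have "W (y \<otimes> z) (u @ v)"
        by (auto simp: W_def word_value_append[OF x_image])
      then have "\<phi> (y \<otimes> z) = word_value H h (u @ v)" by (rule \<phi>)
      then show "\<phi> (y \<otimes> z) = \<phi> y \<otimes>\<^bsub>H\<^esub> \<phi> z"
        using uv \<phi>[OF uv(1)] \<phi>[OF uv(2)] by (simp add: W_def H.word_value_append[OF hH])
    qed
  qed
qed

lemma generator_induct [consumes 1, case_names one gen inv mult]:
  assumes "y \<in> carrier G" and "P \<one>" and "\<And>i. i < n \<Longrightarrow> P (x i)"
    and "\<And>i. i < n \<Longrightarrow> P (inv (x i))"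
    and "\<And>y z. \<lbrakk>y \<in> carrier G; z \<in> carrier G; P y; P z\<rbrakk> \<Longrightarrow> P (y \<otimes> z)"
  shows "P y"
proof -
  have "y \<in> generate G (x ` {..<n})" using assms(1) generate_x by simp
  then have "y \<in> carrier G \<and> P y"
    by induction (use assms in auto)
  then show ?thesis ..
qed

lemma hom_eqI:
  assumes "group H" "\<phi> \<in> hom G H" "\<psi> \<in> hom G H" "\<And>i. i < n \<Longrightarrow> \<phi> (x i) = \<psi> (x i)"
    and y: "y \<in> carrier G"
  shows "\<phi> y = \<psi> y"
proof -
  interpret p: group_hom G H \<phi> using assms by (simp add: group_hom_def group_hom_axioms_def)
  interpret q: group_hom G H \<psi> using assms by (simp add: group_hom_def group_hom_axioms_def)
  from y show ?thesis
    by (induction rule: generator_induct) (simp_all add: assms(4))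
qed

subsection \<open>Exponent sums and the abelianization\<close>

definition expo :: "nat \<Rightarrow> 'a \<Rightarrow> int" where
  "expo j = (SOME \<phi>. \<phi> \<in> hom G integer_group \<and> (\<forall>i<n. \<phi> (x i) = (if i = j then 1 else 0)))"

lemma expo_hom: "expo j \<in> hom G integer_group"
  and expo_x: "i < n \<Longrightarrow> expo j (x i) = (if i = j then 1 else 0)"
proof -
  have "\<exists>\<phi>. \<phi> \<in> hom G integer_group \<and> (\<forall>i<n. \<phi> (x i) = (if i = j then 1 else 0))"
    using universal_property[of integer_group "\<lambda>i. if i = j then 1 else 0"] by (simp add: Bex_def)
  from someI_ex[OF this] show "expo j \<in> hom G integer_group"
    "i < n \<Longrightarrow> expo j (x i) = (if i = j then 1 else 0)"
    unfolding expo_def by blast+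
qed

interpretation expo: group_hom G integer_group "expo j" for j
  using expo_hom by (simp add: group_hom_def group_hom_axioms_def)

lemma expo_mult: "\<lbrakk>y \<in> carrier G; z \<in> carrier G\<rbrakk> \<Longrightarrow> expo j (y \<otimes> z) = expo j y + expo j z"
  using expo.hom_mult[of y z j] by simp

lemma expo_inv: "y \<in> carrier G \<Longrightarrow> expo j (inv y) = - expo j y"
  using expo.hom_inv[of y j] by simp

lemma hom_integer_expand:
  assumes f: "f \<in> hom G integer_group" and y: "y \<in> carrier G"
  shows "f y = (\<Sum>i<n. expo i y * f (x i))"
proof -
  have "(\<lambda>y. \<Sum>i<n. expo i y * f (x i)) \<in> hom G integer_group"
    by (rule homI) (simp_all add: expo_mult sum.distrib algebra_simps)
  then show ?thesis
  proof (rule hom_eqI[OF group_integer_group f _ _ y, where \<psi> = "\<lambda>y. \<Sum>i<n. expo i y * f (x i)"])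
    fix k assume "k < n"
    have "(\<Sum>i<n. expo i (x k) * f (x i)) = (\<Sum>i<n. if i = k then f (x k) else 0)"
      by (rule sum.cong) (use \<open>k < n\<close> in \<open>auto simp: expo_x\<close>)
    then show "f (x k) = (\<Sum>i<n. expo i (x k) * f (x i))" using \<open>k < n\<close> by simp
  qed
qed

lemma expo_hom_endo:
  assumes "\<sigma> \<in> hom G G" "y \<in> carrier G"
  shows "expo j (\<sigma> y) = (\<Sum>i<n. expo i y * expo j (\<sigma> (x i)))"
proof -
  have "(\<lambda>y. expo j (\<sigma> y)) \<in> hom G integer_group"
    using assms(1) expo_hom[of j] by (auto simp: hom_def Pi_iff)
  from hom_integer_expand[OF this assms(2)] show ?thesis .
qed

abbreviation "Gder \<equiv> derived G (carrier G)"

lemma Gder_normal: "Gder \<lhd> G"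
  by (rule derived_self_is_normal)

interpretation D: normal Gder G
  by (rule Gder_normal)

lemma expo_derived:
  assumes "d \<in> Gder"
  shows "expo j d = 0"
proof -
  from assms have "d \<in> carrier G \<and> expo j d = 0"
    unfolding derived_def
  proof (induction)
    case (incl h)
    then show ?case by (auto simp: expo_mult expo_inv)
  next
    case (inv h)
    then show ?case by (auto simp: expo_mult expo_inv)
  qed (auto simp: expo_mult expo_inv)
  then show ?thesis ..
qed

lemma expo_coset:
  assumes "y \<in> carrier G" "z \<in> ab_class G y"
  shows "expo j z = expo j y"
proof -
  obtain d where "d \<in> Gder" "z = d \<otimes> y"
    using assms by (auto simp: ab_class_def r_coset_def)
  then show ?thesis
    using assms expo_derived[of d] D.subset by (auto simp: expo_mult)
qed

abbreviation "Gab \<equiv> abelianization G"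

lemma ab_comm_group: "comm_group Gab"
  unfolding abelianization_def by (rule derived_quot_is_comm_group)

interpretation ab: comm_group Gab
  by (rule ab_comm_group)

lemma ab_class_self: "y \<in> carrier G \<Longrightarrow> y \<in> ab_class G y"
  unfolding ab_class_def by (rule rcos_self[OF _ D.subgroup_axioms])

lemma ab_class_hom: "ab_class G \<in> hom G Gab"
  unfolding ab_class_def abelianization_def by (rule D.r_coset_hom_Mod)

lemma ab_class_closed [simp]: "y \<in> carrier G \<Longrightarrow> ab_class G y \<in> carrier Gab"
  using ab_class_hom by (auto simp: hom_def)

lemma carrier_ab: "carrier Gab = ab_class G ` carrier G"
  by (auto simp: abelianization_def FactGroup_def RCOSETS_def ab_class_def)

text \<open>Both sides are homomorphisms to the abelianization that agree on the basis.\<close>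

lemma ab_class_expand:
  assumes y: "y \<in> carrier G"
  shows "ab_class G y = (\<Otimes>\<^bsub>Gab\<^esub>j\<in>{..<n}. ab_class G (x j) [^]\<^bsub>Gab\<^esub> expo j y)"
proof (rule hom_eqI[OF ab.group_axioms ab_class_hom _ _ y,
      where \<psi> = "\<lambda>y. \<Otimes>\<^bsub>Gab\<^esub>j\<in>{..<n}. ab_class G (x j) [^]\<^bsub>Gab\<^esub> expo j y"])
  show "(\<lambda>y. \<Otimes>\<^bsub>Gab\<^esub>j\<in>{..<n}. ab_class G (x j) [^]\<^bsub>Gab\<^esub> expo j y) \<in> hom G Gab"
  proof (rule homI)
    fix y z assume yz: "y \<in> carrier G" "z \<in> carrier G"
    have "(\<Otimes>\<^bsub>Gab\<^esub>j\<in>{..<n}. ab_class G (x j) [^]\<^bsub>Gab\<^esub> expo j (y \<otimes> z)) =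
        (\<Otimes>\<^bsub>Gab\<^esub>j\<in>{..<n}. ab_class G (x j) [^]\<^bsub>Gab\<^esub> expo j y \<otimes>\<^bsub>Gab\<^esub>
           ab_class G (x j) [^]\<^bsub>Gab\<^esub> expo j z)"
      by (rule ab.finprod_cong') (simp_all add: yz expo_mult ab.int_pow_mult)
    also have "\<dots> = (\<Otimes>\<^bsub>Gab\<^esub>j\<in>{..<n}. ab_class G (x j) [^]\<^bsub>Gab\<^esub> expo j y) \<otimes>\<^bsub>Gab\<^esub>
        (\<Otimes>\<^bsub>Gab\<^esub>j\<in>{..<n}. ab_class G (x j) [^]\<^bsub>Gab\<^esub> expo j z)"
      by (rule ab.finprod_multf) auto
    finally show "(\<Otimes>\<^bsub>Gab\<^esub>j\<in>{..<n}. ab_class G (x j) [^]\<^bsub>Gab\<^esub> expo j (y \<otimes> z)) = \<dots>" .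
  qed (auto intro!: ab.finprod_closed)
next
  fix i assume i: "i < n"
  have "(\<Otimes>\<^bsub>Gab\<^esub>j\<in>{..<n}. ab_class G (x j) [^]\<^bsub>Gab\<^esub> expo j (x i)) =
    (\<Otimes>\<^bsub>Gab\<^esub>j\<in>{..<n}. if i = j then ab_class G (x j) else \<one>\<^bsub>Gab\<^esub>)"
    by (rule ab.finprod_cong') (use i in \<open>auto simp: expo_x ab.int_pow_1\<close>)
  also have "\<dots> = ab_class G (x i)"
    using i by (subst ab.finprod_singleton) auto
  finally show "ab_class G (x i) = (\<Otimes>\<^bsub>Gab\<^esub>j\<in>{..<n}. ab_class G (x j) [^]\<^bsub>Gab\<^esub> expo j (x i))" ..
qed

subsection \<open>Lifting integer matrices to automorphisms\<close>

text \<open>Made extensional, as the elements of \<open>auto G\<close> are.\<close>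

definition endo :: "(nat \<Rightarrow> 'a) \<Rightarrow> 'a \<Rightarrow> 'a" where
  "endo h = (\<lambda>y\<in>carrier G. (SOME \<phi>. \<phi> \<in> hom G G \<and> (\<forall>i<n. \<phi> (x i) = h i)) y)"

lemma
  assumes "\<And>i. i < n \<Longrightarrow> h i \<in> carrier G"
  shows endo_hom: "endo h \<in> hom G G"
    and endo_x: "i < n \<Longrightarrow> endo h (x i) = h i"
proof -
  have "\<exists>\<phi>. \<phi> \<in> hom G G \<and> (\<forall>i<n. \<phi> (x i) = h i)"
    using universal_property[OF is_group, of h] assms by (auto simp: Bex_def)
  from someI_ex[OF this] show "endo h \<in> hom G G" "i < n \<Longrightarrow> endo h (x i) = h i"
    by (simp_all add: endo_def hom_def Pi_iff)
qed

text \<open>Two endomorphisms that invert each other on the basis are inverse automorphisms.\<close>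

lemma endo_auto:
  assumes h: "\<And>i. i < n \<Longrightarrow> h i \<in> carrier G" and h': "\<And>i. i < n \<Longrightarrow> h' i \<in> carrier G"
    and inv1: "\<And>i. i < n \<Longrightarrow> endo h (h' i) = x i" and inv2: "\<And>i. i < n \<Longrightarrow> endo h' (h i) = x i"
  shows "endo h \<in> auto G"
proof -
  have c: "endo h \<in> carrier G \<rightarrow> carrier G" "endo h' \<in> carrier G \<rightarrow> carrier G"
    using endo_hom[of h] endo_hom[of h'] h h' by (auto simp: hom_def)
  have id: "(\<lambda>y. y) \<in> hom G G" by (simp add: hom_def)
  have "endo h (endo h' y) = y" if "y \<in> carrier G" for y
    by (rule hom_eqI[OF is_group _ id _ that, where \<phi> = "\<lambda>y. endo h (endo h' y)"])
      (use endo_hom[of h] endo_hom[of h'] h h' inv1 endo_x[of h'] in \<open>auto simp: hom_def Pi_iff\<close>)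
  moreover have "endo h' (endo h y) = y" if "y \<in> carrier G" for y
    by (rule hom_eqI[OF is_group _ id _ that, where \<phi> = "\<lambda>y. endo h' (endo h y)"])
      (use endo_hom[of h] endo_hom[of h'] h h' inv2 endo_x[of h] in \<open>auto simp: hom_def Pi_iff\<close>)
  ultimately have "bij_betw (endo h) (carrier G) (carrier G)"
    using c by (intro bij_betwI[where g = "endo h'"]) auto
  then show ?thesis
    using endo_hom[of h] h by (simp add: auto_def Bij_def endo_def)
qed

text \<open>Integer matrices are functions here, as only the entries below \<open>n\<close> matter and row operations
  become function updates.\<close>

definition realizes :: "('a \<Rightarrow> 'a) \<Rightarrow> (nat \<Rightarrow> nat \<Rightarrow> int) \<Rightarrow> bool" where
  "realizes \<sigma> A \<longleftrightarrow> \<sigma> \<in> auto G \<and> (\<forall>i<n. \<forall>j<n. expo j (\<sigma> (x i)) = A i j)"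

lemma auto_closed: "\<lbrakk>\<sigma> \<in> auto G; y \<in> carrier G\<rbrakk> \<Longrightarrow> \<sigma> y \<in> carrier G"
  by (auto simp: auto_def hom_def)

lemma auto_comp:
  assumes "\<sigma> \<in> auto G" "\<tau> \<in> auto G"
  shows "compose (carrier G) \<sigma> \<tau> \<in> auto G"
proof -
  have "compose (carrier G) \<sigma> \<tau> \<in> hom G G"
    using assms by (auto simp: auto_def hom_def compose_def Pi_iff)
  then show ?thesis
    using assms compose_Bij by (auto simp: auto_def)
qed

text \<open>Exponent sums turn the composition of endomorphisms into a product of matrices: precomposing
  \<open>\<sigma>\<close> with \<open>endo h\<close> performs row operations on the matrix of \<open>\<sigma>\<close>.\<close>

lemma realizes_comp_endo:
  assumes \<sigma>: "realizes \<sigma> A'" and h: "\<And>i. i < n \<Longrightarrow> h i \<in> carrier G" and au: "endo h \<in> auto G"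
    and A: "\<And>i j. \<lbrakk>i < n; j < n\<rbrakk> \<Longrightarrow> A i j = (\<Sum>k<n. expo k (h i) * A' k j)"
  shows "\<exists>\<sigma>. realizes \<sigma> A"
proof (intro exI)
  have \<sigma>': "\<sigma> \<in> auto G" using \<sigma> by (simp add: realizes_def)
  have "expo j (\<sigma> (h i)) = A i j" if ij: "i < n" "j < n" for i j
  proof -
    have "expo j (\<sigma> (h i)) = (\<Sum>k<n. expo k (h i) * expo j (\<sigma> (x k)))"
      by (rule expo_hom_endo) (use \<sigma>' h ij in \<open>auto simp: auto_def\<close>)
    then show ?thesis using \<sigma> A ij by (simp add: realizes_def)
  qed
  then show "realizes (compose (carrier G) \<sigma> (endo h)) A"
    using auto_comp[OF \<sigma>' au] by (simp add: realizes_def compose_def endo_x h)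
qed

text \<open>The row operation is undone by the Nielsen transformation \<open>x i \<mapsto> x i (x k)\<^sup>-\<^sup>c\<close>.\<close>

lemma realizes_transvection:
  assumes \<sigma>: "realizes \<sigma> (A(i := \<lambda>j. A i j + c * A k j))" and ik: "i < n" "k < n" "i \<noteq> k"
  shows "\<exists>\<sigma>. realizes \<sigma> A"
proof -
  define h where "h d = x(i := x i \<otimes> x k [^] (d::int))" for d
  have h: "h d l \<in> carrier G" if "l < n" for d l
    using that ik by (simp add: h_def)
  have inverse: "endo (h d) (h (- d) l) = x l" if l: "l < n" for d l
  proof (cases "l = i")
    case False
    then show ?thesis using l endo_x[of "h d" l, OF h] by (simp add: h_def)
  next
    case True
    interpret e: group_hom G G "endo (h d)"
      using endo_hom[of "h d", OF h] by (simp add: group_hom_def group_hom_axioms_def)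
    have "endo (h d) (x i \<otimes> x k [^] (- d)) = endo (h d) (x i) \<otimes> endo (h d) (x k) [^] (- d)"
      using ik by (simp add: e.hom_int_pow)
    also have "\<dots> = x i \<otimes> x k [^] d \<otimes> x k [^] (- d)"
      using ik endo_x[of "h d", OF h] by (simp add: h_def)
    also have "\<dots> = x i"
      using ik by (simp add: m_assoc int_pow_mult[symmetric])
    finally show ?thesis using True by (simp add: h_def)
  qed
  have "endo (h (- c)) \<in> auto G"
    by (rule endo_auto[of "h (- c)" "h c"]) (use h inverse[of _ "- c"] inverse[of _ c] in auto)
  moreover have "A l j = (\<Sum>r<n. expo r (h (- c) l) * (A(i := \<lambda>j. A i j + c * A k j)) r j)"
    if "l < n" for l j
  proof -
    have ex: "expo r (x l) = (if r = l then 1 else 0)" for r using that by (simp add: expo_x eq_commute)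
    have exi: "expo r (x i \<otimes> x k [^] (- c)) = (if r = i then 1 else 0) + (- c) * (if r = k then 1 else 0)" for r
      using ik expo.hom_int_pow[of "x k" r "- c"] by (simp add: expo_mult expo_x eq_commute)
    show ?thesis
    proof (cases "l = i")
      case True
      have "(\<Sum>r<n. expo r (h (- c) l) * (A(i := \<lambda>j. A i j + c * A k j)) r j) =
        (\<Sum>r<n. (if r = i then A i j + c * A k j else 0) - (if r = k then c * A k j else 0))"
        by (rule sum.cong) (use True ik in \<open>auto simp: h_def exi\<close>)
      then show ?thesis using True ik by (simp add: sum_subtractf)
    next
      case False
      have "(\<Sum>r<n. expo r (h (- c) l) * (A(i := \<lambda>j. A i j + c * A k j)) r j) =
        (\<Sum>r<n. if r = l then A l j else 0)"
        by (rule sum.cong) (use False ik in \<open>auto simp: h_def ex\<close>)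
      then show ?thesis using that by simp
    qed
  qed
  ultimately show ?thesis
    by (intro realizes_comp_endo[OF \<sigma>, of "h (- c)"] h) auto
qed

lemma realizes_sign:
  assumes \<sigma>: "realizes \<sigma> (A(i := \<lambda>j. - A i j))" and i: "i < n"
  shows "\<exists>\<sigma>. realizes \<sigma> A"
proof -
  define h where "h = x(i := inv (x i))"
  have h: "h l \<in> carrier G" if "l < n" for l
    using that i by (simp add: h_def)
  interpret e: group_hom G G "endo h"
    using endo_hom[of h, OF h] by (simp add: group_hom_def group_hom_axioms_def)
  have inverse: "endo h (h l) = x l" if l: "l < n" for l
    using l i endo_x[of h, OF h] by (auto simp: h_def e.hom_inv[unfolded h_def])
  have "endo h \<in> auto G"
    using endo_auto[of h h, OF h h inverse inverse] .
  moreover have "A l j = (\<Sum>r<n. expo r (h l) * (A(i := \<lambda>j. - A i j)) r j)" if "l < n" for l j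
  proof -
    have ex: "expo r (x l) = (if r = l then 1 else 0)" for r using that by (simp add: expo_x eq_commute)
    have exi: "expo r (inv (x i)) = - (if r = i then 1 else 0)" for r
      using i by (simp add: expo_inv expo_x eq_commute)
    have "(\<Sum>r<n. expo r (h l) * (A(i := \<lambda>j. - A i j)) r j) = (\<Sum>r<n. if r = l then A l j else 0)"
      by (rule sum.cong) (auto simp: h_def ex exi)
    then show ?thesis using that by simp
  qed
  ultimately show ?thesis
    by (intro realizes_comp_endo[OF \<sigma>, of h] h) auto
qed

text \<open>One-sided invertibility is enough to find units in the reduction, and is easy to carry along.\<close>

definition left_invertible :: "(nat \<Rightarrow> nat \<Rightarrow> int) \<Rightarrow> bool" where
  "left_invertible A \<longleftrightarrow>
     (\<exists>B. \<forall>r<n. \<forall>j<n. (\<Sum>i<n. B r i * A i j) = (if r = j then 1 else 0))"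

lemma left_invertible_transvection:
  assumes "left_invertible A" and ik: "i < n" "k < n" "i \<noteq> k"
  shows "left_invertible (A(i := \<lambda>j. A i j + c * A k j))"
proof -
  from assms obtain B where B: "\<And>r j. \<lbrakk>r < n; j < n\<rbrakk> \<Longrightarrow> (\<Sum>i<n. B r i * A i j) = (if r = j then 1 else 0)"
    by (auto simp: left_invertible_def)
  define B' where "B' r = (B r)(k := B r k - c * B r i)" for r
  have "(\<Sum>l<n. B' r l * (A(i := \<lambda>j. A i j + c * A k j)) l j) = (\<Sum>l<n. B r l * A l j)" for r j
  proof -
    have "(\<Sum>l<n. B' r l * (A(i := \<lambda>j. A i j + c * A k j)) l j) =
      (\<Sum>l<n. B r l * A l j + (if l = i then c * B r i * A k j else 0) - (if l = k then c * B r i * A k j else 0))"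
      by (rule sum.cong) (use ik in \<open>auto simp: B'_def algebra_simps\<close>)
    also have "\<dots> = (\<Sum>l<n. B r l * A l j)"
      using ik by (simp add: sum.distrib sum_subtractf)
    finally show ?thesis .
  qed
  with B show ?thesis unfolding left_invertible_def by (intro exI[of _ B']) simp
qed

lemma left_invertible_sign:
  assumes "left_invertible A" and i: "i < n"
  shows "left_invertible (A(i := \<lambda>j. - A i j))"
proof -
  from assms obtain B where B: "\<And>r j. \<lbrakk>r < n; j < n\<rbrakk> \<Longrightarrow> (\<Sum>i<n. B r i * A i j) = (if r = j then 1 else 0)"
    by (auto simp: left_invertible_def)
  define B' where "B' r = (B r)(i := - B r i)" for r
  have "(\<Sum>l<n. B' r l * (A(i := \<lambda>j. - A i j)) l j) = (\<Sum>l<n. B r l * A l j)" for r j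
    by (rule sum.cong) (auto simp: B'_def)
  with B show ?thesis unfolding left_invertible_def by (intro exI[of _ B']) simp
qed

definition unit_columns :: "nat \<Rightarrow> (nat \<Rightarrow> nat \<Rightarrow> int) \<Rightarrow> bool" where
  "unit_columns c A \<longleftrightarrow> (\<forall>i<n. \<forall>j<c. A i j = (if i = j then 1 else 0))"

lemma unit_columns_transvection:
  assumes "unit_columns c A" "c \<le> k" "k < n" "i < n"
  shows "unit_columns c (A(i := \<lambda>j. A i j + d * A k j))"
  using assms by (auto simp: unit_columns_def)

text \<open>With a pivot \<open>1\<close> in place, transvections clear the rest of its column.\<close>

lemma clear_column:
  assumes IH: "\<And>A. \<lbrakk>left_invertible A; unit_columns (Suc c) A\<rbrakk> \<Longrightarrow> \<exists>\<sigma>. realizes \<sigma> A"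
    and c: "c < n"
    and A: "left_invertible A" "unit_columns c A" "A c c = 1"
  shows "\<exists>\<sigma>. realizes \<sigma> A"
  using A
proof (induction "card {i. i < n \<and> i \<noteq> c \<and> A i c \<noteq> 0}" arbitrary: A rule: less_induct)
  case less
  show ?case
  proof (cases "\<exists>i<n. i \<noteq> c \<and> A i c \<noteq> 0")
    case False
    with less.prems c have "unit_columns (Suc c) A"
      by (auto simp: unit_columns_def less_Suc_eq)
    with IH less.prems show ?thesis by blast
  next
    case True
    then obtain i where i: "i < n" "i \<noteq> c" "A i c \<noteq> 0" by blast
    define A' where "A' = A(i := \<lambda>j. A i j + (- A i c) * A c j)"
    have "{l. l < n \<and> l \<noteq> c \<and> A' l c \<noteq> 0} \<subset> {l. l < n \<and> l \<noteq> c \<and> A l c \<noteq> 0}"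
      using i less.prems(3) by (auto simp: A'_def)
    then have "card {l. l < n \<and> l \<noteq> c \<and> A' l c \<noteq> 0} < card {l. l < n \<and> l \<noteq> c \<and> A l c \<noteq> 0}"
      by (rule psubset_card_mono[rotated]) simp
    moreover have "left_invertible A'"
      unfolding A'_def using less.prems i c by (intro left_invertible_transvection) auto
    moreover have "unit_columns c A'"
      unfolding A'_def using less.prems i c by (intro unit_columns_transvection) auto
    moreover have "A' c c = 1" using i less.prems by (simp add: A'_def)
    ultimately have "\<exists>\<sigma>. realizes \<sigma> A'" by (rule less.hyps)
    then show ?thesis
      unfolding A'_def using i c realizes_transvection by blast
  qed
qed

lemma abs_reduce:
  fixes a b :: int
  assumes "b \<noteq> 0" "\<bar>b\<bar> \<le> \<bar>a\<bar>"
  shows "\<bar>a + (- sgn a * sgn b) * b\<bar> < \<bar>a\<bar>"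
  using assms by (auto simp: sgn_if abs_if split: if_splits)

text \<open>Euclid's algorithm on the entries of column \<open>c\<close> in the rows from \<open>c\<close> on leaves a single
  nonzero entry there. Left invertibility makes this entry a unit.\<close>

lemma reduce_column:
  assumes IH: "\<And>A. \<lbrakk>left_invertible A; unit_columns (Suc c) A\<rbrakk> \<Longrightarrow> \<exists>\<sigma>. realizes \<sigma> A"
    and c: "c < n"
    and A: "left_invertible A" "unit_columns c A"
  shows "\<exists>\<sigma>. realizes \<sigma> A"
  using A
proof (induction "\<Sum>i=c..<n. nat \<bar>A i c\<bar>" arbitrary: A rule: less_induct)
  case less
  show ?case
  proof (cases "\<exists>i k. c \<le> i \<and> i < n \<and> c \<le> k \<and> k < n \<and> i \<noteq> k \<and> A k c \<noteq> 0 \<and> \<bar>A k c\<bar> \<le> \<bar>A i c\<bar>")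
    case True
    then obtain i k where ik: "c \<le> i" "i < n" "c \<le> k" "k < n" "i \<noteq> k" "A k c \<noteq> 0"
      "\<bar>A k c\<bar> \<le> \<bar>A i c\<bar>" by blast
    \<comment> \<open>subtract the entry of smaller absolute value from the other one, with the sign that decreases the latter\<close>
    define A' where "A' = A(i := \<lambda>j. A i j + (- sgn (A i c) * sgn (A k c)) * A k j)"
    have "(\<Sum>l=c..<n. nat \<bar>A' l c\<bar>) < (\<Sum>l=c..<n. nat \<bar>A l c\<bar>)"
    proof (rule sum_strict_mono_ex1)
      show "\<forall>l\<in>{c..<n}. nat \<bar>A' l c\<bar> \<le> nat \<bar>A l c\<bar>"
        using abs_reduce[OF ik(6,7)] by (auto simp: A'_def)
      show "\<exists>l\<in>{c..<n}. nat \<bar>A' l c\<bar> < nat \<bar>A l c\<bar>"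
        using abs_reduce[OF ik(6,7)] ik by (intro bexI[of _ i]) (auto simp: A'_def)
    qed simp
    moreover have "left_invertible A'"
      unfolding A'_def using less.prems ik by (intro left_invertible_transvection) auto
    moreover have "unit_columns c A'"
      unfolding A'_def using less.prems ik by (intro unit_columns_transvection) auto
    ultimately have "\<exists>\<sigma>. realizes \<sigma> A'" by (rule less.hyps)
    then show ?thesis
      unfolding A'_def using ik realizes_transvection by blast
  next
    case False
    from less.prems obtain B where
      B: "\<And>r j. \<lbrakk>r < n; j < n\<rbrakk> \<Longrightarrow> (\<Sum>i<n. B r i * A i j) = (if r = j then 1 else 0)"
      by (auto simp: left_invertible_def)
    \<comment> \<open>row \<open>c\<close> of \<open>B A = 1\<close>, first in a unit column, then in column \<open>c\<close>\<close>
    have Bc: "B c j = 0" if "j < c" for j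
    proof -
      have "(\<Sum>i<n. B c i * A i j) = (\<Sum>i<n. if i = j then B c j else 0)"
        by (rule sum.cong) (use less.prems that in \<open>auto simp: unit_columns_def\<close>)
      then show ?thesis using B[of c j] that c by simp
    qed
    have one: "(\<Sum>i=c..<n. B c i * A i c) = 1"
    proof -
      have "(\<Sum>i=c..<n. B c i * A i c) = (\<Sum>i<n. B c i * A i c)"
        by (rule sum.mono_neutral_left) (auto simp: Bc)
      then show ?thesis using B[of c c] c by simp
    qed
    \<comment> \<open>the only nonzero entry below the pivots divides \<open>1\<close>\<close>
    obtain i where i: "c \<le> i" "i < n" "A i c \<noteq> 0"
    proof -
      have "\<exists>i\<in>{c..<n}. B c i * A i c \<noteq> 0"
        using one sum.neutral[of "{c..<n}" "\<lambda>i. B c i * A i c"] by fastforce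
      then show thesis using that by auto
    qed
    have zero: "A k c = 0" if "c \<le> k" "k < n" "k \<noteq> i" for k
    proof (rule ccontr)
      assume "A k c \<noteq> 0"
      then show False using False i that by (metis linorder_le_cases)
    qed
    have "(\<Sum>l=c..<n. B c l * A l c) = (\<Sum>l=c..<n. if l = i then B c i * A i c else 0)"
      by (rule sum.cong) (auto simp: zero)
    with one i have "B c i * A i c = 1" by simp
    then have unit: "A i c = 1 \<or> A i c = - 1" by (metis zmult_eq_1_iff)
    show ?thesis
    proof (cases "i = c")
      case True
      show ?thesis
      proof (cases "A c c = 1")
        case True
        with clear_column[OF IH c] less.prems show ?thesis by blast
      next
        case False
        define A' where "A' = A(c := \<lambda>j. - A c j)"
        have "left_invertible A'"
          unfolding A'_def using less.prems c by (intro left_invertible_sign)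
        moreover have "unit_columns c A'"
          using less.prems c by (auto simp: A'_def unit_columns_def)
        moreover have "A' c c = 1"
          using unit False \<open>i = c\<close> by (simp add: A'_def)
        ultimately have "\<exists>\<sigma>. realizes \<sigma> A'" using clear_column[OF IH c] by blast
        then show ?thesis unfolding A'_def using realizes_sign c by blast
      qed
    next
      case False
      \<comment> \<open>the unit is in row \<open>i\<close>, and row \<open>c\<close> has entry \<open>0\<close>; adding the unit times row \<open>i\<close> puts its square there\<close>
      define A' where "A' = A(c := \<lambda>j. A c j + A i c * A i j)"
      have "left_invertible A'"
        unfolding A'_def using less.prems i c False by (intro left_invertible_transvection) auto
      moreover have "unit_columns c A'"
        unfolding A'_def using less.prems i c by (intro unit_columns_transvection) auto
      moreover have "A' c c = 1"
        using unit zero[of c] c False by (auto simp: A'_def)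
      ultimately have "\<exists>\<sigma>. realizes \<sigma> A'" using clear_column[OF IH c] by blast
      then show ?thesis unfolding A'_def using realizes_transvection c i False by blast
    qed
  qed
qed

text \<open>Induction on the number of columns that are already unit vectors, from the identity matrix downwards.\<close>

lemma left_invertible_realizable:
  assumes "left_invertible A"
  shows "\<exists>\<sigma>. realizes \<sigma> A"
proof -
  have "\<exists>\<sigma>. realizes \<sigma> A" if "c \<le> n" "left_invertible A" "unit_columns c A" for c A
    using that
  proof (induction arbitrary: A rule: inc_induct)
    case base
    have "(\<lambda>y\<in>carrier G. y) \<in> auto G" by (rule id_in_auto)
    with base show ?case
      by (intro exI[of _ "\<lambda>y\<in>carrier G. y"]) (auto simp: realizes_def unit_columns_def expo_x simp del: restrict_apply, simp_all add: expo_x)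
  next
    case (step c)
    show ?case by (rule reduce_column[OF step.IH step.hyps(2) step.prems])
  qed
  from this[of 0] assms show ?thesis by (simp add: unit_columns_def)
qed

lemma ab_aut_class:
  assumes \<sigma>: "\<sigma> \<in> auto G" and y: "y \<in> carrier G"
  shows "ab_aut G \<sigma> (ab_class G y) = ab_class G (\<sigma> y)"
proof -
  interpret s: group_hom G G \<sigma>
    using \<sigma> by (simp add: auto_def group_hom_def group_hom_axioms_def)
  have surj: "\<sigma> ` carrier G = carrier G"
    using \<sigma> by (auto simp: auto_def Bij_def bij_betw_def)
  have "\<sigma> ` Gder = derived G (\<sigma> ` carrier G)"
    by (simp add: s.derived_img)
  then have D: "\<sigma> ` Gder = Gder" using surj by simp
  have "\<sigma> ` (ab_class G y) = (\<lambda>d. \<sigma> d \<otimes> \<sigma> y) ` Gder"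
    using y D.subset by (force simp: ab_class_def r_coset_def image_iff)
  also have "\<dots> = ab_class G (\<sigma> y)"
    using D by (force simp: ab_class_def r_coset_def)
  finally show ?thesis
    using y by (simp add: ab_aut_def)
qed

lemma ab_aut_auto:
  assumes \<sigma>: "\<sigma> \<in> auto G"
  shows "ab_aut G \<sigma> \<in> auto Gab"
proof -
  have cl: "\<sigma> y \<in> carrier G" if "y \<in> carrier G" for y
    using \<sigma> that by (rule auto_closed)
  have surj: "\<sigma> ` carrier G = carrier G"
    using \<sigma> by (auto simp: auto_def Bij_def bij_betw_def)
  have inj: "inj_on \<sigma> (carrier G)"
    using \<sigma> by (auto simp: auto_def Bij_def bij_betw_def)
  have ab: "ab_class G (y \<otimes> z) = ab_class G y \<otimes>\<^bsub>Gab\<^esub> ab_class G z"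
    if "y \<in> carrier G" "z \<in> carrier G" for y z
    using ab_class_hom that by (simp add: hom_def)
  have \<sigma>m: "\<sigma> (y \<otimes> z) = \<sigma> y \<otimes> \<sigma> z" if "y \<in> carrier G" "z \<in> carrier G" for y z
    using \<sigma> that by (auto simp: auto_def hom_def)
  have "ab_aut G \<sigma> \<in> hom Gab Gab"
  proof (rule homI)
    fix C assume "C \<in> carrier Gab"
    then show "ab_aut G \<sigma> C \<in> carrier Gab" 
      unfolding carrier_ab by (auto simp: ab_aut_class[OF \<sigma>] cl)
  next
    fix C D assume "C \<in> carrier Gab" "D \<in> carrier Gab"
    then obtain y z where yz: "y \<in> carrier G" "z \<in> carrier G" "C = ab_class G y" "D = ab_class G z"
      unfolding carrier_ab by blast
    then show "ab_aut G \<sigma> (C \<otimes>\<^bsub>Gab\<^esub> D) = ab_aut G \<sigma> C \<otimes>\<^bsub>Gab\<^esub> ab_aut G \<sigma> D"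
      by (simp add: ab[symmetric] ab_aut_class[OF \<sigma>] cl \<sigma>m)
  qed
  moreover have "ab_aut G \<sigma> ` carrier Gab = carrier Gab"
  proof -
    have "ab_aut G \<sigma> ` carrier Gab = ab_class G ` \<sigma> ` carrier G"
      unfolding carrier_ab image_image by (rule image_cong) (simp_all add: ab_aut_class[OF \<sigma>])
    then show ?thesis by (simp add: surj carrier_ab)
  qed
  moreover have "inj_on (ab_aut G \<sigma>) (carrier Gab)"
  proof (rule inj_onI)
    fix C D assume CD: "C \<in> carrier Gab" "D \<in> carrier Gab" "ab_aut G \<sigma> C = ab_aut G \<sigma> D"
    have "C \<subseteq> carrier G" "D \<subseteq> carrier G"
      using CD(1,2) D.subset unfolding carrier_ab ab_class_def r_coset_def by auto
    then show "C = D"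
      using CD inj by (simp add: ab_aut_def inj_on_image_eq_iff)
  qed
  ultimately show ?thesis
    by (simp add: auto_def Bij_def bij_betw_def ab_aut_def)
qed

lemma auto_ab_eqI:
  assumes "\<alpha> \<in> auto Gab" "\<beta> \<in> auto Gab"
    and eq: "\<And>i. i < n \<Longrightarrow> \<alpha> (ab_class G (x i)) = \<beta> (ab_class G (x i))"
  shows "\<alpha> = \<beta>"
proof
  fix C
  have *: "(\<lambda>y. \<gamma> (ab_class G y)) \<in> hom G Gab" if "\<gamma> \<in> auto Gab" for \<gamma>
    using that ab_class_hom by (auto simp: auto_def hom_def)
  show "\<alpha> C = \<beta> C"
  proof (cases "C \<in> carrier Gab")
    case True
    then obtain y where y: "y \<in> carrier G" "C = ab_class G y"
      unfolding carrier_ab by blast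
    show ?thesis
      using hom_eqI[OF ab.group_axioms *[OF assms(1)] *[OF assms(2)] eq y(1)] y(2) by simp
  next
    case False
    then show ?thesis
      using assms by (auto simp: auto_def Bij_def extensional_def)
  qed
qed

lemma GL_int_left_invertible:
  assumes "A \<in> GL_int n"
  shows "left_invertible (\<lambda>i j. A $$ (i, j))"
proof -
  from assms obtain B where A: "A \<in> carrier_mat n n" and B: "B \<in> carrier_mat n n" "B * A = 1\<^sub>m n"
    by (auto simp: GL_int_def Units_def ring_mat_def)
  have "(\<Sum>i<n. B $$ (r, i) * A $$ (i, j)) = (if r = j then 1 else 0)" if "r < n" "j < n" for r j
  proof -
    have "(B * A) $$ (r, j) = (\<Sum>i<n. B $$ (r, i) * A $$ (i, j))"
      using A B(1) that by (simp add: scalar_prod_def atLeast0LessThan)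
    then show ?thesis using B that by simp
  qed
  then show ?thesis unfolding left_invertible_def by (intro exI[of _ "\<lambda>r i. B $$ (r, i)"]) simp
qed

text \<open>A lift of the matrix to the free group induces an automorphism of the abelianization as
  described in \<open>GL_aut\<close>, and there is only one such since the classes of the basis generate.\<close>

lemma GL_aut_lift:
  assumes A: "A \<in> GL_int n"
  shows "\<exists>\<sigma>. realizes \<sigma> (\<lambda>i j. A $$ (i, j)) \<and> GL_aut G n x A = ab_aut G \<sigma>"
proof -
  obtain \<sigma> where \<sigma>: "realizes \<sigma> (\<lambda>i j. A $$ (i, j))"
    using left_invertible_realizable[OF GL_int_left_invertible[OF A]] by blast
  then have au: "\<sigma> \<in> auto G" by (simp add: realizes_def)
  have img: "ab_aut G \<sigma> (ab_class G (x i)) =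
      (\<Otimes>\<^bsub>Gab\<^esub>j\<in>{..<n}. ab_class G (x j) [^]\<^bsub>Gab\<^esub> (A $$ (i, j)))" if i: "i < n" for i
  proof -
    have "ab_aut G \<sigma> (ab_class G (x i)) = ab_class G (\<sigma> (x i))"
      using i by (simp add: ab_aut_class[OF au])
    also have "\<dots> = (\<Otimes>\<^bsub>Gab\<^esub>j\<in>{..<n}. ab_class G (x j) [^]\<^bsub>Gab\<^esub> expo j (\<sigma> (x i)))"
      using i by (intro ab_class_expand auto_closed[OF au]) simp
    also have "\<dots> = (\<Otimes>\<^bsub>Gab\<^esub>j\<in>{..<n}. ab_class G (x j) [^]\<^bsub>Gab\<^esub> (A $$ (i, j)))"
      by (rule ab.finprod_cong') (use \<sigma> i in \<open>auto simp: realizes_def\<close>)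
    finally show ?thesis .
  qed
  have "GL_aut G n x A = ab_aut G \<sigma>"
    unfolding GL_aut_def
  proof (rule the_equality)
    fix \<alpha> assume "\<alpha> \<in> auto Gab \<and> (\<forall>i<n. \<alpha> (ab_class G (x i)) =
        (\<Otimes>\<^bsub>Gab\<^esub>j\<in>{..<n}. ab_class G (x j) [^]\<^bsub>Gab\<^esub> (A $$ (i, j))))"
    then show "\<alpha> = ab_aut G \<sigma>"
      by (intro auto_ab_eqI ab_aut_auto[OF au]) (auto simp: img)
  qed (use img ab_aut_auto[OF au] in auto)
  with \<sigma> show ?thesis by blast
qed

text \<open>Exponent sums factor through the abelianization.\<close>

lemma realizes_ab_aut:
  assumes "realizes \<sigma> A" "\<tau> \<in> auto G" "ab_aut G \<tau> = ab_aut G \<sigma>"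
  shows "realizes \<tau> A"
proof -
  have au: "\<sigma> \<in> auto G" using assms by (simp add: realizes_def)
  have "expo j (\<tau> (x i)) = expo j (\<sigma> (x i))" if "i < n" for i j
  proof (rule expo_coset)
    have "ab_class G (\<tau> (x i)) = ab_class G (\<sigma> (x i))"
      using assms(3) that ab_aut_class[OF au, of "x i"] ab_aut_class[OF assms(2), of "x i"] by simp
    then show "\<tau> (x i) \<in> ab_class G (\<sigma> (x i))"
      using ab_class_self[of "\<tau> (x i)"] auto_closed[OF assms(2)] that by simp
  qed (use that auto_closed[OF au] in simp)
  with assms show ?thesis by (simp add: realizes_def)
qed

end

section \<open>Monomials and spaces spanned by them\<close>

text \<open>Induction on the variables: fixing all variables but one leaves a polynomial in one variable
  with infinitely many zeros.\<close>

lemma monomials_linearly_independent: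
  fixes c :: "('i \<Rightarrow> nat) \<Rightarrow> complex"
  assumes "finite I" "finite M" "M \<subseteq> I \<rightarrow>\<^sub>E UNIV"
    and "\<And>a :: 'i \<Rightarrow> complex. (\<Sum>\<epsilon>\<in>M. c \<epsilon> * (\<Prod>i\<in>I. a i ^ \<epsilon> i)) = 0"
    and "\<epsilon> \<in> M"
  shows "c \<epsilon> = 0"
  using assms
proof (induction I arbitrary: M c \<epsilon> rule: finite_induct)
  case empty
  then have "M = {\<epsilon>}" by (auto simp: PiE_empty_domain)
  with empty.prems(3)[of undefined] show ?case by simp
next
  case (insert i I)
  \<comment> \<open>the monomials in which variable \<open>i\<close> has the same exponent as in \<open>\<epsilon>\<close>; their sum, without that variable,
    is a coefficient of a polynomial in one variable\<close>
  define d where "d = \<epsilon> i"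
  define Md where "Md = {\<eta> \<in> M. \<eta> i = d}"
  define r where "r = (\<lambda>\<eta> :: 'i \<Rightarrow> nat. restrict \<eta> I)"
  have extend: "(r \<eta>)(i := d) = \<eta>" if "\<eta> \<in> Md" for \<eta>
    using that insert.prems(2) insert.hyps
    by (auto simp: Md_def r_def fun_eq_iff PiE_def extensional_def)
  have inj: "inj_on r Md"
    by (rule inj_onI) (metis extend)
  have fin: "finite Md" using insert.prems(1) by (simp add: Md_def)
  have "(\<Sum>\<eta>\<in>r ` Md. c (\<eta>(i := d)) * (\<Prod>j\<in>I. a j ^ \<eta> j)) = 0" for a :: "'i \<Rightarrow> complex"
  proof -
    define p where "p = (\<Sum>\<eta>\<in>M. monom (c \<eta> * (\<Prod>j\<in>I. a j ^ \<eta> j)) (\<eta> i))"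
    have "poly p X = 0" for X
    proof -
      have "(\<Prod>j\<in>insert i I. (a(i := X)) j ^ \<eta> j) = X ^ \<eta> i * (\<Prod>j\<in>I. a j ^ \<eta> j)" for \<eta>
      proof -
        have "(\<Prod>j\<in>I. (a(i := X)) j ^ \<eta> j) = (\<Prod>j\<in>I. a j ^ \<eta> j)"
          by (rule prod.cong) (use insert.hyps in auto)
        then show ?thesis using insert.hyps by simp
      qed
      then have "poly p X = (\<Sum>\<eta>\<in>M. c \<eta> * (\<Prod>j\<in>insert i I. (a(i := X)) j ^ \<eta> j))"
        by (simp add: p_def poly_sum poly_monom ac_simps)
      then show ?thesis using insert.prems(3)[of "a(i := X)"] by simp
    qed
    then have "p = 0" using poly_all_0_iff_0 by blast
    then have "0 = coeff p d" by simp
    also have "\<dots> = (\<Sum>\<eta>\<in>M. if \<eta> i = d then c \<eta> * (\<Prod>j\<in>I. a j ^ \<eta> j) else 0)"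
      by (simp add: p_def coeff_sum)
    also have "\<dots> = (\<Sum>\<eta>\<in>Md. c \<eta> * (\<Prod>j\<in>I. a j ^ \<eta> j))"
      unfolding Md_def by (rule sum.inter_filter[symmetric]) (rule insert.prems(1))
    also have "\<dots> = (\<Sum>\<eta>\<in>Md. c ((r \<eta>)(i := d)) * (\<Prod>j\<in>I. a j ^ r \<eta> j))"
      by (rule sum.cong) (simp_all add: extend, simp add: r_def)
    finally show ?thesis by (simp add: sum.reindex[OF inj])
  qed
  moreover have "r ` Md \<subseteq> I \<rightarrow>\<^sub>E UNIV" by (auto simp: r_def)
  moreover have "\<epsilon> \<in> Md" using insert.prems(4) by (simp add: Md_def d_def)
  ultimately have "c ((r \<epsilon>)(i := d)) = 0"
    using insert.IH[of "r ` Md" "\<lambda>\<eta>. c (\<eta>(i := d))" "r \<epsilon>"] fin by blast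
  with \<open>\<epsilon> \<in> Md\<close> show ?case using extend by simp
qed

text \<open>The usual axioms, stated without the record of the field of rationals; the additive inverse is
  multiplication by \<open>- 1\<close>.\<close>

lemma rat_vectorspaceI:
  fixes V :: "(rat, 'v, 'z) module_scheme"
  assumes "\<zero>\<^bsub>V\<^esub> \<in> carrier V"
    and "\<And>v w. \<lbrakk>v \<in> carrier V; w \<in> carrier V\<rbrakk> \<Longrightarrow> v \<oplus>\<^bsub>V\<^esub> w \<in> carrier V"
    and "\<And>c v. v \<in> carrier V \<Longrightarrow> c \<odot>\<^bsub>V\<^esub> v \<in> carrier V"
    and "\<And>v w. \<lbrakk>v \<in> carrier V; w \<in> carrier V\<rbrakk> \<Longrightarrow> v \<oplus>\<^bsub>V\<^esub> w = w \<oplus>\<^bsub>V\<^esub> v"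
    and "\<And>u v w. \<lbrakk>u \<in> carrier V; v \<in> carrier V; w \<in> carrier V\<rbrakk> \<Longrightarrow>
           (u \<oplus>\<^bsub>V\<^esub> v) \<oplus>\<^bsub>V\<^esub> w = u \<oplus>\<^bsub>V\<^esub> (v \<oplus>\<^bsub>V\<^esub> w)"
    and "\<And>v. v \<in> carrier V \<Longrightarrow> v \<oplus>\<^bsub>V\<^esub> \<zero>\<^bsub>V\<^esub> = v"
    and "\<And>v. v \<in> carrier V \<Longrightarrow> v \<oplus>\<^bsub>V\<^esub> (- 1) \<odot>\<^bsub>V\<^esub> v = \<zero>\<^bsub>V\<^esub>"
    and "\<And>c d v. v \<in> carrier V \<Longrightarrow> (c * d) \<odot>\<^bsub>V\<^esub> v = c \<odot>\<^bsub>V\<^esub> (d \<odot>\<^bsub>V\<^esub> v)"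
    and "\<And>v. v \<in> carrier V \<Longrightarrow> 1 \<odot>\<^bsub>V\<^esub> v = v"
    and "\<And>c d v. v \<in> carrier V \<Longrightarrow> (c + d) \<odot>\<^bsub>V\<^esub> v = c \<odot>\<^bsub>V\<^esub> v \<oplus>\<^bsub>V\<^esub> d \<odot>\<^bsub>V\<^esub> v"
    and "\<And>c v w. \<lbrakk>v \<in> carrier V; w \<in> carrier V\<rbrakk> \<Longrightarrow>
           c \<odot>\<^bsub>V\<^esub> (v \<oplus>\<^bsub>V\<^esub> w) = c \<odot>\<^bsub>V\<^esub> v \<oplus>\<^bsub>V\<^esub> c \<odot>\<^bsub>V\<^esub> w"
  shows "vectorspace class_ring V"
proof -
  have "module (class_ring :: rat ring) V"
  proof (rule module_criteria)
    show "cring (class_ring :: rat ring)"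
      by (rule fieldE(1)[OF class_field])
    show "\<forall>v\<in>carrier V. \<exists>w\<in>carrier V. v \<oplus>\<^bsub>V\<^esub> w = \<zero>\<^bsub>V\<^esub>"
      using assms(3,7) by blast
  qed (use assms in auto)
  then show ?thesis
    by (simp add: vectorspace_def class_field)
qed

text \<open>The smallest set containing \<open>S\<close> that is closed under the operations of \<open>V\<close>. In contrast to
  the span it comes with an induction rule.\<close>

inductive_set lin_gen :: "(rat, 'v, 'z) module_scheme \<Rightarrow> 'v set \<Rightarrow> 'v set" for V S where
  zero: "\<zero>\<^bsub>V\<^esub> \<in> lin_gen V S"
| base: "v \<in> S \<Longrightarrow> v \<in> lin_gen V S"
| add: "\<lbrakk>v \<in> lin_gen V S; w \<in> lin_gen V S\<rbrakk> \<Longrightarrow> v \<oplus>\<^bsub>V\<^esub> w \<in> lin_gen V S"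
| smult: "v \<in> lin_gen V S \<Longrightarrow> c \<odot>\<^bsub>V\<^esub> v \<in> lin_gen V S"

lemma lin_gen_closed:
  assumes "vectorspace class_ring V" "S \<subseteq> carrier V" "v \<in> lin_gen V S"
  shows "v \<in> carrier V"
proof -
  interpret vectorspace class_ring V by fact
  from assms(3) show ?thesis by induction (use assms(2) in auto)
qed

lemma lin_gen_subset_span:
  assumes "vectorspace class_ring V" "S \<subseteq> carrier V"
  shows "lin_gen V S \<subseteq> LinearCombinations.module.span class_ring V S"
proof
  interpret vectorspace class_ring V by fact
  interpret sp: submodule class_ring "span S" V by (rule span_is_submodule[OF assms(2)])
  fix v assume "v \<in> lin_gen V S"
  then show "v \<in> span S"
    by induction (use in_own_span[OF assms(2)] in auto)
qed

lemma span_eq_lin_gen: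
  assumes "vectorspace class_ring V" "S \<subseteq> carrier V"
  shows "LinearCombinations.module.span class_ring V S = lin_gen V S"
proof
  interpret vectorspace class_ring V by fact
  have "submodule class_ring (lin_gen V S) V"
    by (intro submodule.intro module_axioms subsetI lin_gen_closed[OF assms] lin_gen.zero lin_gen.add lin_gen.smult)
  then show "span S \<subseteq> lin_gen V S"
    by (rule span_is_subset[rotated]) (intro subsetI lin_gen.base)
qed (rule lin_gen_subset_span[OF assms])

lemma lin_gen_subset: "S \<subseteq> lin_gen V T \<Longrightarrow> lin_gen V S \<subseteq> lin_gen V T"
proof
  fix v assume "S \<subseteq> lin_gen V T" "v \<in> lin_gen V S"
  from this(2,1) show "v \<in> lin_gen V T"
    by induction (auto intro: lin_gen.intros)
qed

lemma lin_gen_mono: "S \<subseteq> T \<Longrightarrow> lin_gen V S \<subseteq> lin_gen V T"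
  by (rule lin_gen_subset) (auto intro: lin_gen.base)

text \<open>Functionals take complex values: a complex number is what evaluating a function along a
  representation yields, and linearity over the rationals is all that is needed of it.\<close>

locale functional =
  fixes V :: "(rat, 'v, 'z) module_scheme" and L :: "'v \<Rightarrow> complex"
  assumes L_add: "\<lbrakk>v \<in> carrier V; w \<in> carrier V\<rbrakk> \<Longrightarrow> L (v \<oplus>\<^bsub>V\<^esub> w) = L v + L w"
    and L_smult: "v \<in> carrier V \<Longrightarrow> L (c \<odot>\<^bsub>V\<^esub> v) = of_rat c * L v"

lemma (in vectorspace) finsum_smult_closed:
  "\<lbrakk>\<beta> \<in> M \<rightarrow> carrier V; c \<in> M \<rightarrow> carrier K\<rbrakk> \<Longrightarrow> (\<Oplus>\<^bsub>V\<^esub>\<epsilon>\<in>M. c \<epsilon> \<odot>\<^bsub>V\<^esub> \<beta> \<epsilon>) \<in> carrier V"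
  by (auto intro!: finsum_closed)

lemma functional_finsum:
  fixes V :: "(rat, 'v, 'z) module_scheme"
  assumes "vectorspace class_ring V" "functional V L" "\<beta> \<in> M \<rightarrow> carrier V"
  shows "L (\<Oplus>\<^bsub>V\<^esub>\<epsilon>\<in>M. c \<epsilon> \<odot>\<^bsub>V\<^esub> \<beta> \<epsilon>) = (\<Sum>\<epsilon>\<in>M. of_rat (c \<epsilon>) * L (\<beta> \<epsilon>))"
proof -
  interpret vectorspace class_ring V by fact
  interpret functional V L by fact
  have zero: "L \<zero>\<^bsub>V\<^esub> = 0" using L_add[of "\<zero>\<^bsub>V\<^esub>" "\<zero>\<^bsub>V\<^esub>"] by simp
  show ?thesis
    using assms(3)
  proof (induction M rule: infinite_finite_induct)
    case (insert \<epsilon> M)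
    then have "(\<lambda>\<epsilon>. c \<epsilon> \<odot>\<^bsub>V\<^esub> \<beta> \<epsilon>) \<in> M \<rightarrow> carrier V" "\<beta> \<epsilon> \<in> carrier V" by auto
    with insert show ?case by (simp add: L_add L_smult)
  qed (simp_all add: zero)
qed

text \<open>A space spanned by a finite family \<open>\<beta>\<close> which sufficiently many functionals \<open>L a\<close> show to be
  linearly independent. Its structure is determined by the values \<open>ev a \<epsilon>\<close> of the functionals on
  the family.\<close>

locale monomial_space = vectorspace class_ring V
  for V :: "(rat, 'v, 'z) module_scheme" +
  fixes M :: "'e set" and \<beta> :: "'e \<Rightarrow> 'v" and ev :: "'p \<Rightarrow> 'e \<Rightarrow> complex"
    and L :: "'p \<Rightarrow> 'v \<Rightarrow> complex"
  assumes finite_M: "finite M"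
    and \<beta>_closed: "\<beta> \<in> M \<rightarrow> carrier V"
    and generated: "carrier V \<subseteq> lin_gen V (\<beta> ` M)"
    and functional: "functional V (L a)"
    and L_\<beta>: "\<epsilon> \<in> M \<Longrightarrow> L a (\<beta> \<epsilon>) = ev a \<epsilon>"
    and independent: "\<lbrakk>\<And>a. (\<Sum>\<epsilon>\<in>M. of_rat (c \<epsilon>) * ev a \<epsilon>) = 0; \<epsilon> \<in> M\<rbrakk> \<Longrightarrow> c \<epsilon> = 0"
begin

definition comb :: "('e \<Rightarrow> rat) \<Rightarrow> 'v" where
  "comb c = (\<Oplus>\<^bsub>V\<^esub>\<epsilon>\<in>M. c \<epsilon> \<odot>\<^bsub>V\<^esub> \<beta> \<epsilon>)"

lemma comb_closed [simp]: "comb c \<in> carrier V"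
  unfolding comb_def using \<beta>_closed by (intro finsum_smult_closed) auto

lemma L_comb: "L a (comb c) = (\<Sum>\<epsilon>\<in>M. of_rat (c \<epsilon>) * ev a \<epsilon>)"
  unfolding comb_def functional_finsum[OF vectorspace_axioms functional \<beta>_closed]
  by (simp add: L_\<beta>)

lemma combE:
  assumes "v \<in> carrier V"
  obtains c where "v = comb c"
proof -
  have cl: "(\<lambda>\<epsilon>. c \<epsilon> \<odot>\<^bsub>V\<^esub> \<beta> \<epsilon>) \<in> M \<rightarrow> carrier V" for c
    using \<beta>_closed by auto
  have "v \<in> lin_gen V (\<beta> ` M)" using assms generated by blast
  then have "\<exists>c. v = comb c"
  proof induction
    case zero
    have "comb (\<lambda>_. 0) = (\<Oplus>\<^bsub>V\<^esub>\<epsilon>\<in>M. \<zero>\<^bsub>V\<^esub>)"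
      unfolding comb_def using \<beta>_closed lmult_0 by (intro finsum_cong') (auto simp: Pi_iff)
    then show ?case by (intro exI[of _ "\<lambda>_. 0"]) simp
  next
    case (base v)
    then obtain \<epsilon> where \<epsilon>: "\<epsilon> \<in> M" "v = \<beta> \<epsilon>" by blast
    have "comb (\<lambda>\<eta>. if \<eta> = \<epsilon> then 1 else 0) = (\<Oplus>\<^bsub>V\<^esub>\<eta>\<in>M. if \<epsilon> = \<eta> then \<beta> \<eta> else \<zero>\<^bsub>V\<^esub>)"
      unfolding comb_def using \<beta>_closed lmult_0 smult_one by (intro finsum_cong') (auto simp: Pi_iff)
    also have "\<dots> = \<beta> \<epsilon>"
      using \<epsilon> \<beta>_closed finite_M by (intro add.finprod_singleton) auto
    finally show ?case using \<epsilon> by metis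
  next
    case (add v w)
    then obtain c d where "v = comb c" "w = comb d" by blast
    moreover have "comb (\<lambda>\<epsilon>. c \<epsilon> + d \<epsilon>) =
        (\<Oplus>\<^bsub>V\<^esub>\<epsilon>\<in>M. c \<epsilon> \<odot>\<^bsub>V\<^esub> \<beta> \<epsilon> \<oplus>\<^bsub>V\<^esub> d \<epsilon> \<odot>\<^bsub>V\<^esub> \<beta> \<epsilon>)"
      unfolding comb_def using \<beta>_closed smult_l_distr by (intro finsum_cong') (auto simp: Pi_iff)
    moreover have "\<dots> = comb c \<oplus>\<^bsub>V\<^esub> comb d"
      unfolding comb_def by (rule finsum_addf[OF cl cl])
    ultimately have "v \<oplus>\<^bsub>V\<^esub> w = comb (\<lambda>\<epsilon>. c \<epsilon> + d \<epsilon>)" by simp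
    then show ?case by blast
  next
    case (smult v k)
    then obtain c where "v = comb c" by blast
    moreover have "comb (\<lambda>\<epsilon>. k * c \<epsilon>) = (\<Oplus>\<^bsub>V\<^esub>\<epsilon>\<in>M. k \<odot>\<^bsub>V\<^esub> (c \<epsilon> \<odot>\<^bsub>V\<^esub> \<beta> \<epsilon>))"
      unfolding comb_def using \<beta>_closed smult_assoc1 by (intro finsum_cong') (auto simp: Pi_iff)
    moreover have "k \<odot>\<^bsub>V\<^esub> comb c = \<dots>"
      unfolding comb_def by (rule finsum_smult) (use cl in auto)
    ultimately have "k \<odot>\<^bsub>V\<^esub> v = comb (\<lambda>\<epsilon>. k * c \<epsilon>)" by simp
    then show ?case by blast
  qed
  then show thesis using that by blast
qed

lemma comb_eq_iff: "comb c = comb d \<longleftrightarrow> (\<forall>\<epsilon>\<in>M. c \<epsilon> = d \<epsilon>)"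
proof
  assume "comb c = comb d"
  then have "(\<Sum>\<epsilon>\<in>M. of_rat (c \<epsilon> - d \<epsilon>) * ev a \<epsilon>) = 0" for a
    using L_comb[of a c] L_comb[of a d] by (simp add: of_rat_diff left_diff_distrib sum_subtractf)
  from independent[OF this] show "\<forall>\<epsilon>\<in>M. c \<epsilon> = d \<epsilon>" by simp
next
  assume "\<forall>\<epsilon>\<in>M. c \<epsilon> = d \<epsilon>"
  then show "comb c = comb d"
    unfolding comb_def using \<beta>_closed by (intro finsum_cong') (auto simp: Pi_iff)
qed

lemma L_determines:
  assumes "v \<in> carrier V" "w \<in> carrier V" "\<And>a. L a v = L a w"
  shows "v = w"
proof -
  obtain c d where cd: "v = comb c" "w = comb d" using assms combE by metis
  have "(\<Sum>\<epsilon>\<in>M. of_rat (c \<epsilon> - d \<epsilon>) * ev a \<epsilon>) = 0" for a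
    using assms(3)[of a] cd by (simp add: L_comb of_rat_diff left_diff_distrib sum_subtractf)
  from independent[OF this] show ?thesis by (simp add: cd comb_eq_iff)
qed

lemma inj_on_\<beta>: "inj_on \<beta> M"
proof (rule inj_onI, rule ccontr)
  fix \<epsilon> \<eta> assume *: "\<epsilon> \<in> M" "\<eta> \<in> M" "\<beta> \<epsilon> = \<beta> \<eta>" "\<epsilon> \<noteq> \<eta>"
  define c :: "'e \<Rightarrow> rat" where "c = (\<lambda>\<iota>. (if \<iota> = \<epsilon> then 1 else 0) - (if \<iota> = \<eta> then 1 else 0))"
  have "(\<Sum>\<iota>\<in>M. of_rat (c \<iota>) * ev a \<iota>) = 0" for a
  proof -
    have "(\<Sum>\<iota>\<in>M. of_rat (c \<iota>) * ev a \<iota>) =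
      (\<Sum>\<iota>\<in>M. (if \<iota> = \<epsilon> then ev a \<epsilon> else 0) - (if \<iota> = \<eta> then ev a \<eta> else 0))"
      by (rule sum.cong) (auto simp: c_def)
    also have "\<dots> = ev a \<epsilon> - ev a \<eta>" using * finite_M by (simp add: sum_subtractf)
    also have "\<dots> = 0" using L_\<beta>[of \<epsilon> a] L_\<beta>[of \<eta> a] * by simp
    finally show ?thesis .
  qed
  from independent[OF this *(1)] *(4) show False by (simp add: c_def)
qed

lemma basis_\<beta>: "basis (\<beta> ` M)"
  unfolding basis_def
proof (intro conjI)
  show sub: "\<beta> ` M \<subseteq> carrier V" using \<beta>_closed by auto
  show "span (\<beta> ` M) = carrier V"
    using span_is_subset2[OF sub] generated lin_gen_subset_span[OF vectorspace_axioms sub] by blast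
  show "lin_indpt (\<beta> ` M)"
  proof (rule finite_lin_indpt2)
    fix a :: "'v \<Rightarrow> rat" assume "lincomb a (\<beta> ` M) = \<zero>\<^bsub>V\<^esub>"
    moreover have "lincomb a (\<beta> ` M) = comb (a \<circ> \<beta>)"
      unfolding lincomb_def comb_def
      using \<beta>_closed by (subst add.finprod_reindex) (auto simp: inj_on_\<beta> Pi_iff)
    moreover have "comb (\<lambda>_. 0) = \<zero>\<^bsub>V\<^esub>"
    proof (rule L_determines)
      have "L b \<zero>\<^bsub>V\<^esub> = 0" for b
        using functional.L_add[OF functional, of "\<zero>\<^bsub>V\<^esub>" "\<zero>\<^bsub>V\<^esub>" b] by simp
      then show "L b (comb (\<lambda>_. 0)) = L b \<zero>\<^bsub>V\<^esub>" for b by (simp add: L_comb)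
    qed simp_all
    ultimately have "comb (a \<circ> \<beta>) = comb (\<lambda>_. 0)" by simp
    then show "\<forall>v\<in>\<beta> ` M. a v = \<zero>\<^bsub>class_ring\<^esub>" by (auto simp: comb_eq_iff)
  qed (use sub finite_M in auto)
qed

end

text \<open>Both spaces have the same image under their families of functionals, namely the span of the
  functions \<open>a \<mapsto> ev a \<epsilon>\<close>, and both families separate points.\<close>

lemma monomial_spaces_isomorphic:
  assumes "monomial_space V M \<beta> ev L" "monomial_space W M \<beta>' ev L'"
  shows "\<exists>\<phi>. linear_map class_ring V W \<phi> \<and> bij_betw \<phi> (carrier V) (carrier W) \<and>
    (\<forall>v\<in>carrier V. \<forall>a. L' a (\<phi> v) = L a v)"
proof -
  interpret V: monomial_space V M \<beta> ev L by fact
  interpret W: monomial_space W M \<beta>' ev L' by fact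
  have VL: "functional V (L a)" and WL: "functional W (L' a)" for a
    by (rule V.functional W.functional)+
  define \<phi> where "\<phi> v = W.comb (SOME c. v = V.comb c)" for v
  have \<phi>: "\<phi> v \<in> carrier W" "L' a (\<phi> v) = L a v" if v: "v \<in> carrier V" for v a
  proof -
    obtain c where "v = V.comb c" by (rule V.combE[OF v])
    then have "v = V.comb (SOME c. v = V.comb c)" (is "v = V.comb ?c") by (rule someI[of "\<lambda>c. v = V.comb c"])
    then have "L a v = L a (V.comb ?c)" by simp
    then show "\<phi> v \<in> carrier W" "L' a (\<phi> v) = L a v"
      by (simp_all add: \<phi>_def V.L_comb W.L_comb)
  qed
  have "\<phi> \<in> module_hom (class_ring :: rat ring) V W"
    unfolding module_hom_def
  proof (intro CollectI conjI allI impI)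
    fix v w assume "v \<in> carrier V \<and> w \<in> carrier V"
    then show "\<phi> (v \<oplus>\<^bsub>V\<^esub> w) = \<phi> v \<oplus>\<^bsub>W\<^esub> \<phi> w"
      by (intro W.L_determines) (auto simp: \<phi> functional.L_add[OF VL] functional.L_add[OF WL])
  next
    fix c :: rat and v assume "c \<in> carrier class_ring \<and> v \<in> carrier V"
    then show "\<phi> (c \<odot>\<^bsub>V\<^esub> v) = c \<odot>\<^bsub>W\<^esub> \<phi> v"
      by (intro W.L_determines) (auto simp: \<phi> functional.L_smult[OF VL] functional.L_smult[OF WL])
  qed (use \<phi> in auto)
  then have "linear_map class_ring V W \<phi>"
    by (simp add: linear_map_def mod_hom_def mod_hom_axioms_def V.vectorspace_axioms
        W.vectorspace_axioms V.module_axioms W.module_axioms)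
  moreover have "inj_on \<phi> (carrier V)"
  proof (rule inj_onI)
    fix v w assume vw: "v \<in> carrier V" "w \<in> carrier V" "\<phi> v = \<phi> w"
    have "L a v = L a w" for a
      using \<phi>(2)[OF vw(1), of a] \<phi>(2)[OF vw(2), of a] vw(3) by simp
    then show "v = w" by (rule V.L_determines[OF vw(1,2)])
  qed
  moreover have "w \<in> \<phi> ` carrier V" if w: "w \<in> carrier W" for w
  proof -
    obtain c where "w = W.comb c" by (rule W.combE[OF w])
    then have "\<phi> (V.comb c) = w"
      by (intro W.L_determines) (auto simp: \<phi> V.L_comb W.L_comb)
    then show ?thesis by (rule image_eqI[OF sym]) simp
  qed
  ultimately show ?thesis
    using \<phi> unfolding bij_betw_def by (intro exI[of _ \<phi>] conjI) blast+
qed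

section \<open>Quotients and modules given by generators and relations\<close>

locale linear_endo =
  fixes V :: "(rat, 'v, 'z) module_scheme" and f :: "'v \<Rightarrow> 'v"
  assumes endo_closed: "v \<in> carrier V \<Longrightarrow> f v \<in> carrier V"
    and endo_add: "\<lbrakk>v \<in> carrier V; w \<in> carrier V\<rbrakk> \<Longrightarrow> f (v \<oplus>\<^bsub>V\<^esub> w) = f v \<oplus>\<^bsub>V\<^esub> f w"
    and endo_smult: "v \<in> carrier V \<Longrightarrow> f (c \<odot>\<^bsub>V\<^esub> v) = c \<odot>\<^bsub>V\<^esub> f v"

lemma functional_zero:
  assumes "vectorspace class_ring V" "functional V L"
  shows "L \<zero>\<^bsub>V\<^esub> = 0"
proof -
  interpret vectorspace class_ring V by fact
  show ?thesis using functional.L_add[OF assms(2), of "\<zero>\<^bsub>V\<^esub>" "\<zero>\<^bsub>V\<^esub>"] by simp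
qed

lemma rat_smult_minus_one:
  fixes V :: "(rat, 'v, 'z) module_scheme"
  assumes "vectorspace class_ring V" "v \<in> carrier V"
  shows "(- 1) \<odot>\<^bsub>V\<^esub> v = \<ominus>\<^bsub>V\<^esub> v"
proof -
  interpret vectorspace class_ring V by fact
  show ?thesis using smult_minus_1[of v] assms(2) by (simp add: class_ring_simps)
qed

locale quotient = vectorspace class_ring M
  for M :: "(rat, 'v) module" +
  fixes N :: "'v set"
  assumes submodule_N: "LinearCombinations.submodule (class_ring :: rat ring) N M"
begin

abbreviation "Q \<equiv> quot_module M N"

interpretation N: LinearCombinations.submodule "class_ring :: rat ring" N M
  by (rule submodule_N)

lemma N_uminus:
  assumes "v \<in> N"
  shows "\<ominus>\<^bsub>M\<^esub> v \<in> N"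
proof -
  have "v \<in> carrier M" using assms N.subset by blast
  from rat_smult_minus_one[OF vectorspace_axioms this] N.smult_closed[OF _ assms, of "- 1"]
  show ?thesis by simp
qed

interpretation abelian_subgroup N M
proof (rule abelian_subgroupI3)
  show "additive_subgroup N M"
    by (intro additive_subgroup.intro add.subgroupI)
      (use N.subset N.zero_closed N.m_closed N_uminus in \<open>auto simp del: N.zero_closed\<close>)
qed (rule abelian_group_axioms)

lemma coset_eq_iff:
  assumes "v \<in> carrier M" "w \<in> carrier M"
  shows "N +>\<^bsub>M\<^esub> v = N +>\<^bsub>M\<^esub> w \<longleftrightarrow> v \<ominus>\<^bsub>M\<^esub> w \<in> N"
proof
  assume "N +>\<^bsub>M\<^esub> v = N +>\<^bsub>M\<^esub> w"
  then have "v \<in> N +>\<^bsub>M\<^esub> w" using a_rcos_self[OF assms(1)] by simp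
  then show "v \<ominus>\<^bsub>M\<^esub> w \<in> N" using a_rcos_module_imp[of w v] assms by (simp add: minus_eq)
next
  assume "v \<ominus>\<^bsub>M\<^esub> w \<in> N"
  then have "v \<in> N +>\<^bsub>M\<^esub> w" using a_rcos_module_rev[of w v] assms by (simp add: minus_eq)
  then show "N +>\<^bsub>M\<^esub> v = N +>\<^bsub>M\<^esub> w" using a_repr_independence'[of v w] assms by simp
qed

lemma carrier_Q: "carrier Q = (\<lambda>v. N +>\<^bsub>M\<^esub> v) ` carrier M"
  by (auto simp: quot_module_def A_RCOSETS_def')

lemma cosetE:
  assumes "C \<in> carrier Q"
  obtains v where "v \<in> carrier M" "C = N +>\<^bsub>M\<^esub> v"
  using assms unfolding carrier_Q by blast

lemma coset_closed [simp]: "v \<in> carrier M \<Longrightarrow> N +>\<^bsub>M\<^esub> v \<in> carrier Q"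
  by (simp add: carrier_Q)

lemma coset_mem: "\<lbrakk>v \<in> carrier M; u \<in> N +>\<^bsub>M\<^esub> v\<rbrakk> \<Longrightarrow> u \<in> carrier M \<and> N +>\<^bsub>M\<^esub> u = N +>\<^bsub>M\<^esub> v"
  using a_repr_independence'[of u v] a_elemrcos_carrier[of v u] by simp

lemma coset_self: "v \<in> carrier M \<Longrightarrow> v \<in> N +>\<^bsub>M\<^esub> v"
  by (rule a_rcos_self)

lemma add_Q:
  "\<lbrakk>v \<in> carrier M; w \<in> carrier M\<rbrakk> \<Longrightarrow>
     (N +>\<^bsub>M\<^esub> v) \<oplus>\<^bsub>Q\<^esub> (N +>\<^bsub>M\<^esub> w) = N +>\<^bsub>M\<^esub> (v \<oplus>\<^bsub>M\<^esub> w)"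
  by (simp add: quot_module_def a_rcos_sum)

text \<open>Scalar multiplication and induced maps on a quotient are given by unions over the elements of a
  coset, so as to avoid a choice. Under the condition below all sets of the union agree.\<close>

lemma Union_coset:
  assumes v: "v \<in> carrier M" and f: "\<And>u. u \<in> carrier M \<Longrightarrow> f u \<in> carrier M"
    and N: "\<And>u. u \<in> carrier M \<Longrightarrow> u \<ominus>\<^bsub>M\<^esub> v \<in> N \<Longrightarrow> f u \<ominus>\<^bsub>M\<^esub> f v \<in> N"
  shows "(\<Union>u\<in>N +>\<^bsub>M\<^esub> v. N +>\<^bsub>M\<^esub> f u) = N +>\<^bsub>M\<^esub> f v"
proof -
  have "N +>\<^bsub>M\<^esub> f u = N +>\<^bsub>M\<^esub> f v" if "u \<in> N +>\<^bsub>M\<^esub> v" for u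
  proof -
    have u: "u \<in> carrier M" "N +>\<^bsub>M\<^esub> u = N +>\<^bsub>M\<^esub> v" using coset_mem[OF v that] by auto
    then have "f u \<ominus>\<^bsub>M\<^esub> f v \<in> N" using coset_eq_iff[OF u(1) v] by (intro N) simp_all
    then show ?thesis using u(1) v f by (simp add: coset_eq_iff)
  qed
  then show ?thesis using coset_self[OF v] by blast
qed

lemma smult_Q:
  assumes "v \<in> carrier M"
  shows "c \<odot>\<^bsub>Q\<^esub> (N +>\<^bsub>M\<^esub> v) = N +>\<^bsub>M\<^esub> (c \<odot>\<^bsub>M\<^esub> v)"
proof -
  have "c \<odot>\<^bsub>M\<^esub> u \<ominus>\<^bsub>M\<^esub> c \<odot>\<^bsub>M\<^esub> v \<in> N" if "u \<in> carrier M" "u \<ominus>\<^bsub>M\<^esub> v \<in> N" for u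
    using that assms N.smult_closed[of c "u \<ominus>\<^bsub>M\<^esub> v"]
    by (simp add: minus_eq smult_r_distr smult_r_minus)
  then show ?thesis
    using assms by (simp add: quot_module_def Union_coset)
qed

lemma zero_Q: "\<zero>\<^bsub>Q\<^esub> = N +>\<^bsub>M\<^esub> \<zero>\<^bsub>M\<^esub>"
  using a_rcos_zero by (simp add: quot_module_def a_coset_add_zero N.subset)

lemma vectorspace_Q: "vectorspace class_ring Q"
proof (rule rat_vectorspaceI)
  fix C assume "C \<in> carrier Q"
  then obtain v where v: "v \<in> carrier M" "C = N +>\<^bsub>M\<^esub> v" by (rule cosetE)
  show "C \<oplus>\<^bsub>Q\<^esub> (- 1) \<odot>\<^bsub>Q\<^esub> C = \<zero>\<^bsub>Q\<^esub>"
    using v rat_smult_minus_one[OF vectorspace_axioms, of v] by (simp add: smult_Q add_Q zero_Q r_neg)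
qed (auto elim!: cosetE simp: add_Q smult_Q zero_Q a_ac smult_l_distr[simplified] smult_r_distr
    smult_assoc1[simplified] smult_one[simplified])

lemma quot_map_coset:
  assumes f: "linear_endo M f" "f ` N \<subseteq> N" and v: "v \<in> carrier M"
  shows "quot_map M N f (N +>\<^bsub>M\<^esub> v) = N +>\<^bsub>M\<^esub> f v"
proof -
  interpret linear_endo M f by fact
  have "f u \<ominus>\<^bsub>M\<^esub> f v = f (u \<ominus>\<^bsub>M\<^esub> v)" if "u \<in> carrier M" for u
  proof -
    have "f (\<ominus>\<^bsub>M\<^esub> v) = \<ominus>\<^bsub>M\<^esub> f v"
      using v endo_smult[of v "- 1"] rat_smult_minus_one[OF vectorspace_axioms, of v]
        rat_smult_minus_one[OF vectorspace_axioms, of "f v"] endo_closed by simp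
    then show ?thesis using that v endo_add[of u "\<ominus>\<^bsub>M\<^esub> v"] by (simp add: minus_eq)
  qed
  then show ?thesis
    using v f(2) endo_closed unfolding quot_map_def by (intro Union_coset) auto
qed

lemma linear_endo_quot_map:
  assumes f: "linear_endo M f" "f ` N \<subseteq> N"
  shows "linear_endo Q (quot_map M N f)"
proof -
  interpret linear_endo M f by fact
  show ?thesis
    by unfold_locales
      (auto elim!: cosetE simp: quot_map_coset[OF f] add_Q smult_Q endo_closed endo_add endo_smult)
qed

text \<open>The choice does not matter for functionals vanishing on \<open>N\<close>, see \<open>quot_fun_coset\<close>.\<close>

definition quot_fun :: "('v \<Rightarrow> complex) \<Rightarrow> 'v set \<Rightarrow> complex" where
  "quot_fun L C = L (SOME v. v \<in> C)"

lemma quot_fun_coset: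
  assumes L: "functional M L" "\<And>v. v \<in> N \<Longrightarrow> L v = 0" and v: "v \<in> carrier M"
  shows "quot_fun L (N +>\<^bsub>M\<^esub> v) = L v"
proof -
  interpret functional M L by fact
  define u where "u = (SOME u. u \<in> N +>\<^bsub>M\<^esub> v)"
  have "u \<in> N +>\<^bsub>M\<^esub> v" unfolding u_def using coset_self[OF v] by (rule someI)
  then have "u \<in> carrier M" "u \<ominus>\<^bsub>M\<^esub> v \<in> N" using coset_mem[OF v] coset_eq_iff v by blast+
  moreover have "u = (u \<ominus>\<^bsub>M\<^esub> v) \<oplus>\<^bsub>M\<^esub> v"
    using calculation v by (simp add: minus_eq a_assoc l_neg)
  ultimately have "L u = L (u \<ominus>\<^bsub>M\<^esub> v) + L v"
    using v L_add[of "u \<ominus>\<^bsub>M\<^esub> v" v] by simp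
  then show ?thesis using L(2) \<open>u \<ominus>\<^bsub>M\<^esub> v \<in> N\<close> by (simp add: quot_fun_def u_def)
qed

lemma functional_quot_fun:
  assumes L: "functional M L" "\<And>v. v \<in> N \<Longrightarrow> L v = 0"
  shows "functional Q (quot_fun L)"
proof -
  interpret functional M L by fact
  show ?thesis
    by unfold_locales
      (auto elim!: cosetE simp: quot_fun_coset[OF L] add_Q smult_Q L_add L_smult)
qed

lemma lin_gen_Q:
  assumes "S \<subseteq> carrier M" "carrier M \<subseteq> lin_gen M S"
  shows "carrier Q \<subseteq> lin_gen Q ((\<lambda>v. N +>\<^bsub>M\<^esub> v) ` S)"
proof
  fix C assume "C \<in> carrier Q"
  then obtain v where v: "v \<in> carrier M" "C = N +>\<^bsub>M\<^esub> v" by (rule cosetE)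
  have "v \<in> lin_gen M S" using v assms(2) by blast
  then have "v \<in> carrier M \<and> N +>\<^bsub>M\<^esub> v \<in> lin_gen Q ((\<lambda>v. N +>\<^bsub>M\<^esub> v) ` S)"
  proof induction
    case zero
    then show ?case by (auto simp: zero_Q[symmetric] intro: lin_gen.zero)
  next
    case (base v)
    then show ?case using assms(1) by (auto intro: lin_gen.base)
  next
    case (add v w)
    then show ?case by (auto simp: add_Q[symmetric] intro: lin_gen.add)
  next
    case (smult v c)
    then show ?case by (auto simp: smult_Q[symmetric] intro: lin_gen.smult)
  qed
  with v show "C \<in> lin_gen Q ((\<lambda>v. N +>\<^bsub>M\<^esub> v) ` S)" by simp
qed

end

subsection \<open>Free modules\<close>

lemma vectorspace_free:
  fixes B :: "'x set"
  shows "vectorspace class_ring (free_module B)"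
proof (rule rat_vectorspaceI)
  fix v :: "'x \<Rightarrow>\<^sub>0 rat" and c :: rat
  have l: "Poly_Mapping.lookup (Poly_Mapping.map ((*) c) v) x = c * Poly_Mapping.lookup v x"
    for c :: rat and v :: "'x \<Rightarrow>\<^sub>0 rat" and x
    by (auto simp: map.rep_eq when_def)
  show "1 \<odot>\<^bsub>free_module B\<^esub> v = v"
    by (simp add: free_module_def poly_mapping_eq_iff fun_eq_iff l)
  show "v \<oplus>\<^bsub>free_module B\<^esub> (- 1) \<odot>\<^bsub>free_module B\<^esub> v = \<zero>\<^bsub>free_module B\<^esub>"
    by (simp add: free_module_def poly_mapping_eq_iff fun_eq_iff l lookup_add)
  show "(c * d) \<odot>\<^bsub>free_module B\<^esub> v = c \<odot>\<^bsub>free_module B\<^esub> (d \<odot>\<^bsub>free_module B\<^esub> v)" for d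
    by (simp add: free_module_def poly_mapping_eq_iff fun_eq_iff l)
  show "(c + d) \<odot>\<^bsub>free_module B\<^esub> v = c \<odot>\<^bsub>free_module B\<^esub> v \<oplus>\<^bsub>free_module B\<^esub> d \<odot>\<^bsub>free_module B\<^esub> v" for d
    by (simp add: free_module_def poly_mapping_eq_iff fun_eq_iff l lookup_add algebra_simps)
  show "c \<odot>\<^bsub>free_module B\<^esub> (v \<oplus>\<^bsub>free_module B\<^esub> w) = c \<odot>\<^bsub>free_module B\<^esub> v \<oplus>\<^bsub>free_module B\<^esub> c \<odot>\<^bsub>free_module B\<^esub> w" for w
    by (simp add: free_module_def poly_mapping_eq_iff fun_eq_iff l lookup_add algebra_simps)
  show "c \<odot>\<^bsub>free_module B\<^esub> v \<in> carrier (free_module B)" if "v \<in> carrier (free_module B)"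
    using that by (auto simp: free_module_def in_keys_iff l subset_iff)
  show "v \<oplus>\<^bsub>free_module B\<^esub> w \<in> carrier (free_module B)"
    if "v \<in> carrier (free_module B)" "w \<in> carrier (free_module B)" for w
    using that keys_add[of v w] by (auto simp: free_module_def)
qed (simp_all add: free_module_def ac_simps)

lemma smult_single:
  "c \<odot>\<^bsub>free_module B\<^esub> Poly_Mapping.single x d = Poly_Mapping.single x (c * d)"
  by (auto simp: free_module_def poly_mapping_eq_iff fun_eq_iff map.rep_eq lookup_single when_def)

lemma single_closed: "x \<in> B \<Longrightarrow> Poly_Mapping.single x c \<in> carrier (free_module B)"
  by (simp add: free_module_def)

lemma lin_gen_free:
  "carrier (free_module B) \<subseteq> lin_gen (free_module B) ((\<lambda>x. Poly_Mapping.single x 1) ` B)"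
proof
  fix f assume "f \<in> carrier (free_module B)"
  then have f: "Poly_Mapping.keys f \<subseteq> B" by (simp add: free_module_def)
  have "(\<Sum>x\<in>A. Poly_Mapping.single x (Poly_Mapping.lookup f x)) \<in>
      lin_gen (free_module B) ((\<lambda>x. Poly_Mapping.single x 1) ` B)" if "finite A" "A \<subseteq> B" for A
    using that
  proof induction
    case empty
    show ?case using lin_gen.zero[of "free_module B"] by (simp add: free_module_def)
  next
    case (insert x A)
    have "Poly_Mapping.single x (Poly_Mapping.lookup f x) \<in>
        lin_gen (free_module B) ((\<lambda>x. Poly_Mapping.single x 1) ` B)"
      using lin_gen.smult[OF lin_gen.base, of "Poly_Mapping.single x 1" _ "free_module B" "Poly_Mapping.lookup f x"]
        insert by (simp add: smult_single)
    from lin_gen.add[OF this insert.IH] insert show ?case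
      by (simp add: free_module_def)
  qed
  moreover have "(\<Sum>x\<in>Poly_Mapping.keys f. Poly_Mapping.single x (Poly_Mapping.lookup f x)) = f"
    by (simp add: poly_mapping_eq_iff fun_eq_iff lookup_sum lookup_single when_def in_keys_iff)
  ultimately show "f \<in> lin_gen (free_module B) ((\<lambda>x. Poly_Mapping.single x 1) ` B)"
    using f by (metis finite_keys)
qed

definition lin_ext :: "('x \<Rightarrow> complex) \<Rightarrow> ('x \<Rightarrow>\<^sub>0 rat) \<Rightarrow> complex" where
  "lin_ext g f = (\<Sum>x\<in>Poly_Mapping.keys f. of_rat (Poly_Mapping.lookup f x) * g x)"

lemma lin_ext_superset:
  assumes "finite A" "Poly_Mapping.keys f \<subseteq> A"
  shows "lin_ext g f = (\<Sum>x\<in>A. of_rat (Poly_Mapping.lookup f x) * g x)"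
  unfolding lin_ext_def using assms by (intro sum.mono_neutral_left) (auto simp: in_keys_iff)

lemma lin_ext_add: "lin_ext g (f + f') = lin_ext g f + lin_ext g f'"
proof -
  define A where "A = Poly_Mapping.keys f \<union> Poly_Mapping.keys f'"
  have "finite A" "Poly_Mapping.keys f \<subseteq> A" "Poly_Mapping.keys f' \<subseteq> A" "Poly_Mapping.keys (f + f') \<subseteq> A"
    using keys_add[of f f'] by (auto simp: A_def)
  then show ?thesis
    by (simp add: lin_ext_superset lookup_add of_rat_add algebra_simps sum.distrib)
qed

lemma lin_ext_single [simp]: "lin_ext g (Poly_Mapping.single x c) = of_rat c * g x"
  by (subst lin_ext_superset[of "{x}"]) auto

lemma lin_ext_diff: "lin_ext g (f - f') = lin_ext g f - lin_ext g f'"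
  using lin_ext_add[of g "f - f'" f'] by simp

lemma functional_lin_ext: "functional (free_module B) (lin_ext g)"
proof
  fix f :: "'a \<Rightarrow>\<^sub>0 rat" and c
  have "lin_ext g (Poly_Mapping.map ((*) c) f) = of_rat c * lin_ext g f"
    by (subst lin_ext_superset[of "Poly_Mapping.keys f"])
      (auto simp: in_keys_iff map.rep_eq when_def lin_ext_def sum_distrib_left of_rat_mult ac_simps intro!: sum.cong)
  then show "lin_ext g (c \<odot>\<^bsub>free_module B\<^esub> f) = of_rat c * lin_ext g f"
    by (simp add: free_module_def)
qed (simp add: free_module_def lin_ext_add)

lemma free_map_superset:
  assumes "finite A" "Poly_Mapping.keys f \<subseteq> A"
  shows "free_map h f = (\<Sum>x\<in>A. Poly_Mapping.single (h x) (Poly_Mapping.lookup f x))"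
  unfolding free_map_def using assms by (intro sum.mono_neutral_left) (auto simp: in_keys_iff)

lemma free_map_add: "free_map h (f + f') = free_map h f + free_map h f'"
proof -
  define A where "A = Poly_Mapping.keys f \<union> Poly_Mapping.keys f'"
  have "finite A" "Poly_Mapping.keys f \<subseteq> A" "Poly_Mapping.keys f' \<subseteq> A" "Poly_Mapping.keys (f + f') \<subseteq> A"
    using keys_add[of f f'] by (auto simp: A_def)
  then show ?thesis
    by (simp add: free_map_superset lookup_add single_add sum.distrib)
qed

lemma free_map_single [simp]: "free_map h (Poly_Mapping.single x c) = Poly_Mapping.single (h x) c"
  by (subst free_map_superset[of "{x}"]) auto

lemma free_map_diff: "free_map h (f - f') = free_map h f - free_map h f'"
  using free_map_add[of h "f - f'" f'] by simp

lemma lin_ext_free_map: "lin_ext g (free_map h f) = lin_ext (\<lambda>x. g (h x)) f"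
proof -
  have "lin_ext g (\<Sum>x\<in>A. F x) = (\<Sum>x\<in>A. lin_ext g (F x))" if "finite A" for A and F :: "'a \<Rightarrow> 'a \<Rightarrow>\<^sub>0 rat"
    using that by induction (simp_all add: lin_ext_add, simp add: lin_ext_def)
  then have "lin_ext g (free_map h f) =
      (\<Sum>x\<in>Poly_Mapping.keys f. lin_ext g (Poly_Mapping.single (h x) (Poly_Mapping.lookup f x)))"
    by (simp add: free_map_def)
  then show ?thesis by (simp add: lin_ext_def[of "\<lambda>x. g (h x)"])
qed

lemma linear_endo_free_map:
  assumes "h ` B \<subseteq> B"
  shows "linear_endo (free_module B) (free_map h)"
proof
  fix f :: "'a \<Rightarrow>\<^sub>0 rat" and c
  interpret vectorspace class_ring "free_module B" by (rule vectorspace_free)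
  assume "f \<in> carrier (free_module B)"
  then have f: "Poly_Mapping.keys f \<subseteq> B" by (simp add: free_module_def)
  have "(\<Sum>x\<in>A. Poly_Mapping.single (h x) (Poly_Mapping.lookup f x)) \<in> carrier (free_module B)"
    if "finite A" "A \<subseteq> B" for A
    using that
  proof induction
    case (insert x A)
    then have "Poly_Mapping.single (h x) (Poly_Mapping.lookup f x) \<oplus>\<^bsub>free_module B\<^esub>
        (\<Sum>x\<in>A. Poly_Mapping.single (h x) (Poly_Mapping.lookup f x)) \<in> carrier (free_module B)"
      using assms by (intro a_closed single_closed) auto
    then show ?case using insert by (simp add: free_module_def)
  qed (simp add: free_module_def)
  with f show "free_map h f \<in> carrier (free_module B)" by (simp add: free_map_def)
  have "free_map h (Poly_Mapping.map ((*) c) f) =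
      (\<Sum>x\<in>Poly_Mapping.keys f. Poly_Mapping.single (h x) (c * Poly_Mapping.lookup f x))"
    by (subst free_map_superset[of "Poly_Mapping.keys f"])
      (auto simp: in_keys_iff map.rep_eq when_def intro!: sum.cong)
  moreover have "Poly_Mapping.map ((*) c) (\<Sum>x\<in>A. F x) = (\<Sum>x\<in>A. Poly_Mapping.map ((*) c) (F x))"
    for A and F :: "'a \<Rightarrow> 'a \<Rightarrow>\<^sub>0 rat"
  proof -
    have "Poly_Mapping.lookup (Poly_Mapping.map ((*) c) v) x = c * Poly_Mapping.lookup v x"
      for v :: "'a \<Rightarrow>\<^sub>0 rat" and x
      by (auto simp: map.rep_eq when_def)
    then show ?thesis
      by (simp add: poly_mapping_eq_iff fun_eq_iff lookup_sum sum_distrib_left)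
  qed
  moreover have "Poly_Mapping.map ((*) c) (Poly_Mapping.single x d) = Poly_Mapping.single x (c * d)" for x :: 'a and d
    by (auto simp: poly_mapping_eq_iff fun_eq_iff map.rep_eq lookup_single when_def)
  ultimately show "free_map h (c \<odot>\<^bsub>free_module B\<^esub> f) = c \<odot>\<^bsub>free_module B\<^esub> free_map h f"
    by (simp add: free_module_def free_map_def)
qed (simp add: free_module_def free_map_add)

subsection \<open>Presented modules\<close>

locale presented =
  fixes B :: "'x set" and rels :: "('x \<Rightarrow>\<^sub>0 rat) set"
  assumes rels: "rels \<subseteq> carrier (free_module B)"
begin

interpretation F: vectorspace class_ring "free_module B"
  by (rule vectorspace_free)

abbreviation "P \<equiv> presented_module B rels"
abbreviation "R \<equiv> LinearCombinations.module.span class_ring (free_module B) rels"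

lemma quotient_R: "quotient (free_module B) R"
  by (intro quotient.intro vectorspace_free quotient_axioms.intro F.span_is_submodule[OF rels])

interpretation q: quotient "free_module B" R
  by (rule quotient_R)

lemma rels_subset_R: "rels \<subseteq> R"
  unfolding span_eq_lin_gen[OF vectorspace_free rels] by (intro subsetI lin_gen.base)

lemma P_eq: "P = quot_module (free_module B) R"
  by (simp add: presented_module_def)

lemma vectorspace_P: "vectorspace class_ring P"
  unfolding P_eq by (rule q.vectorspace_Q)

interpretation P: vectorspace class_ring P
  by (rule vectorspace_P)

definition cls :: "('x \<Rightarrow>\<^sub>0 rat) \<Rightarrow> ('x \<Rightarrow>\<^sub>0 rat) set" where
  "cls f = R +>\<^bsub>free_module B\<^esub> f"

definition gen :: "'x \<Rightarrow> ('x \<Rightarrow>\<^sub>0 rat) set" where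
  "gen x = cls (Poly_Mapping.single x 1)"

lemma cls_closed: "f \<in> carrier (free_module B) \<Longrightarrow> cls f \<in> carrier P"
  unfolding cls_def P_eq by simp

lemma gen_closed: "x \<in> B \<Longrightarrow> gen x \<in> carrier P"
  unfolding gen_def by (intro cls_closed single_closed)

lemma cls_eqI:
  assumes "f \<in> carrier (free_module B)" "f' \<in> carrier (free_module B)" "f - f' \<in> rels"
  shows "cls f = cls f'"
proof -
  have "f \<ominus>\<^bsub>free_module B\<^esub> f' = f - f'"
  proof -
    have "(f - f') \<oplus>\<^bsub>free_module B\<^esub> f' = f" by (simp add: free_module_def)
    moreover have "f - f' \<in> carrier (free_module B)" using assms(3) rels by blast
    ultimately show ?thesis
      using assms by (metis F.add.inv_solve_right F.minus_eq)
  qed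
  moreover have "f - f' \<in> R" using F.in_own_span[OF rels] assms(3) by blast
  ultimately show ?thesis
    unfolding cls_def using assms by (simp add: q.coset_eq_iff)
qed

lemma cls_add:
  assumes "f \<in> carrier (free_module B)" "f' \<in> carrier (free_module B)"
  shows "cls (f + f') = cls f \<oplus>\<^bsub>P\<^esub> cls f'"
proof -
  have "f + f' = f \<oplus>\<^bsub>free_module B\<^esub> f'" by (simp add: free_module_def)
  then show ?thesis unfolding cls_def P_eq using q.add_Q[OF assms] by simp
qed

lemma cls_single: "x \<in> B \<Longrightarrow> cls (Poly_Mapping.single x c) = c \<odot>\<^bsub>P\<^esub> gen x"
  unfolding gen_def cls_def P_eq
  by (simp add: q.smult_Q single_closed smult_single)

lemma gen_add_relation:
  assumes "x \<in> B" "y \<in> B" "z \<in> B"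
    and "Poly_Mapping.single x 1 - Poly_Mapping.single y 1 - Poly_Mapping.single z 1 \<in> rels"
  shows "gen x = gen y \<oplus>\<^bsub>P\<^esub> gen z"
proof -
  have "cls (Poly_Mapping.single x 1) = cls (Poly_Mapping.single y 1 + Poly_Mapping.single z 1)"
  proof (rule cls_eqI)
    have "Poly_Mapping.single y 1 \<oplus>\<^bsub>free_module B\<^esub> Poly_Mapping.single z 1 \<in> carrier (free_module B)"
      using assms by (intro F.a_closed single_closed)
    then show "Poly_Mapping.single y 1 + Poly_Mapping.single z 1 \<in> carrier (free_module B)"
      by (simp add: free_module_def)
  qed (use assms in \<open>simp_all add: single_closed diff_diff_eq\<close>)
  then show ?thesis using assms by (simp add: cls_add single_closed gen_def)
qed

lemma gen_smult_relation:
  assumes "x \<in> B" "y \<in> B" "Poly_Mapping.single x 1 - Poly_Mapping.single y c \<in> rels"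
  shows "gen x = c \<odot>\<^bsub>P\<^esub> gen y"
proof -
  have "cls (Poly_Mapping.single x 1) = cls (Poly_Mapping.single y c)"
    using assms by (intro cls_eqI single_closed)
  then show ?thesis unfolding gen_def[of x] cls_single[OF assms(2), symmetric] .
qed

lemma gen_eq_relation:
  assumes "x \<in> B" "y \<in> B" "Poly_Mapping.single x 1 - Poly_Mapping.single y 1 \<in> rels"
  shows "gen x = gen y"
  unfolding gen_def using assms by (intro cls_eqI single_closed)

lemma lin_gen_P: "carrier P \<subseteq> lin_gen P (gen ` B)"
proof -
  have "(\<lambda>x. Poly_Mapping.single x 1) ` B \<subseteq> carrier (free_module B)"
    by (intro image_subsetI single_closed)
  from q.lin_gen_Q[OF this lin_gen_free] show ?thesis
    unfolding P_eq gen_def cls_def image_image .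
qed

definition pres_fun :: "('x \<Rightarrow> complex) \<Rightarrow> ('x \<Rightarrow>\<^sub>0 rat) set \<Rightarrow> complex" where
  "pres_fun g = q.quot_fun (lin_ext g)"

lemma lin_ext_R:
  assumes "\<And>r. r \<in> rels \<Longrightarrow> lin_ext g r = 0" and "f \<in> R"
  shows "lin_ext g f = 0"
proof -
  interpret functional "free_module B" "lin_ext g" by (rule functional_lin_ext)
  have "f \<in> lin_gen (free_module B) rels"
    using assms(2) span_eq_lin_gen[OF vectorspace_free rels] by simp
  then have "f \<in> carrier (free_module B) \<and> lin_ext g f = 0"
    by induction
      (use assms(1) rels functional_zero[OF vectorspace_free functional_axioms]
        in \<open>auto simp: L_add L_smult\<close>)
  then show ?thesis ..
qed

lemma
  assumes "\<And>r. r \<in> rels \<Longrightarrow> lin_ext g r = 0"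
  shows functional_pres_fun: "functional P (pres_fun g)"
    and pres_fun_cls: "f \<in> carrier (free_module B) \<Longrightarrow> pres_fun g (cls f) = lin_ext g f"
    and pres_fun_gen: "x \<in> B \<Longrightarrow> pres_fun g (gen x) = g x"
proof -
  note L = functional_lin_ext lin_ext_R[OF assms]
  show "functional P (pres_fun g)"
    unfolding P_eq pres_fun_def by (rule q.functional_quot_fun[OF L])
  show *: "pres_fun g (cls f) = lin_ext g f" if "f \<in> carrier (free_module B)" for f
    unfolding pres_fun_def cls_def by (rule q.quot_fun_coset[OF L that])
  show "pres_fun g (gen x) = g x" if "x \<in> B"
    unfolding gen_def by (simp add: * single_closed that)
qed

lemma
  assumes h: "h ` B \<subseteq> B" "\<And>r. r \<in> rels \<Longrightarrow> free_map h r \<in> R"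
  shows linear_endo_presented_map: "linear_endo P (presented_map B rels h)"
    and presented_map_cls:
      "f \<in> carrier (free_module B) \<Longrightarrow> presented_map B rels h (cls f) = cls (free_map h f)"
proof -
  interpret linear_endo "free_module B" "free_map h" by (rule linear_endo_free_map[OF h(1)])
  interpret R: LinearCombinations.submodule class_ring R "free_module B"
    by (rule F.span_is_submodule[OF rels])
  have "free_map h ` R \<subseteq> R"
  proof (rule image_subsetI)
    fix f assume "f \<in> R"
    then have "f \<in> lin_gen (free_module B) rels"
      using span_eq_lin_gen[OF vectorspace_free rels] by simp
    then have "f \<in> carrier (free_module B) \<and> free_map h f \<in> R"
    proof induction
      case zero
      have "free_map h \<zero>\<^bsub>free_module B\<^esub> = \<zero>\<^bsub>free_module B\<^esub>"
        by (simp add: free_module_def free_map_def)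
      then show ?case by simp
    qed (use h(2) rels endo_add endo_smult in auto)
    then show "free_map h f \<in> R" ..
  qed
  note * = linear_endo_axioms this
  show "linear_endo P (presented_map B rels h)"
    unfolding P_eq presented_map_def by (rule q.linear_endo_quot_map[OF *])
  show "presented_map B rels h (cls f) = cls (free_map h f)" if "f \<in> carrier (free_module B)"
    unfolding cls_def presented_map_def by (rule q.quot_map_coset[OF * that])
qed

lemma pres_fun_presented_map:
  assumes h: "h ` B \<subseteq> B" "\<And>r. r \<in> rels \<Longrightarrow> free_map h r \<in> R"
    and g: "\<And>r. r \<in> rels \<Longrightarrow> lin_ext g r = 0" and g': "\<And>r. r \<in> rels \<Longrightarrow> lin_ext g' r = 0"
    and gh: "\<And>x. x \<in> B \<Longrightarrow> g (h x) = g' x"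
    and C: "C \<in> carrier P"
  shows "pres_fun g (presented_map B rels h C) = pres_fun g' C"
proof -
  obtain f where f: "f \<in> carrier (free_module B)" "C = cls f"
    using C unfolding P_eq cls_def by (rule q.cosetE)
  have "lin_ext g (free_map h f) = lin_ext g' f"
    unfolding lin_ext_free_map unfolding lin_ext_def
    using f(1) by (intro sum.cong) (auto simp: gh free_module_def)
  then show ?thesis
    using f linear_endo.endo_closed[OF linear_endo_free_map[OF h(1)] f(1)]
    by (simp add: presented_map_cls[OF h] pres_fun_cls[OF g] pres_fun_cls[OF g'])
qed

end

subsection \<open>Tensor products and symmetric powers\<close>

lemma free_diff_closed:
  assumes "f \<in> carrier (free_module B)" "f' \<in> carrier (free_module B)"
  shows "f - f' \<in> carrier (free_module B)"
  using assms keys_diff[of f f'] by (auto simp: free_module_def)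

lemma multilinear_rels_closed:
  assumes "\<And>i. i \<in> I \<Longrightarrow> vectorspace class_ring (V i)"
  shows "multilinear_rels I V \<subseteq> carrier (free_module (\<Pi>\<^sub>E i\<in>I. carrier (V i)))"
proof -
  have "a \<oplus>\<^bsub>V i\<^esub> b \<in> carrier (V i)" if "i \<in> I" "a \<in> carrier (V i)" "b \<in> carrier (V i)" for i a b
  proof -
    interpret vectorspace class_ring "V i" by (rule assms[OF that(1)])
    show ?thesis using that by simp
  qed
  moreover have "c \<odot>\<^bsub>V i\<^esub> a \<in> carrier (V i)" if "i \<in> I" "a \<in> carrier (V i)" for i a c
  proof -
    interpret vectorspace class_ring "V i" by (rule assms[OF that(1)])
    show ?thesis using that by simp
  qed
  ultimately show ?thesis
    unfolding multilinear_rels_def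
    by (auto intro!: free_diff_closed single_closed PiE_fun_upd simp: insert_absorb)
qed

locale multilinear = presented "\<Pi>\<^sub>E i\<in>I. carrier (V i)" rels
  for I :: "'i set" and V :: "'i \<Rightarrow> (rat, 'v) module" and rels +
  assumes finite_I: "finite I"
    and vectorspace_V: "i \<in> I \<Longrightarrow> vectorspace class_ring (V i)"
    and multilinear_rels: "multilinear_rels I V \<subseteq> rels"
begin

abbreviation "B \<equiv> \<Pi>\<^sub>E i\<in>I. carrier (V i)"

lemma update_closed: "\<lbrakk>v \<in> B; i \<in> I; a \<in> carrier (V i)\<rbrakk> \<Longrightarrow> v(i := a) \<in> B"
  using PiE_fun_upd[of a "\<lambda>i. carrier (V i)" i v I] by (simp add: insert_absorb)

lemma gen_update_add:
  assumes "v \<in> B" "i \<in> I" "a \<in> carrier (V i)" "b \<in> carrier (V i)"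
  shows "gen (v(i := a \<oplus>\<^bsub>V i\<^esub> b)) = gen (v(i := a)) \<oplus>\<^bsub>P\<^esub> gen (v(i := b))"
proof -
  interpret vectorspace class_ring "V i" by (rule vectorspace_V[OF assms(2)])
  have "Poly_Mapping.single (v(i := a \<oplus>\<^bsub>V i\<^esub> b)) 1 - Poly_Mapping.single (v(i := a)) 1
      - Poly_Mapping.single (v(i := b)) 1 \<in> multilinear_rels I V"
    unfolding multilinear_rels_def using assms by blast
  then show ?thesis
    using assms multilinear_rels by (intro gen_add_relation update_closed a_closed) auto
qed

lemma gen_update_smult:
  assumes "v \<in> B" "i \<in> I" "a \<in> carrier (V i)"
  shows "gen (v(i := c \<odot>\<^bsub>V i\<^esub> a)) = c \<odot>\<^bsub>P\<^esub> gen (v(i := a))"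
proof -
  interpret vectorspace class_ring "V i" by (rule vectorspace_V[OF assms(2)])
  have "Poly_Mapping.single (v(i := c \<odot>\<^bsub>V i\<^esub> a)) 1 - Poly_Mapping.single (v(i := a)) c
      \<in> multilinear_rels I V"
    unfolding multilinear_rels_def using assms by blast
  then show ?thesis
    using assms multilinear_rels by (intro gen_smult_relation update_closed smult_closed) auto
qed

lemma gen_update_zero:
  assumes "v \<in> B" "i \<in> I"
  shows "gen (v(i := \<zero>\<^bsub>V i\<^esub>)) = \<zero>\<^bsub>P\<^esub>"
proof -
  interpret Vi: vectorspace class_ring "V i" by (rule vectorspace_V[OF assms(2)])
  interpret PP: vectorspace class_ring P by (rule vectorspace_P)
  have "0 \<odot>\<^bsub>V i\<^esub> \<zero>\<^bsub>V i\<^esub> = \<zero>\<^bsub>V i\<^esub>"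
    using Vi.lmult_0[of "\<zero>\<^bsub>V i\<^esub>"] by simp
  then show ?thesis
    using gen_update_smult[OF assms, of "\<zero>\<^bsub>V i\<^esub>" 0] PP.lmult_0[of "gen (v(i := \<zero>\<^bsub>V i\<^esub>))"]
      gen_closed[OF update_closed[OF assms, of "\<zero>\<^bsub>V i\<^esub>"]] by simp
qed

text \<open>Expanding the factors one after the other.\<close>

lemma lin_gen_multilinear:
  assumes S: "\<And>i. i \<in> I \<Longrightarrow> S i \<subseteq> carrier (V i)"
    and gen_S: "\<And>i. i \<in> I \<Longrightarrow> carrier (V i) \<subseteq> lin_gen (V i) (S i)"
  shows "carrier P \<subseteq> lin_gen P (gen ` (\<Pi>\<^sub>E i\<in>I. S i))"
proof -
  define L where "L = lin_gen P (gen ` (\<Pi>\<^sub>E i\<in>I. S i))"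
  have "\<forall>v \<in> (\<Pi>\<^sub>E i\<in>I. if i \<in> J then carrier (V i) else S i). gen v \<in> L" if "finite J" "J \<subseteq> I" for J
    using that
  proof (induction J)
    case empty
    show ?case by (auto simp: L_def intro: lin_gen.base)
  next
    case (insert j J)
    show ?case
    proof
      fix v assume v: "v \<in> (\<Pi>\<^sub>E i\<in>I. if i \<in> insert j J then carrier (V i) else S i)"
      have j: "j \<in> I" using insert by simp
      have vB: "v \<in> B" using v S by (fastforce simp: PiE_iff split: if_splits)
      have "v j \<in> lin_gen (V j) (S j)" using PiE_mem[OF vB j] gen_S[OF j] by blast
      then have "v j \<in> carrier (V j) \<and> gen (v(j := v j)) \<in> L"
      proof induction
        case zero
        interpret vectorspace class_ring "V j" by (rule vectorspace_V[OF j])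
        show ?case using gen_update_zero[OF vB j] by (simp add: L_def lin_gen.zero del: fun_upd_apply)
      next
        case (base u)
        then have "v(j := u) \<in> (\<Pi>\<^sub>E i\<in>I. if i \<in> J then carrier (V i) else S i)"
          using v j insert.hyps by (auto simp: PiE_iff extensional_def)
        then show ?case using insert base S[OF j] by (auto simp del: fun_upd_apply)
      next
        case (add u w)
        interpret vectorspace class_ring "V j" by (rule vectorspace_V[OF j])
        show ?case using add gen_update_add[OF vB j, of u w] by (simp add: L_def lin_gen.add del: fun_upd_apply)
      next
        case (smult u c)
        interpret vectorspace class_ring "V j" by (rule vectorspace_V[OF j])
        show ?case using smult gen_update_smult[OF vB j, of u c] by (simp add: L_def lin_gen.smult del: fun_upd_apply)
      qed
      then show "gen v \<in> L" by simp
    qed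
  qed
  from this[OF finite_I subset_refl] have "gen v \<in> L" if "v \<in> B" for v
    using that by (auto simp: PiE_iff)
  then have "gen ` B \<subseteq> L" by blast
  then show ?thesis
    using lin_gen_P lin_gen_subset[of "gen ` B" P "gen ` (\<Pi>\<^sub>E i\<in>I. S i)"] unfolding L_def by blast
qed

end

lemma prod_functionals_multilinear:
  assumes "finite I" "\<And>i. i \<in> I \<Longrightarrow> functional (V i) (\<mu> i)" "r \<in> multilinear_rels I V"
  shows "lin_ext (\<lambda>v. \<Prod>i\<in>I. \<mu> i (v i)) r = 0"
proof -
  have upd: "(\<Prod>j\<in>I. \<mu> j ((v(i := a)) j)) = \<mu> i a * (\<Prod>j\<in>I - {i}. \<mu> j (v j))" if "i \<in> I" for v i a
  proof -
    have "(\<Prod>j\<in>I - {i}. \<mu> j ((v(i := a)) j)) = (\<Prod>j\<in>I - {i}. \<mu> j (v j))"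
      by (rule prod.cong) auto
    then show ?thesis using prod.remove[OF assms(1) that, of "\<lambda>j. \<mu> j ((v(i := a)) j)"] by simp
  qed
  from assms(3) consider
    v i a b where "i \<in> I" "a \<in> carrier (V i)" "b \<in> carrier (V i)"
      "r = Poly_Mapping.single (v(i := a \<oplus>\<^bsub>V i\<^esub> b)) 1
        - Poly_Mapping.single (v(i := a)) 1 - Poly_Mapping.single (v(i := b)) 1"
  | v i a c where "i \<in> I" "a \<in> carrier (V i)"
      "r = Poly_Mapping.single (v(i := c \<odot>\<^bsub>V i\<^esub> a)) 1 - Poly_Mapping.single (v(i := a)) c"
    unfolding multilinear_rels_def by blast
  then show ?thesis
  proof cases
    case 1
    then show ?thesis
      unfolding 1(4) lin_ext_diff lin_ext_single upd[OF 1(1)]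
      using functional.L_add[OF assms(2)[OF 1(1)] 1(2,3)] by (simp add: algebra_simps)
  next
    case 2
    then show ?thesis
      unfolding 2(3) lin_ext_diff lin_ext_single upd[OF 2(1)]
      using functional.L_smult[OF assms(2)[OF 2(1)] 2(2)] by simp
  qed
qed

lemma multilinear_rels_map:
  assumes f: "\<And>i. i \<in> I \<Longrightarrow> linear_endo (V i) (f i)" and r: "r \<in> multilinear_rels I V"
  shows "free_map (\<lambda>v. \<lambda>i\<in>I. f i (v i)) r \<in> multilinear_rels I V"
proof -
  let ?h = "\<lambda>v. \<lambda>i\<in>I. f i (v i)"
  have upd: "?h (v(i := a)) = (?h v)(i := f i a)" if "i \<in> I" for v i a
    using that by auto
  have closed: "?h v \<in> (\<Pi>\<^sub>E j\<in>I. carrier (V j))" if "v \<in> (\<Pi>\<^sub>E j\<in>I. carrier (V j))" for v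
    using that linear_endo.endo_closed[OF f] by auto
  from r consider
    v i a b where "v \<in> (\<Pi>\<^sub>E j\<in>I. carrier (V j))" "i \<in> I" "a \<in> carrier (V i)" "b \<in> carrier (V i)"
      "r = Poly_Mapping.single (v(i := a \<oplus>\<^bsub>V i\<^esub> b)) 1
        - Poly_Mapping.single (v(i := a)) 1 - Poly_Mapping.single (v(i := b)) 1"
  | v i a c where "v \<in> (\<Pi>\<^sub>E j\<in>I. carrier (V j))" "i \<in> I" "a \<in> carrier (V i)"
      "r = Poly_Mapping.single (v(i := c \<odot>\<^bsub>V i\<^esub> a)) 1 - Poly_Mapping.single (v(i := a)) c"
    unfolding multilinear_rels_def by blast
  then show ?thesis
  proof cases
    case 1
    interpret linear_endo "V i" "f i" by (rule f[OF 1(2)])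
    have "free_map ?h r = Poly_Mapping.single ((?h v)(i := f i a \<oplus>\<^bsub>V i\<^esub> f i b)) 1
        - Poly_Mapping.single ((?h v)(i := f i a)) 1 - Poly_Mapping.single ((?h v)(i := f i b)) 1"
      unfolding 1(5) free_map_diff free_map_single upd[OF 1(2)] endo_add[OF 1(3,4)] ..
    then show ?thesis
      unfolding multilinear_rels_def using closed[OF 1(1)] 1(2) endo_closed[OF 1(3)] endo_closed[OF 1(4)]
      by blast
  next
    case 2
    interpret linear_endo "V i" "f i" by (rule f[OF 2(2)])
    have "free_map ?h r = Poly_Mapping.single ((?h v)(i := c \<odot>\<^bsub>V i\<^esub> f i a)) 1
        - Poly_Mapping.single ((?h v)(i := f i a)) c"
      unfolding 2(4) free_map_diff free_map_single upd[OF 2(2)] endo_smult[OF 2(3)] ..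
    then show ?thesis
      unfolding multilinear_rels_def using closed[OF 2(1)] 2(2) endo_closed[OF 2(3)] by blast
  qed
qed

lemma multilinear_tensor:
  assumes "finite I" "\<And>i. i \<in> I \<Longrightarrow> vectorspace class_ring (V i)"
  shows "multilinear I V (multilinear_rels I V)"
  using assms multilinear_rels_closed[of I V]
  by (intro multilinear.intro presented.intro multilinear_axioms.intro) auto

lemma multilinear_symmetric:
  assumes "vectorspace class_ring V"
  shows "multilinear {..<e} (\<lambda>_. V) (symmetric_rels e V)"
proof (intro multilinear.intro presented.intro multilinear_axioms.intro)
  have "v \<circ> \<pi> \<in> {..<e} \<rightarrow>\<^sub>E carrier V"
    if "v \<in> {..<e} \<rightarrow>\<^sub>E carrier V" "\<pi> permutes {..<e}" for v \<pi>
  proof (rule PiE_I)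
    fix i assume "i \<in> {..<e}"
    then have "\<pi> i \<in> {..<e}" using permutes_in_image[OF that(2)] by blast
    then show "(v \<circ> \<pi>) i \<in> carrier V" using that(1) by auto
  next
    fix i assume "i \<notin> {..<e}"
    then show "(v \<circ> \<pi>) i = undefined"
      using that by (auto simp: permutes_not_in PiE_iff extensional_def)
  qed
  then show "symmetric_rels e V \<subseteq> carrier (free_module (\<Pi>\<^sub>E i\<in>{..<e}. carrier V))"
    using multilinear_rels_closed[of "{..<e}" "\<lambda>_. V"] assms
    unfolding symmetric_rels_def by (auto intro!: free_diff_closed single_closed)
qed (use assms in \<open>auto simp: symmetric_rels_def\<close>)

lemma prod_functional_symmetric:
  assumes "functional V \<mu>" "r \<in> symmetric_rels e V"
  shows "lin_ext (\<lambda>v. \<Prod>i<e. \<mu> (v i)) r = 0"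
  using assms(2) unfolding symmetric_rels_def
proof
  assume "r \<in> multilinear_rels {..<e} (\<lambda>_. V)"
  then show ?thesis using prod_functionals_multilinear[of "{..<e}" "\<lambda>_. V" "\<lambda>_. \<mu>"] assms(1) by simp
next
  assume "r \<in> {Poly_Mapping.single (v \<circ> \<pi>) 1 - Poly_Mapping.single v 1 | v \<pi>.
      v \<in> {..<e} \<rightarrow>\<^sub>E carrier V \<and> \<pi> permutes {..<e}}"
  then obtain v \<pi> where r: "r = Poly_Mapping.single (v \<circ> \<pi>) 1 - Poly_Mapping.single v 1"
    and \<pi>: "\<pi> permutes {..<e}" by blast
  have "(\<Prod>i<e. \<mu> (v (\<pi> i))) = (\<Prod>i<e. \<mu> (v i))"
    using prod.permute[OF \<pi>, of "\<lambda>i. \<mu> (v i)"] by (simp add: comp_def)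
  then show ?thesis by (simp add: r lin_ext_diff)
qed

lemma symmetric_rels_map:
  assumes f: "linear_endo V f" and r: "r \<in> symmetric_rels e V"
  shows "free_map (\<lambda>v. \<lambda>i\<in>{..<e}. f (v i)) r \<in> symmetric_rels e V"
  using r unfolding symmetric_rels_def
proof
  let ?h = "\<lambda>v. \<lambda>i\<in>{..<e}. f (v i)"
  assume "r \<in> {Poly_Mapping.single (v \<circ> \<pi>) 1 - Poly_Mapping.single v 1 | v \<pi>.
      v \<in> {..<e} \<rightarrow>\<^sub>E carrier V \<and> \<pi> permutes {..<e}}"
  then obtain v \<pi> where r: "r = Poly_Mapping.single (v \<circ> \<pi>) 1 - Poly_Mapping.single v 1"
    and \<pi>: "\<pi> permutes {..<e}" and v: "v \<in> {..<e} \<rightarrow>\<^sub>E carrier V" by blast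
  have "?h (v \<circ> \<pi>) = ?h v \<circ> \<pi>"
    using permutes_in_image[OF \<pi>] by (auto simp: fun_eq_iff)
  then have "free_map ?h r = Poly_Mapping.single (?h v \<circ> \<pi>) 1 - Poly_Mapping.single (?h v) 1"
    unfolding r free_map_diff free_map_single by simp
  moreover have "?h v \<in> {..<e} \<rightarrow>\<^sub>E carrier V"
    using v linear_endo.endo_closed[OF f] by auto
  ultimately show "free_map ?h r \<in> multilinear_rels {..<e} (\<lambda>_. V) \<union>
      {Poly_Mapping.single (v \<circ> \<pi>) 1 - Poly_Mapping.single v 1 | v \<pi>.
        v \<in> {..<e} \<rightarrow>\<^sub>E carrier V \<and> \<pi> permutes {..<e}}"
    using \<pi> by blast
qed (use multilinear_rels_map[of "{..<e}" "\<lambda>_. V" "\<lambda>_. f"] f in auto)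

subsection \<open>Extension of scalars\<close>

lemma presented_rat_extension:
  assumes "comm_group A"
  shows "presented (carrier A \<times> UNIV) (rat_extension_rels A)"
proof
  interpret comm_group A by fact
  show "rat_extension_rels A \<subseteq> carrier (free_module (carrier A \<times> UNIV))"
    unfolding rat_extension_rels_def by (auto intro!: free_diff_closed single_closed)
qed

lemma rat_extension_functional:
  assumes "\<And>a b. \<lbrakk>a \<in> carrier A; b \<in> carrier A\<rbrakk> \<Longrightarrow> \<chi> (a \<otimes>\<^bsub>A\<^esub> b) = \<chi> a + \<chi> b"
    and "r \<in> rat_extension_rels A"
  shows "lin_ext (\<lambda>(a, q). of_rat q * \<chi> a) r = 0"
proof -
  from assms(2) consider
    a b q where "a \<in> carrier A" "b \<in> carrier A"
      "r = Poly_Mapping.single (a \<otimes>\<^bsub>A\<^esub> b, q) 1 - Poly_Mapping.single (a, q) 1 - Poly_Mapping.single (b, q) 1"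
  | a q q' where "r = Poly_Mapping.single (a, q + q') 1 - Poly_Mapping.single (a, q) 1 - Poly_Mapping.single (a, q') 1"
  | a c q where "r = Poly_Mapping.single (a, c * q) 1 - Poly_Mapping.single (a, q) c"
    unfolding rat_extension_rels_def by blast
  then show ?thesis
  proof cases
    case 1
    show ?thesis unfolding 1(3) lin_ext_diff lin_ext_single using 1 by (simp add: assms(1) algebra_simps)
  next
    case 2
    show ?thesis unfolding 2 lin_ext_diff lin_ext_single by (simp add: of_rat_add algebra_simps)
  next
    case 3
    show ?thesis unfolding 3 lin_ext_diff lin_ext_single by (simp add: of_rat_mult)
  qed
qed

lemma rat_extension_rels_map:
  assumes "\<alpha> \<in> hom A A" "r \<in> rat_extension_rels A"
  shows "free_map (\<lambda>(a, q). (\<alpha> a, q)) r \<in> rat_extension_rels A"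
proof -
  have c: "\<alpha> a \<in> carrier A" "\<alpha> (a \<otimes>\<^bsub>A\<^esub> b) = \<alpha> a \<otimes>\<^bsub>A\<^esub> \<alpha> b" if "a \<in> carrier A" "b \<in> carrier A" for a b
    using assms(1) that by (auto simp: hom_def)
  show ?thesis
    using assms(2) unfolding rat_extension_rels_def
    by (elim UnE; clarsimp simp: free_map_diff c) (use c in blast)+
qed

subsection \<open>Direct sums\<close>

lemma rat_vectorspaceD:
  fixes V :: "(rat, 'v, 'z) module_scheme"
  assumes "vectorspace class_ring V"
  shows "\<zero>\<^bsub>V\<^esub> \<in> carrier (V)"
    "\<And>v w. \<lbrakk>v \<in> carrier (V); w \<in> carrier (V)\<rbrakk> \<Longrightarrow> v \<oplus>\<^bsub>V\<^esub> w \<in> carrier (V)"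
    "\<And>c v. v \<in> carrier (V) \<Longrightarrow> c \<odot>\<^bsub>V\<^esub> v \<in> carrier (V)"
    "\<And>v w. \<lbrakk>v \<in> carrier (V); w \<in> carrier (V)\<rbrakk> \<Longrightarrow> v \<oplus>\<^bsub>V\<^esub> w = w \<oplus>\<^bsub>V\<^esub> v"
    "\<And>u v w. \<lbrakk>u \<in> carrier (V); v \<in> carrier (V); w \<in> carrier (V)\<rbrakk> \<Longrightarrow>
           (u \<oplus>\<^bsub>V\<^esub> v) \<oplus>\<^bsub>V\<^esub> w = u \<oplus>\<^bsub>V\<^esub> (v \<oplus>\<^bsub>V\<^esub> w)"
    "\<And>v. v \<in> carrier (V) \<Longrightarrow> v \<oplus>\<^bsub>V\<^esub> \<zero>\<^bsub>V\<^esub> = v"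
    "\<And>v. v \<in> carrier (V) \<Longrightarrow> v \<oplus>\<^bsub>V\<^esub> (- 1) \<odot>\<^bsub>V\<^esub> v = \<zero>\<^bsub>V\<^esub>"
    "\<And>c d v. v \<in> carrier (V) \<Longrightarrow> (c * d) \<odot>\<^bsub>V\<^esub> v = c \<odot>\<^bsub>V\<^esub> (d \<odot>\<^bsub>V\<^esub> v)"
    "\<And>v. v \<in> carrier (V) \<Longrightarrow> 1 \<odot>\<^bsub>V\<^esub> v = v"
    "\<And>c d v. v \<in> carrier (V) \<Longrightarrow> (c + d) \<odot>\<^bsub>V\<^esub> v = c \<odot>\<^bsub>V\<^esub> v \<oplus>\<^bsub>V\<^esub> d \<odot>\<^bsub>V\<^esub> v"
    "\<And>c v w. \<lbrakk>v \<in> carrier (V); w \<in> carrier (V)\<rbrakk> \<Longrightarrow>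
           c \<odot>\<^bsub>V\<^esub> (v \<oplus>\<^bsub>V\<^esub> w) = c \<odot>\<^bsub>V\<^esub> v \<oplus>\<^bsub>V\<^esub> c \<odot>\<^bsub>V\<^esub> w"
proof -
  interpret vectorspace class_ring V by fact
  fix u v w and c d :: rat
  show "\<zero>\<^bsub>V\<^esub> \<in> carrier V" by simp
  show "v \<oplus>\<^bsub>V\<^esub> (- 1) \<odot>\<^bsub>V\<^esub> v = \<zero>\<^bsub>V\<^esub>" if "v \<in> carrier V"
    using that rat_smult_minus_one[OF vectorspace_axioms that] by (simp add: r_neg)
  show "(c + d) \<odot>\<^bsub>V\<^esub> v = c \<odot>\<^bsub>V\<^esub> v \<oplus>\<^bsub>V\<^esub> d \<odot>\<^bsub>V\<^esub> v" if "v \<in> carrier V"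
    using smult_l_distr[of c d v] that by simp
  show "(c * d) \<odot>\<^bsub>V\<^esub> v = c \<odot>\<^bsub>V\<^esub> (d \<odot>\<^bsub>V\<^esub> v)" if "v \<in> carrier V"
    using smult_assoc1[of c d v] that by simp
  show "1 \<odot>\<^bsub>V\<^esub> v = v" if "v \<in> carrier V"
    using smult_one[of v] that by simp
  show "v \<oplus>\<^bsub>V\<^esub> w = w \<oplus>\<^bsub>V\<^esub> v" if "v \<in> carrier V" "w \<in> carrier V"
    using that by (rule a_comm)
  show "c \<odot>\<^bsub>V\<^esub> (v \<oplus>\<^bsub>V\<^esub> w) = c \<odot>\<^bsub>V\<^esub> v \<oplus>\<^bsub>V\<^esub> c \<odot>\<^bsub>V\<^esub> w" if "v \<in> carrier V" "w \<in> carrier V"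
    using that by (intro smult_r_distr) auto
  show "c \<odot>\<^bsub>V\<^esub> v \<in> carrier V" if "v \<in> carrier V"
    using that by simp
qed (simp_all add: assms(1)[unfolded vectorspace_def Module.module_def abelian_group_def]
    abelian_monoid.a_assoc abelian_monoid.a_closed abelian_monoid.r_zero)

lemma vectorspace_direct_sum:
  assumes "\<And>i. i \<in> I \<Longrightarrow> vectorspace class_ring (V i)" "finite I"
  shows "vectorspace class_ring (direct_sum_family I V)"
proof -
  have car: "carrier (direct_sum_family I V) = (\<Pi>\<^sub>E i\<in>I. carrier (V i))"
    using assms(2) by (auto simp: direct_sum_family_def)
  have ops: "\<zero>\<^bsub>direct_sum_family I V\<^esub> = (\<lambda>i\<in>I. \<zero>\<^bsub>V i\<^esub>)"
    "f \<oplus>\<^bsub>direct_sum_family I V\<^esub> g = (\<lambda>i\<in>I. f i \<oplus>\<^bsub>V i\<^esub> g i)"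
    "c \<odot>\<^bsub>direct_sum_family I V\<^esub> f = (\<lambda>i\<in>I. c \<odot>\<^bsub>V i\<^esub> f i)" for f g c
    by (simp_all add: direct_sum_family_def)
  note V = rat_vectorspaceD[OF assms(1)]
  show ?thesis
    by (rule rat_vectorspaceI; unfold car ops) (auto simp: V(1-3,5-11) PiE_iff extensional_def fun_eq_iff intro: V(4))
qed

section \<open>Symmetric powers of the rational abelianization and their functionals\<close>

definition mono_eval :: "nat \<Rightarrow> nat \<Rightarrow> ((nat \<times> nat) \<times> nat \<Rightarrow> complex) \<Rightarrow>
    ((nat \<times> nat) \<times> nat \<Rightarrow> nat) \<Rightarrow> complex" where
  "mono_eval m n a \<epsilon> = (\<Prod>p\<in>entry_positions m. \<Prod>l<n. a (p, l) ^ \<epsilon> (p, l))"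

lemma finite_entry_positions [simp]: "finite (entry_positions m)"
  by (simp add: entry_positions_def)

lemma finite_monomial_exponents: "finite (monomial_exponents m n k)"
proof (rule finite_subset)
  show "monomial_exponents m n k \<subseteq> entry_positions m \<times> {..<n} \<rightarrow>\<^sub>E {..k}"
  proof
    fix e assume e: "e \<in> monomial_exponents m n k"
    have "e q \<le> k" if "q \<in> entry_positions m \<times> {..<n}" for q
    proof -
      have "e q \<le> (\<Sum>q\<in>entry_positions m \<times> {..<n}. e q)"
        using that by (intro member_le_sum) auto
      also have "\<dots> = k"
        using e by (simp add: monomial_exponents_def sum.cartesian_product)
      finally show ?thesis .
    qed
    then show "e \<in> entry_positions m \<times> {..<n} \<rightarrow>\<^sub>E {..k}"
      using e by (auto simp: monomial_exponents_def PiE_iff)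
  qed
qed (intro finite_PiE; simp)

lemma finite_entry_exponents: "finite (entry_exponents m k)"
proof (rule finite_subset)
  show "entry_exponents m k \<subseteq> entry_positions m \<rightarrow>\<^sub>E {..k}"
  proof
    fix e assume e: "e \<in> entry_exponents m k"
    have "e q \<le> k" if "q \<in> entry_positions m" for q
      using e member_le_sum[OF that, of e] by (simp add: entry_exponents_def)
    then show "e \<in> entry_positions m \<rightarrow>\<^sub>E {..k}"
      using e by (auto simp: entry_exponents_def PiE_iff)
  qed
qed (intro finite_PiE; simp)

lemma mono_eval_independent:
  assumes "\<And>a. (\<Sum>\<epsilon>\<in>monomial_exponents m n k. of_rat (c \<epsilon>) * mono_eval m n a \<epsilon>) = 0"
    and "\<epsilon> \<in> monomial_exponents m n k"
  shows "c \<epsilon> = 0"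
proof -
  have "of_rat (c \<epsilon>) = (0 :: complex)"
  proof (rule monomials_linearly_independent[of "entry_positions m \<times> {..<n}" "monomial_exponents m n k"
        "\<lambda>\<epsilon>. of_rat (c \<epsilon>)", OF _ finite_monomial_exponents _ _ assms(2)])
    show "monomial_exponents m n k \<subseteq> entry_positions m \<times> {..<n} \<rightarrow>\<^sub>E UNIV"
      by (auto simp: monomial_exponents_def)
    show "(\<Sum>\<epsilon>\<in>monomial_exponents m n k. of_rat (c \<epsilon>) *
        (\<Prod>q\<in>entry_positions m \<times> {..<n}. a q ^ \<epsilon> q)) = 0" for a :: "(nat \<times> nat) \<times> nat \<Rightarrow> complex"
      using assms(1)[of a] by (simp add: mono_eval_def prod.cartesian_product)
  qed simp
  then show ?thesis by simp
qed

text \<open>A normal form of words up to permutation of their letters: such a word stands for a monomial,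
  and \<open>c\<close> is its exponent vector.\<close>

definition sorted_word :: "nat \<Rightarrow> (nat \<Rightarrow> nat) \<Rightarrow> nat list" where
  "sorted_word n c = concat (map (\<lambda>l. replicate (c l) l) [0..<n])"

lemma length_sorted_word: "length (sorted_word n c) = (\<Sum>l<n. c l)"
  by (induction n) (simp_all add: sorted_word_def)

lemma set_sorted_word: "set (sorted_word n c) \<subseteq> {..<n}"
  by (auto simp: sorted_word_def)

lemma prod_list_sorted_word:
  fixes f :: "nat \<Rightarrow> 'a :: comm_monoid_mult"
  shows "prod_list (map f (sorted_word n c)) = (\<Prod>l<n. f l ^ c l)"
  by (induction n) (simp_all add: sorted_word_def)

lemma count_sorted_word: "count (mset (sorted_word n c)) l = (if l < n then c l else 0)"
  by (induction n) (auto simp: sorted_word_def)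

text \<open>Two words with the same letters, counted with multiplicity, differ by a permutation.\<close>

lemma word_permutes_to_sorted_word:
  assumes "w \<in> {..<d} \<rightarrow> {..<n}" and c: "\<And>l. l < n \<Longrightarrow> c l = card {i. i < d \<and> w i = l}"
  shows "\<exists>\<pi>. \<pi> permutes {..<d} \<and> (\<forall>i<d. w i = sorted_word n c ! \<pi> i)"
proof -
  have "count (mset (map w [0..<d])) l = count (mset (sorted_word n c)) l" for l
  proof -
    have "count (mset (map w [0..<d])) l = card {i. i < d \<and> w i = l}"
    proof -
      have "w -` {l} \<inter> {0..<d} = {i. i < d \<and> w i = l}" by auto
      then show ?thesis by (simp add: count_image_mset)
    qed
    moreover have "card {i. i < d \<and> w i = l} = 0" if "\<not> l < n"
      using assms(1) that by (auto simp: Pi_iff)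
    ultimately show ?thesis using c by (simp add: count_sorted_word)
  qed
  then have eq: "mset (map w [0..<d]) = mset (sorted_word n c)"
    by (simp add: multiset_eq_iff)
  then obtain \<pi> where \<pi>: "\<pi> permutes {..<length (sorted_word n c)}"
      "permute_list \<pi> (sorted_word n c) = map w [0..<d]"
    by (rule mset_eq_permutation)
  have len: "length (sorted_word n c) = d"
    using arg_cong[OF eq, of size] by simp
  have "w i = sorted_word n c ! \<pi> i" if "i < d" for i
    using permute_list_nth[OF \<pi>(1), of i] \<pi>(2) that len by simp
  then show ?thesis using \<pi>(1) len by auto
qed

context free_basis
begin

interpretation ab: comm_group Gab
  by (rule ab_comm_group)

interpretation HQ: presented "carrier Gab \<times> UNIV" "rat_extension_rels Gab"
  by (rule presented_rat_extension[OF ab_comm_group])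

abbreviation "H \<equiv> H_rat G"

lemma vectorspace_H: "vectorspace class_ring H"
  unfolding rat_extension_def by (rule HQ.vectorspace_P)

definition H_gen :: "'a set \<Rightarrow> rat \<Rightarrow> ('a set \<times> rat \<Rightarrow>\<^sub>0 rat) set" where
  "H_gen C q = HQ.gen (C, q)"

lemma H_gen_closed: "C \<in> carrier Gab \<Longrightarrow> H_gen C q \<in> carrier H"
  unfolding H_gen_def rat_extension_def by (intro HQ.gen_closed) simp

lemma H_gen_mult:
  assumes "C \<in> carrier Gab" "D \<in> carrier Gab"
  shows "H_gen (C \<otimes>\<^bsub>Gab\<^esub> D) q = H_gen C q \<oplus>\<^bsub>H\<^esub> H_gen D q"
proof -
  have "Poly_Mapping.single (C \<otimes>\<^bsub>Gab\<^esub> D, q) 1 - Poly_Mapping.single (C, q) 1 - Poly_Mapping.single (D, q) 1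
      \<in> rat_extension_rels Gab"
    unfolding rat_extension_rels_def using assms by blast
  then show ?thesis
    unfolding H_gen_def rat_extension_def using assms by (intro HQ.gen_add_relation) auto
qed

lemma H_gen_smult:
  assumes "C \<in> carrier Gab"
  shows "H_gen C (c * q) = c \<odot>\<^bsub>H\<^esub> H_gen C q"
proof -
  have "Poly_Mapping.single (C, c * q) 1 - Poly_Mapping.single (C, q) c \<in> rat_extension_rels Gab"
    unfolding rat_extension_rels_def using assms by blast
  then show ?thesis
    unfolding H_gen_def rat_extension_def using assms by (intro HQ.gen_smult_relation) auto
qed

lemma H_gen_one: "H_gen \<one>\<^bsub>Gab\<^esub> q = \<zero>\<^bsub>H\<^esub>"
proof -
  interpret HV: vectorspace class_ring H by (rule vectorspace_H)
  have "H_gen \<one>\<^bsub>Gab\<^esub> q = H_gen \<one>\<^bsub>Gab\<^esub> q \<oplus>\<^bsub>H\<^esub> H_gen \<one>\<^bsub>Gab\<^esub> q"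
    using H_gen_mult[of "\<one>\<^bsub>Gab\<^esub>" "\<one>\<^bsub>Gab\<^esub>" q] by simp
  then show ?thesis
    using H_gen_closed[of "\<one>\<^bsub>Gab\<^esub>" q] HV.add.l_cancel_one by simp
qed

definition H_basis :: "nat \<Rightarrow> ('a set \<times> rat \<Rightarrow>\<^sub>0 rat) set" where
  "H_basis l = H_gen (ab_class G (x l)) 1"

lemma H_basis_closed: "l < n \<Longrightarrow> H_basis l \<in> carrier H"
  unfolding H_basis_def by (intro H_gen_closed ab_class_closed x_closed)

text \<open>Scalars can be pulled out of \<open>y \<otimes> q\<close>, and \<open>y \<mapsto> y \<otimes> 1\<close> is a homomorphism, so that it suffices to
  consider generators of the group.\<close>

lemma lin_gen_H: "carrier H \<subseteq> lin_gen H (H_basis ` {..<n})"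
proof -
  interpret HV: vectorspace class_ring H by (rule vectorspace_H)
  have one: "H_gen (ab_class G y) 1 \<in> lin_gen H (H_basis ` {..<n})" if "y \<in> carrier G" for y
    using that
  proof (induction rule: generator_induct)
    case one
    have "ab_class G \<one> = \<one>\<^bsub>Gab\<^esub>"
      using hom_one[OF ab_class_hom is_group ab.group_axioms] .
    then show ?case by (simp add: H_gen_one lin_gen.zero)
  next
    case (gen i)
    then show ?case by (intro lin_gen.base) (simp add: H_basis_def)
  next
    case (inv i)
    have "ab_class G (x i) \<otimes>\<^bsub>Gab\<^esub> ab_class G (inv (x i)) = ab_class G (x i \<otimes> inv (x i))"
      using inv by (intro hom_mult[OF ab_class_hom, symmetric]) auto
    also have "\<dots> = \<one>\<^bsub>Gab\<^esub>"
      using hom_one[OF ab_class_hom is_group ab.group_axioms] inv by simp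
    finally have "H_basis i \<oplus>\<^bsub>H\<^esub> H_gen (ab_class G (inv (x i))) 1 = \<zero>\<^bsub>H\<^esub>"
      using H_gen_mult[of "ab_class G (x i)" "ab_class G (inv (x i))" 1] inv
      by (simp add: H_basis_def H_gen_one)
    then have "H_gen (ab_class G (inv (x i))) 1 = \<ominus>\<^bsub>H\<^esub> H_basis i"
      using HV.minus_equality[of "H_gen (ab_class G (inv (x i))) 1" "H_basis i"] inv
        H_basis_closed H_gen_closed by (simp add: HV.a_comm)
    also have "\<dots> = (- 1) \<odot>\<^bsub>H\<^esub> H_basis i"
      using rat_smult_minus_one[OF vectorspace_H H_basis_closed[OF inv]] by simp
    finally show ?case using inv by (simp add: lin_gen.smult lin_gen.base)
  next
    case (mult y z)
    then have "H_gen (ab_class G (y \<otimes> z)) 1 = H_gen (ab_class G y) 1 \<oplus>\<^bsub>H\<^esub> H_gen (ab_class G z) 1"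
      using ab_class_hom by (simp add: hom_def H_gen_mult)
    then show ?case using mult by (simp add: lin_gen.add)
  qed
  have "HQ.gen ` (carrier Gab \<times> UNIV) \<subseteq> lin_gen H (H_basis ` {..<n})"
  proof clarify
    fix C and q :: rat assume "C \<in> carrier Gab"
    then obtain y where y: "y \<in> carrier G" "C = ab_class G y" unfolding carrier_ab by blast
    have "HQ.gen (C, q) = q \<odot>\<^bsub>H\<^esub> H_gen C 1"
      using H_gen_smult[OF \<open>C \<in> carrier Gab\<close>, of q 1] by (simp add: H_gen_def)
    then show "HQ.gen (C, q) \<in> lin_gen H (H_basis ` {..<n})"
      using one[OF y(1)] y(2) by (simp add: lin_gen.smult)
  qed
  from lin_gen_subset[OF this] show ?thesis
    using HQ.lin_gen_P unfolding rat_extension_def by blast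
qed

text \<open>The choice of a representative does not matter, as exponent sums vanish on commutators.\<close>

definition ab_expo :: "nat \<Rightarrow> 'a set \<Rightarrow> int" where
  "ab_expo j C = expo j (SOME y. y \<in> C)"

lemma ab_expo_class: "y \<in> carrier G \<Longrightarrow> ab_expo j (ab_class G y) = expo j y"
  unfolding ab_expo_def using expo_coset ab_class_self someI[of "\<lambda>z. z \<in> ab_class G y" y] by blast

definition H_char :: "(nat \<Rightarrow> complex) \<Rightarrow> 'a set \<Rightarrow> complex" where
  "H_char a C = (\<Sum>j<n. of_int (ab_expo j C) * a j)"

lemma H_char_mult:
  assumes "C \<in> carrier Gab" "D \<in> carrier Gab"
  shows "H_char a (C \<otimes>\<^bsub>Gab\<^esub> D) = H_char a C + H_char a D"
proof -
  obtain y z where yz: "y \<in> carrier G" "z \<in> carrier G" "C = ab_class G y" "D = ab_class G z"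
    using assms unfolding carrier_ab by blast
  have "C \<otimes>\<^bsub>Gab\<^esub> D = ab_class G (y \<otimes> z)"
    using yz ab_class_hom by (simp add: hom_def)
  then show ?thesis
    using yz by (simp add: H_char_def ab_expo_class expo_mult algebra_simps sum.distrib)
qed

definition H_fun :: "(nat \<Rightarrow> complex) \<Rightarrow> ('a set \<times> rat \<Rightarrow>\<^sub>0 rat) set \<Rightarrow> complex" where
  "H_fun a = HQ.pres_fun (\<lambda>(C, q). of_rat q * H_char a C)"

lemmas H_fun_rels = rat_extension_functional[of Gab "H_char _", OF H_char_mult]

lemma functional_H_fun: "functional H (H_fun a)"
  unfolding H_fun_def rat_extension_def by (rule HQ.functional_pres_fun[OF H_fun_rels])

lemma H_fun_basis: "l < n \<Longrightarrow> H_fun a (H_basis l) = a l"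
proof -
  assume l: "l < n"
  have "H_fun a (H_basis l) = H_char a (ab_class G (x l))"
    unfolding H_fun_def H_basis_def H_gen_def
    using l by (subst HQ.pres_fun_gen[OF H_fun_rels]) auto
  also have "\<dots> = (\<Sum>j<n. if j = l then a l else 0)"
    unfolding H_char_def by (rule sum.cong) (use l in \<open>auto simp: ab_expo_class expo_x\<close>)
  finally show ?thesis using l by simp
qed

text \<open>Replacing \<open>x l\<close> by a product of the \<open>x j\<close> with exponents \<open>A l j\<close> replaces the coordinate
  \<open>a l\<close> by this linear form.\<close>

definition subst_matrix :: "(nat \<Rightarrow> nat \<Rightarrow> int) \<Rightarrow> (nat \<Rightarrow> complex) \<Rightarrow> nat \<Rightarrow> complex" where
  "subst_matrix A a l = (\<Sum>j<n. of_int (A l j) * a j)"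

abbreviation "H_map \<sigma> \<equiv> rat_extension_map Gab (ab_aut G \<sigma>)"

lemma
  assumes \<sigma>: "realizes \<sigma> A"
  shows linear_endo_H_map: "linear_endo H (H_map \<sigma>)"
    and H_fun_H_map: "u \<in> carrier H \<Longrightarrow> H_fun a (H_map \<sigma> u) = H_fun (subst_matrix A a) u"
proof -
  have au: "\<sigma> \<in> auto G" using \<sigma> by (simp add: realizes_def)
  have hom: "ab_aut G \<sigma> \<in> hom Gab Gab" using ab_aut_auto[OF au] by (simp add: auto_def)
  let ?h = "\<lambda>(C, q :: rat). (ab_aut G \<sigma> C, q)"
  have h: "?h ` (carrier Gab \<times> UNIV) \<subseteq> carrier Gab \<times> UNIV"
    using hom by (auto simp: hom_def)
  have r: "free_map ?h r \<in> HQ.R" if "r \<in> rat_extension_rels Gab" for r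
    using rat_extension_rels_map[OF hom that] HQ.rels_subset_R by blast
  show "linear_endo H (H_map \<sigma>)"
    unfolding rat_extension_def rat_extension_map_def
    by (rule HQ.linear_endo_presented_map[OF h r])
  have char: "H_char a (ab_aut G \<sigma> C) = H_char (subst_matrix A a) C" if "C \<in> carrier Gab" for C
  proof -
    obtain y where y: "y \<in> carrier G" "C = ab_class G y" using \<open>C \<in> carrier Gab\<close> unfolding carrier_ab by blast
    have "expo j (\<sigma> y) = (\<Sum>l<n. expo l y * A l j)" if "j < n" for j
    proof -
      have "expo j (\<sigma> y) = (\<Sum>l<n. expo l y * expo j (\<sigma> (x l)))"
        using au y by (intro expo_hom_endo) (auto simp: auto_def)
      also have "\<dots> = (\<Sum>l<n. expo l y * A l j)"
        by (rule sum.cong) (use \<sigma> that in \<open>auto simp: realizes_def\<close>)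
      finally show ?thesis .
    qed
    then have "H_char a (ab_aut G \<sigma> C) = (\<Sum>j<n. \<Sum>l<n. of_int (expo l y) * of_int (A l j) * a j)"
      using y by (simp add: H_char_def ab_aut_class[OF au] ab_expo_class auto_closed[OF au] sum_distrib_right)
    also have "\<dots> = (\<Sum>l<n. \<Sum>j<n. of_int (expo l y) * of_int (A l j) * a j)"
      by (rule sum.swap)
    finally show ?thesis
      using y by (simp add: H_char_def subst_matrix_def ab_expo_class sum_distrib_left ac_simps)
  qed
  show "H_fun a (H_map \<sigma> u) = H_fun (subst_matrix A a) u" if "u \<in> carrier H"
    unfolding H_fun_def rat_extension_map_def
    using that by (intro HQ.pres_fun_presented_map[OF h r H_fun_rels H_fun_rels])
      (auto simp: char rat_extension_def)
qed

subsection \<open>The symmetric powers\<close>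

abbreviation "Sym d \<equiv> symmetric_power d H"

interpretation Sym: multilinear "{..<d}" "\<lambda>_. H" "symmetric_rels d H" for d
  by (rule multilinear_symmetric[OF vectorspace_H])

lemma vectorspace_Sym: "vectorspace class_ring (Sym d)"
  unfolding symmetric_power_def by (rule Sym.vectorspace_P)

definition Sym_fun :: "(nat \<Rightarrow> complex) \<Rightarrow> nat \<Rightarrow> _ \<Rightarrow> complex" where
  "Sym_fun a d = Sym.pres_fun (\<lambda>v. \<Prod>i<d. H_fun a (v i))"

lemmas Sym_fun_rels = prod_functional_symmetric[OF functional_H_fun]

lemma functional_Sym_fun: "functional (Sym d) (Sym_fun a d)"
  unfolding Sym_fun_def symmetric_power_def by (rule Sym.functional_pres_fun[OF Sym_fun_rels])

definition Sym_word :: "nat \<Rightarrow> (nat \<Rightarrow> nat) \<Rightarrow> ((nat \<Rightarrow> _) \<Rightarrow>\<^sub>0 rat) set" where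
  "Sym_word d w = Sym.gen d (\<lambda>i\<in>{..<d}. H_basis (w i))"

definition Sym_monomial :: "nat \<Rightarrow> (nat \<Rightarrow> nat) \<Rightarrow> ((nat \<Rightarrow> _) \<Rightarrow>\<^sub>0 rat) set" where
  "Sym_monomial d c = Sym_word d (\<lambda>i. sorted_word n c ! i)"

lemma Sym_word_closed:
  assumes "w \<in> {..<d} \<rightarrow> {..<n}"
  shows "Sym_word d w \<in> carrier (Sym d)"
  unfolding Sym_word_def symmetric_power_def
  using assms by (intro Sym.gen_closed) (auto intro!: H_basis_closed)

lemma sorted_word_letters:
  assumes "(\<Sum>l<n. c l) = d"
  shows "(\<lambda>i. sorted_word n c ! i) \<in> {..<d} \<rightarrow> {..<n}"
  using assms set_sorted_word[of n c] by (force simp: length_sorted_word[symmetric])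

text \<open>The symmetric relations permit sorting the letters of a word.\<close>

lemma Sym_word_eq_monomial:
  assumes w: "w \<in> {..<d} \<rightarrow> {..<n}"
  shows "Sym_word d w = Sym_monomial d (\<lambda>l. card {i. i < d \<and> w i = l})"
proof -
  let ?c = "\<lambda>l. card {i. i < d \<and> w i = l}"
  obtain \<pi> where \<pi>: "\<pi> permutes {..<d}" "\<And>i. i < d \<Longrightarrow> w i = sorted_word n ?c ! \<pi> i"
    using word_permutes_to_sorted_word[OF w, of ?c] by auto
  have img: "\<pi> i < d \<longleftrightarrow> i < d" for i using permutes_in_image[OF \<pi>(1), of i] by simp
  let ?v = "\<lambda>i\<in>{..<d}. H_basis (sorted_word n ?c ! i)"
  have eq: "(\<lambda>i\<in>{..<d}. H_basis (w i)) = ?v \<circ> \<pi>"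
    using \<pi>(2) img by (auto simp: fun_eq_iff)
  have v: "?v \<in> {..<d} \<rightarrow>\<^sub>E carrier H"
  proof (rule restrict_PiE_iff[THEN iffD2], rule ballI)
    fix i assume "i \<in> {..<d}"
    then have "inv_into UNIV \<pi> i \<in> {..<d}" "\<pi> (inv_into UNIV \<pi> i) = i"
      using permutes_in_image[OF permutes_inv[OF \<pi>(1)]] permutes_inverses(1)[OF \<pi>(1)] by auto
    then have "sorted_word n ?c ! i \<in> {..<n}"
      using \<pi>(2)[of "inv_into UNIV \<pi> i"] funcset_mem[OF w, of "inv_into UNIV \<pi> i"] by simp
    then show "H_basis (sorted_word n ?c ! i) \<in> carrier H" by (simp add: H_basis_closed)
  qed
  have "(\<lambda>i\<in>{..<d}. H_basis (w i)) \<in> {..<d} \<rightarrow>\<^sub>E carrier H"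
    using w by (auto intro!: H_basis_closed)
  then have v\<pi>: "?v \<circ> \<pi> \<in> {..<d} \<rightarrow>\<^sub>E carrier H" by (simp only: eq)
  have "Poly_Mapping.single (?v \<circ> \<pi>) 1 - Poly_Mapping.single ?v 1 \<in> symmetric_rels d H"
    unfolding symmetric_rels_def using v \<pi>(1) by blast
  then show ?thesis
    unfolding Sym_monomial_def Sym_word_def eq using v v\<pi> by (intro Sym.gen_eq_relation) auto
qed

lemma lin_gen_Sym: "carrier (Sym d) \<subseteq> lin_gen (Sym d) (Sym_word d ` ({..<d} \<rightarrow> {..<n}))"
proof -
  have "Sym.gen d ` ({..<d} \<rightarrow>\<^sub>E H_basis ` {..<n}) \<subseteq> Sym_word d ` ({..<d} \<rightarrow> {..<n})"
  proof (rule image_subsetI)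
    fix v assume v: "v \<in> {..<d} \<rightarrow>\<^sub>E H_basis ` {..<n}"
    then have "\<forall>i\<in>{..<d}. \<exists>l\<in>{..<n}. v i = H_basis l" by (auto simp: PiE_iff)
    then obtain w where w: "\<forall>i\<in>{..<d}. w i \<in> {..<n} \<and> v i = H_basis (w i)" by metis
    then have "v = (\<lambda>i\<in>{..<d}. H_basis (w i))" using v by (auto simp: PiE_iff extensional_def fun_eq_iff)
    then have "Sym.gen d v = Sym_word d w" by (simp add: Sym_word_def)
    then show "Sym.gen d v \<in> Sym_word d ` ({..<d} \<rightarrow> {..<n})" using w by auto
  qed
  then have "lin_gen (Sym d) (Sym.gen d ` ({..<d} \<rightarrow>\<^sub>E H_basis ` {..<n})) \<subseteq>
      lin_gen (Sym d) (Sym_word d ` ({..<d} \<rightarrow> {..<n}))"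
    by (rule lin_gen_mono)
  moreover have "carrier (Sym d) \<subseteq> lin_gen (Sym d) (Sym.gen d ` ({..<d} \<rightarrow>\<^sub>E H_basis ` {..<n}))"
    unfolding symmetric_power_def
    by (rule Sym.lin_gen_multilinear[of d "\<lambda>_. H_basis ` {..<n}"])
      (use lin_gen_H H_basis_closed in auto)
  ultimately show ?thesis by blast
qed

lemma Sym_fun_monomial:
  assumes "(\<Sum>l<n. c l) = d"
  shows "Sym_fun a d (Sym_monomial d c) = (\<Prod>l<n. a l ^ c l)"
proof -
  have w: "sorted_word n c ! i < n" if "i < d" for i
    using sorted_word_letters[OF assms] that by (auto simp: Pi_iff)
  have "Sym_fun a d (Sym_monomial d c) = (\<Prod>i<d. a (sorted_word n c ! i))"
    unfolding Sym_fun_def Sym_monomial_def Sym_word_def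
    by (subst Sym.pres_fun_gen[OF Sym_fun_rels]) (auto simp: w H_basis_closed H_fun_basis)
  also have "\<dots> = prod_list (map a (sorted_word n c))"
    using assms by (simp add: prod.list_conv_set_nth length_sorted_word atLeast0LessThan)
  finally show ?thesis by (simp add: prod_list_sorted_word)
qed

abbreviation "Sym_map d \<sigma> \<equiv> symmetric_power_map d H (H_map \<sigma>)"

lemma
  assumes \<sigma>: "realizes \<sigma> A"
  shows linear_endo_Sym_map: "linear_endo (Sym d) (Sym_map d \<sigma>)"
    and Sym_fun_Sym_map:
      "u \<in> carrier (Sym d) \<Longrightarrow> Sym_fun a d (Sym_map d \<sigma> u) = Sym_fun (subst_matrix A a) d u"
proof -
  let ?h = "\<lambda>v. \<lambda>i\<in>{..<d}. H_map \<sigma> (v i)"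
  note f = linear_endo_H_map[OF \<sigma>]
  have h: "?h ` ({..<d} \<rightarrow>\<^sub>E carrier H) \<subseteq> {..<d} \<rightarrow>\<^sub>E carrier H"
    by (intro image_subsetI restrict_PiE_iff[THEN iffD2] ballI linear_endo.endo_closed[OF f])
      (rule PiE_mem)
  have r: "free_map ?h r \<in> Sym.R d" if "r \<in> symmetric_rels d H" for r
    using symmetric_rels_map[OF f that] Sym.rels_subset_R by blast
  show "linear_endo (Sym d) (Sym_map d \<sigma>)"
    unfolding symmetric_power_def symmetric_power_map_def
    by (rule Sym.linear_endo_presented_map[OF h r])
  show "Sym_fun a d (Sym_map d \<sigma> u) = Sym_fun (subst_matrix A a) d u" if "u \<in> carrier (Sym d)"
    unfolding Sym_fun_def symmetric_power_map_def
    using that by (intro Sym.pres_fun_presented_map[OF h r Sym_fun_rels Sym_fun_rels])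
      (auto simp: symmetric_power_def H_fun_H_map[OF \<sigma>] PiE_iff)
qed

subsection \<open>The tensor products of symmetric powers\<close>

abbreviation "Tens m e \<equiv> tensor_product (entry_positions m) (\<lambda>p. Sym (e p))"

interpretation Tens: multilinear "entry_positions m" "\<lambda>p. Sym (e p)"
    "multilinear_rels (entry_positions m) (\<lambda>p. Sym (e p))" for m e
  by (rule multilinear_tensor[OF finite_entry_positions vectorspace_Sym])

lemma vectorspace_Tens: "vectorspace class_ring (Tens m e)"
  unfolding tensor_product_def by (rule Tens.vectorspace_P)

definition Tens_fun :: "((nat \<times> nat) \<times> nat \<Rightarrow> complex) \<Rightarrow> nat \<Rightarrow> (nat \<times> nat \<Rightarrow> nat) \<Rightarrow> _ \<Rightarrow> complex" where
  "Tens_fun a m e =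
     Tens.pres_fun (\<lambda>v. \<Prod>p\<in>entry_positions m. Sym_fun (\<lambda>l. a (p, l)) (e p) (v p))"

lemma Tens_fun_rels:
  "r \<in> multilinear_rels (entry_positions m) (\<lambda>p. Sym (e p)) \<Longrightarrow>
     lin_ext (\<lambda>v. \<Prod>p\<in>entry_positions m. Sym_fun (\<lambda>l. a (p, l)) (e p) (v p)) r = 0"
  by (rule prod_functionals_multilinear[OF finite_entry_positions functional_Sym_fun])

lemma functional_Tens_fun: "functional (Tens m e) (Tens_fun a m e)"
  unfolding Tens_fun_def tensor_product_def by (rule Tens.functional_pres_fun[OF Tens_fun_rels])

definition row_sums :: "nat \<Rightarrow> ((nat \<times> nat) \<times> nat \<Rightarrow> nat) \<Rightarrow> nat \<times> nat \<Rightarrow> nat" where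
  "row_sums m \<epsilon> = (\<lambda>p\<in>entry_positions m. \<Sum>l<n. \<epsilon> (p, l))"

lemma row_sums_entry_exponents:
  "\<epsilon> \<in> monomial_exponents m n k \<Longrightarrow> row_sums m \<epsilon> \<in> entry_exponents m k"
  by (simp add: monomial_exponents_def entry_exponents_def row_sums_def)

definition Tens_monomial :: "nat \<Rightarrow> ((nat \<times> nat) \<times> nat \<Rightarrow> nat) \<Rightarrow> _" where
  "Tens_monomial m \<epsilon> =
     Tens.gen m (row_sums m \<epsilon>) (\<lambda>p\<in>entry_positions m. Sym_monomial (row_sums m \<epsilon> p) (\<lambda>l. \<epsilon> (p, l)))"

lemma Sym_monomial_closed:
  "p \<in> entry_positions m \<Longrightarrow>
     Sym_monomial (row_sums m \<epsilon> p) (\<lambda>l. \<epsilon> (p, l)) \<in> carrier (Sym (row_sums m \<epsilon> p))"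
  unfolding Sym_monomial_def by (intro Sym_word_closed sorted_word_letters) (simp add: row_sums_def)

lemma Tens_monomial_closed: "Tens_monomial m \<epsilon> \<in> carrier (Tens m (row_sums m \<epsilon>))"
  unfolding Tens_monomial_def tensor_product_def
  by (intro Tens.gen_closed) (simp add: restrict_PiE_iff Sym_monomial_closed)

lemma Tens_fun_monomial: "Tens_fun a m (row_sums m \<epsilon>) (Tens_monomial m \<epsilon>) = mono_eval m n a \<epsilon>"
proof -
  have "Tens_fun a m (row_sums m \<epsilon>) (Tens_monomial m \<epsilon>) =
      (\<Prod>p\<in>entry_positions m. Sym_fun (\<lambda>l. a (p, l)) (row_sums m \<epsilon> p)
         (Sym_monomial (row_sums m \<epsilon> p) (\<lambda>l. \<epsilon> (p, l))))"
    unfolding Tens_fun_def Tens_monomial_def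
    by (subst Tens.pres_fun_gen[OF Tens_fun_rels]) (auto simp: restrict_PiE_iff Sym_monomial_closed)
  also have "\<dots> = mono_eval m n a \<epsilon>"
    unfolding mono_eval_def
    by (rule prod.cong[OF refl]) (simp add: Sym_fun_monomial row_sums_def)
  finally show ?thesis .
qed

text \<open>Expanding all factors in words of basis elements and sorting these words leaves one pure tensor for
  each exponent vector.\<close>

lemma lin_gen_Tens:
  assumes e: "e \<in> entry_exponents m k"
  shows "carrier (Tens m e) \<subseteq>
    lin_gen (Tens m e) (Tens_monomial m ` {\<epsilon> \<in> monomial_exponents m n k. row_sums m \<epsilon> = e})"
proof -
  let ?S = "\<lambda>p. Sym_word (e p) ` ({..<e p} \<rightarrow> {..<n})"
  let ?M = "{\<epsilon> \<in> monomial_exponents m n k. row_sums m \<epsilon> = e}"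
  have "Tens.gen m e ` (\<Pi>\<^sub>E p\<in>entry_positions m. ?S p) \<subseteq> Tens_monomial m ` ?M"
  proof (rule image_subsetI)
    fix v assume v: "v \<in> (\<Pi>\<^sub>E p\<in>entry_positions m. ?S p)"
    have "\<exists>w. w \<in> {..<e p} \<rightarrow> {..<n} \<and> v p = Sym_word (e p) w" if "p \<in> entry_positions m" for p
      using PiE_mem[OF v that] by blast
    then obtain w where w: "\<And>p. p \<in> entry_positions m \<Longrightarrow> w p \<in> {..<e p} \<rightarrow> {..<n}"
        "\<And>p. p \<in> entry_positions m \<Longrightarrow> v p = Sym_word (e p) (w p)" by metis
    define \<epsilon> where "\<epsilon> = (\<lambda>(p, l)\<in>entry_positions m \<times> {..<n}. card {i. i < e p \<and> w p i = l})"
    have row: "(\<Sum>l<n. \<epsilon> (p, l)) = e p" if p: "p \<in> entry_positions m" for p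
    proof -
      have "w p ` {..<e p} \<subseteq> {..<n}" using w(1)[OF p] by auto
      then have "(\<Sum>l<n. \<Sum>i | i \<in> {..<e p} \<and> w p i = l. 1) = card {..<e p}"
        by (subst sum.group) auto
      moreover have "(\<Sum>l<n. \<epsilon> (p, l)) = (\<Sum>l<n. \<Sum>i | i \<in> {..<e p} \<and> w p i = l. 1)"
        by (rule sum.cong[OF refl]) (use p in \<open>simp add: \<epsilon>_def\<close>)
      ultimately show ?thesis by simp
    qed
    have rs: "row_sums m \<epsilon> = e"
      using row e by (auto simp: row_sums_def fun_eq_iff entry_exponents_def PiE_iff extensional_def)
    have "\<epsilon> \<in> monomial_exponents m n k"
      using row e by (auto simp: monomial_exponents_def entry_exponents_def \<epsilon>_def)
    moreover have "Tens.gen m e v = Tens_monomial m \<epsilon>"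
    proof -
      have "v p = Sym_monomial (e p) (\<lambda>l. \<epsilon> (p, l))" if p: "p \<in> entry_positions m" for p
      proof -
        have "sorted_word n (\<lambda>l. \<epsilon> (p, l)) = sorted_word n (\<lambda>l. card {i. i < e p \<and> w p i = l})"
          unfolding sorted_word_def by (rule arg_cong[where f = concat], rule map_cong)
            (use p in \<open>auto simp: \<epsilon>_def\<close>)
        then show ?thesis
          unfolding w(2)[OF p] Sym_word_eq_monomial[OF w(1)[OF p]] by (simp add: Sym_monomial_def)
      qed
      then have "v = (\<lambda>p\<in>entry_positions m. Sym_monomial (e p) (\<lambda>l. \<epsilon> (p, l)))"
        using v by (auto simp: fun_eq_iff PiE_iff extensional_def)
      then show ?thesis by (simp add: Tens_monomial_def rs)
    qed
    ultimately show "Tens.gen m e v \<in> Tens_monomial m ` ?M" using rs by blast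
  qed
  then have "lin_gen (Tens m e) (Tens.gen m e ` (\<Pi>\<^sub>E p\<in>entry_positions m. ?S p)) \<subseteq>
      lin_gen (Tens m e) (Tens_monomial m ` ?M)"
    by (rule lin_gen_mono)
  moreover have "carrier (Tens m e) \<subseteq>
      lin_gen (Tens m e) (Tens.gen m e ` (\<Pi>\<^sub>E p\<in>entry_positions m. ?S p))"
    unfolding tensor_product_def
    by (rule Tens.lin_gen_multilinear) (use lin_gen_Sym Sym_word_closed in blast)+
  ultimately show ?thesis by blast
qed

abbreviation "subst_all A a \<equiv> \<lambda>(p, l). subst_matrix A (\<lambda>l. a (p, l)) l"

abbreviation "Tens_map m e \<sigma> \<equiv>
  tensor_map (entry_positions m) (\<lambda>p. Sym (e p)) (\<lambda>p. Sym_map (e p) \<sigma>)"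

lemma
  assumes \<sigma>: "realizes \<sigma> A"
  shows linear_endo_Tens_map: "linear_endo (Tens m e) (Tens_map m e \<sigma>)"
    and Tens_fun_Tens_map:
      "u \<in> carrier (Tens m e) \<Longrightarrow> Tens_fun a m e (Tens_map m e \<sigma> u) = Tens_fun (subst_all A a) m e u"
proof -
  let ?h = "\<lambda>v. \<lambda>p\<in>entry_positions m. Sym_map (e p) \<sigma> (v p)"
  note f = linear_endo_Sym_map[OF \<sigma>]
  have h: "?h ` (\<Pi>\<^sub>E p\<in>entry_positions m. carrier (Sym (e p))) \<subseteq>
      (\<Pi>\<^sub>E p\<in>entry_positions m. carrier (Sym (e p)))"
    by (intro image_subsetI restrict_PiE_iff[THEN iffD2] ballI linear_endo.endo_closed[OF f])
      (rule PiE_mem)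
  have r: "free_map ?h r \<in> Tens.R m e" if "r \<in> multilinear_rels (entry_positions m) (\<lambda>p. Sym (e p))" for r
    using multilinear_rels_map[OF f that] Tens.rels_subset_R by blast
  show "linear_endo (Tens m e) (Tens_map m e \<sigma>)"
    unfolding tensor_product_def tensor_map_def
    by (rule Tens.linear_endo_presented_map[OF h r])
  show "Tens_fun a m e (Tens_map m e \<sigma> u) = Tens_fun (subst_all A a) m e u" if "u \<in> carrier (Tens m e)"
    unfolding Tens_fun_def tensor_map_def
    using that by (intro Tens.pres_fun_presented_map[OF h r Tens_fun_rels Tens_fun_rels])
      (auto simp: tensor_product_def Sym_fun_Sym_map[OF \<sigma>] PiE_iff)
qed

subsection \<open>Their direct sum\<close>

lemma vectorspace_sym_sum: "vectorspace class_ring (sym_sum m G k)"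
  unfolding sym_sum_def by (rule vectorspace_direct_sum[OF vectorspace_Tens finite_entry_exponents])

lemma carrier_sym_sum: "carrier (sym_sum m G k) = (\<Pi>\<^sub>E e\<in>entry_exponents m k. carrier (Tens m e))"
  using finite_entry_exponents[of m k] by (auto simp: sym_sum_def direct_sum_family_def)

lemma sym_sum_ops:
  "\<zero>\<^bsub>sym_sum m G k\<^esub> = (\<lambda>e\<in>entry_exponents m k. \<zero>\<^bsub>Tens m e\<^esub>)"
  "f \<oplus>\<^bsub>sym_sum m G k\<^esub> g = (\<lambda>e\<in>entry_exponents m k. f e \<oplus>\<^bsub>Tens m e\<^esub> g e)"
  "c \<odot>\<^bsub>sym_sum m G k\<^esub> f = (\<lambda>e\<in>entry_exponents m k. c \<odot>\<^bsub>Tens m e\<^esub> f e)"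
  by (simp_all add: sym_sum_def direct_sum_family_def)

definition summand :: "nat \<Rightarrow> nat \<Rightarrow> (nat \<times> nat \<Rightarrow> nat) \<Rightarrow> _ \<Rightarrow> _" where
  "summand m k e u = (\<lambda>e'\<in>entry_exponents m k. if e' = e then u else \<zero>\<^bsub>Tens m e'\<^esub>)"

definition sym_sum_fun :: "nat \<Rightarrow> nat \<Rightarrow> ((nat \<times> nat) \<times> nat \<Rightarrow> complex) \<Rightarrow> _ \<Rightarrow> complex" where
  "sym_sum_fun m k a f = (\<Sum>e\<in>entry_exponents m k. Tens_fun a m e (f e))"

lemma functional_sym_sum_fun: "functional (sym_sum m G k) (sym_sum_fun m k a)"
proof (rule functional.intro)
  fix f g assume fg: "f \<in> carrier (sym_sum m G k)" "g \<in> carrier (sym_sum m G k)"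
  have "sym_sum_fun m k a (f \<oplus>\<^bsub>sym_sum m G k\<^esub> g) =
      (\<Sum>e\<in>entry_exponents m k. Tens_fun a m e (f e) + Tens_fun a m e (g e))"
    unfolding sym_sum_fun_def sym_sum_ops
    by (rule sum.cong) (use fg in \<open>auto simp: carrier_sym_sum PiE_iff functional.L_add[OF functional_Tens_fun]\<close>)
  then show "sym_sum_fun m k a (f \<oplus>\<^bsub>sym_sum m G k\<^esub> g) = sym_sum_fun m k a f + sym_sum_fun m k a g"
    by (simp add: sym_sum_fun_def sum.distrib)
next
  fix f c assume f: "f \<in> carrier (sym_sum m G k)"
  have "sym_sum_fun m k a (c \<odot>\<^bsub>sym_sum m G k\<^esub> f) =
      (\<Sum>e\<in>entry_exponents m k. of_rat c * Tens_fun a m e (f e))"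
    unfolding sym_sum_fun_def sym_sum_ops
    by (rule sum.cong) (use f in \<open>auto simp: carrier_sym_sum PiE_iff functional.L_smult[OF functional_Tens_fun]\<close>)
  then show "sym_sum_fun m k a (c \<odot>\<^bsub>sym_sum m G k\<^esub> f) = of_rat c * sym_sum_fun m k a f"
    by (simp add: sym_sum_fun_def sum_distrib_left)
qed

definition sym_sum_monomial :: "nat \<Rightarrow> nat \<Rightarrow> ((nat \<times> nat) \<times> nat \<Rightarrow> nat) \<Rightarrow> _" where
  "sym_sum_monomial m k \<epsilon> = summand m k (row_sums m \<epsilon>) (Tens_monomial m \<epsilon>)"

text \<open>An element is the sum of its components, and each component is handled by \<open>lin_gen_Tens\<close>.\<close>

lemma lin_gen_sym_sum:
  "carrier (sym_sum m G k) \<subseteq> lin_gen (sym_sum m G k) (sym_sum_monomial m k ` monomial_exponents m n k)"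
proof
  let ?L = "lin_gen (sym_sum m G k) (sym_sum_monomial m k ` monomial_exponents m n k)"
  fix f assume f: "f \<in> carrier (sym_sum m G k)"
  note T = rat_vectorspaceD[OF vectorspace_Tens]
  have summand: "summand m k e u \<in> ?L" if e: "e \<in> entry_exponents m k" and u: "u \<in> carrier (Tens m e)" for e u
  proof -
    have z: "\<zero>\<^bsub>Tens m e'\<^esub> \<oplus>\<^bsub>Tens m e'\<^esub> \<zero>\<^bsub>Tens m e'\<^esub> = \<zero>\<^bsub>Tens m e'\<^esub>" for e'
      using T(6)[OF T(1)] .
    have cz: "c \<odot>\<^bsub>Tens m e'\<^esub> \<zero>\<^bsub>Tens m e'\<^esub> = \<zero>\<^bsub>Tens m e'\<^esub>" for e' and c :: rat
    proof -
      interpret vectorspace class_ring "Tens m e'" by (rule vectorspace_Tens)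
      show ?thesis by (rule smult_r_null) simp
    qed
    have "u \<in> lin_gen (Tens m e) (Tens_monomial m ` {\<epsilon> \<in> monomial_exponents m n k. row_sums m \<epsilon> = e})"
      using lin_gen_Tens[OF e] u by blast
    then show ?thesis
    proof induction
      case zero
      have "summand m k e \<zero>\<^bsub>Tens m e\<^esub> = \<zero>\<^bsub>sym_sum m G k\<^esub>"
        by (rule ext) (auto simp: summand_def sym_sum_ops)
      then show ?case by (simp add: lin_gen.zero)
    next
      case (base u)
      then obtain \<epsilon> where "\<epsilon> \<in> monomial_exponents m n k" "row_sums m \<epsilon> = e" "u = Tens_monomial m \<epsilon>"
        by blast
      then have "summand m k e u = sym_sum_monomial m k \<epsilon>" by (simp add: sym_sum_monomial_def)
      then show ?case using \<open>\<epsilon> \<in> monomial_exponents m n k\<close> by (simp add: lin_gen.base)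
    next
      case (add u v)
      have "summand m k e (u \<oplus>\<^bsub>Tens m e\<^esub> v) = summand m k e u \<oplus>\<^bsub>sym_sum m G k\<^esub> summand m k e v"
        by (rule ext) (auto simp: summand_def sym_sum_ops z)
      then show ?case using add by (simp add: lin_gen.add)
    next
      case (smult u c)
      have "summand m k e (c \<odot>\<^bsub>Tens m e\<^esub> u) = c \<odot>\<^bsub>sym_sum m G k\<^esub> summand m k e u"
        by (rule ext) (auto simp: summand_def sym_sum_ops cz)
      then show ?case using smult by (simp add: lin_gen.smult)
    qed
  qed
  have "(\<lambda>e\<in>entry_exponents m k. if e \<in> J then f e else \<zero>\<^bsub>Tens m e\<^esub>) \<in> ?L"
    if "finite J" "J \<subseteq> entry_exponents m k" for J
    using that
  proof induction
    case empty
    show ?case using lin_gen.zero[of "sym_sum m G k"] by (simp add: sym_sum_ops del: restrict_apply)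
  next
    case (insert e J)
    have fe: "f e' \<in> carrier (Tens m e')" if "e' \<in> entry_exponents m k" for e'
      using f that by (auto simp: carrier_sym_sum)
    have "(\<lambda>e'\<in>entry_exponents m k. if e' \<in> insert e J then f e' else \<zero>\<^bsub>Tens m e'\<^esub>) =
      (\<lambda>e\<in>entry_exponents m k. if e \<in> J then f e else \<zero>\<^bsub>Tens m e\<^esub>) \<oplus>\<^bsub>sym_sum m G k\<^esub> summand m k e (f e)"
    proof
      fix e'
      show "(\<lambda>e'\<in>entry_exponents m k. if e' \<in> insert e J then f e' else \<zero>\<^bsub>Tens m e'\<^esub>) e' =
        ((\<lambda>e\<in>entry_exponents m k. if e \<in> J then f e else \<zero>\<^bsub>Tens m e\<^esub>) \<oplus>\<^bsub>sym_sum m G k\<^esub> summand m k e (f e)) e'"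
      proof (cases "e' \<in> entry_exponents m k")
        case True
        note fe' = fe[OF True]
        have "\<zero>\<^bsub>Tens m e'\<^esub> \<oplus>\<^bsub>Tens m e'\<^esub> f e' = f e'"
          unfolding T(4)[OF T(1) fe'] by (rule T(6)[OF fe'])
        then show ?thesis
          using True insert.hyps T(6)[OF fe'] T(6)[OF T(1), of m e']
          by (auto simp: summand_def sym_sum_ops)
      next
        case False
        then show ?thesis by (simp add: sym_sum_ops)
      qed
    qed
    moreover have "summand m k e (f e) \<in> ?L" using insert.prems by (intro summand fe) auto
    ultimately show ?case using insert by (simp only: lin_gen.add insert_subset)
  qed
  from this[OF finite_entry_exponents subset_refl]
  have "(\<lambda>e\<in>entry_exponents m k. if e \<in> entry_exponents m k then f e else \<zero>\<^bsub>Tens m e\<^esub>) \<in> ?L" .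
  moreover have "(\<lambda>e\<in>entry_exponents m k. if e \<in> entry_exponents m k then f e else \<zero>\<^bsub>Tens m e\<^esub>) = f"
    using f by (auto simp: carrier_sym_sum PiE_iff extensional_def fun_eq_iff)
  ultimately show "f \<in> ?L" by simp
qed

text \<open>The functional for \<open>a\<close> is built by universal properties from the characters \<open>H_char\<close>, so that on
  the chosen generators it evaluates the monomials at \<open>a\<close>. As these are independent, the generators
  are a basis.\<close>

lemma monomial_space_sym_sum:
  "monomial_space (sym_sum m G k) (monomial_exponents m n k) (sym_sum_monomial m k) (mono_eval m n)
     (sym_sum_fun m k)"
proof (intro monomial_space.intro monomial_space_axioms.intro vectorspace_sym_sum
    finite_monomial_exponents lin_gen_sym_sum functional_sym_sum_fun)
  note T = rat_vectorspaceD[OF vectorspace_Tens]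
  show "sym_sum_monomial m k \<in> monomial_exponents m n k \<rightarrow> carrier (sym_sum m G k)"
    using Tens_monomial_closed T(1)
    by (auto simp: sym_sum_monomial_def summand_def carrier_sym_sum)
  show "sym_sum_fun m k a (sym_sum_monomial m k \<epsilon>) = mono_eval m n a \<epsilon>"
    if "\<epsilon> \<in> monomial_exponents m n k" for a \<epsilon>
  proof -
    have "sym_sum_fun m k a (sym_sum_monomial m k \<epsilon>) =
        (\<Sum>e\<in>entry_exponents m k. if e = row_sums m \<epsilon> then mono_eval m n a \<epsilon> else 0)"
      unfolding sym_sum_fun_def sym_sum_monomial_def summand_def
      by (rule sum.cong[OF refl])
        (simp add: Tens_fun_monomial functional_zero[OF vectorspace_Tens functional_Tens_fun])
    then show ?thesis
      using row_sums_entry_exponents[OF that] finite_entry_exponents by simp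
  qed
qed (rule mono_eval_independent)

lemma
  assumes \<sigma>: "realizes \<sigma> A" and f: "f \<in> carrier (sym_sum m G k)"
  shows sym_sum_act_closed: "sym_sum_act m G k (ab_aut G \<sigma>) f \<in> carrier (sym_sum m G k)"
    and sym_sum_fun_act:
      "sym_sum_fun m k a (sym_sum_act m G k (ab_aut G \<sigma>) f) = sym_sum_fun m k (subst_all A a) f"
proof -
  have fe: "f e \<in> carrier (Tens m e)" if "e \<in> entry_exponents m k" for e
    using f that by (auto simp: carrier_sym_sum)
  have act: "sym_sum_act m G k (ab_aut G \<sigma>) f = (\<lambda>e\<in>entry_exponents m k. Tens_map m e \<sigma> (f e))"
    by (simp add: sym_sum_act_def direct_sum_map_def)
  show "sym_sum_act m G k (ab_aut G \<sigma>) f \<in> carrier (sym_sum m G k)"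
    unfolding act carrier_sym_sum restrict_PiE_iff
    using fe linear_endo.endo_closed[OF linear_endo_Tens_map[OF \<sigma>]] by blast
  show "sym_sum_fun m k a (sym_sum_act m G k (ab_aut G \<sigma>) f) = sym_sum_fun m k (subst_all A a) f"
    unfolding act sym_sum_fun_def
    by (rule sum.cong[OF refl]) (simp add: fe Tens_fun_Tens_map[OF \<sigma>])
qed

end

section \<open>The ring of representations and the powers of its ideal\<close>

text \<open>Pointwise operations inherit the laws of the complex numbers.\<close>

lemma cring_of_functions:
  fixes R :: "('r \<Rightarrow> complex, 'z) ring_scheme"
  assumes car: "carrier R \<subseteq> B \<rightarrow>\<^sub>E UNIV"
    and ops: "\<one>\<^bsub>R\<^esub> = (\<lambda>r\<in>B. 1)" "\<zero>\<^bsub>R\<^esub> = (\<lambda>r\<in>B. 0)"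
      "monoid.mult R = (\<lambda>f g. \<lambda>r\<in>B. f r * g r)" "add R = (\<lambda>f g. \<lambda>r\<in>B. f r + g r)"
    and closed: "\<one>\<^bsub>R\<^esub> \<in> carrier R" "\<zero>\<^bsub>R\<^esub> \<in> carrier R"
      "\<And>f g. \<lbrakk>f \<in> carrier R; g \<in> carrier R\<rbrakk> \<Longrightarrow> f \<otimes>\<^bsub>R\<^esub> g \<in> carrier R"
      "\<And>f g. \<lbrakk>f \<in> carrier R; g \<in> carrier R\<rbrakk> \<Longrightarrow> f \<oplus>\<^bsub>R\<^esub> g \<in> carrier R"
      "\<And>f. f \<in> carrier R \<Longrightarrow> (\<lambda>r\<in>B. - f r) \<in> carrier R"
  shows "cring R"
proof (rule cringI)
  have ext: "f = (\<lambda>r\<in>B. f r)" if "f \<in> carrier R" for f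
    using that car by (auto simp: PiE_iff extensional_def fun_eq_iff)
  show "abelian_group R"
  proof (rule abelian_groupI)
    fix f assume f: "f \<in> carrier R"
    have "\<zero>\<^bsub>R\<^esub> \<oplus>\<^bsub>R\<^esub> f = (\<lambda>r\<in>B. f r)" by (simp add: ops fun_eq_iff)
    then show "\<zero>\<^bsub>R\<^esub> \<oplus>\<^bsub>R\<^esub> f = f" using ext[OF f] by (rule trans[OF _ sym])
    show "\<exists>g\<in>carrier R. g \<oplus>\<^bsub>R\<^esub> f = \<zero>\<^bsub>R\<^esub>"
      using closed(5)[OF f] by (rule bexI[rotated]) (simp add: ops fun_eq_iff)
  qed (auto simp: closed, auto simp: ops fun_eq_iff)
  show "comm_monoid R"
  proof (rule comm_monoidI)
    fix f assume f: "f \<in> carrier R"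
    have "\<one>\<^bsub>R\<^esub> \<otimes>\<^bsub>R\<^esub> f = (\<lambda>r\<in>B. f r)" by (simp add: ops fun_eq_iff)
    then show "\<one>\<^bsub>R\<^esub> \<otimes>\<^bsub>R\<^esub> f = f" using ext[OF f] by (rule trans[OF _ sym])
  qed (auto simp: closed, auto simp: ops fun_eq_iff)
  show "(f \<oplus>\<^bsub>R\<^esub> g) \<otimes>\<^bsub>R\<^esub> h = f \<otimes>\<^bsub>R\<^esub> h \<oplus>\<^bsub>R\<^esub> g \<otimes>\<^bsub>R\<^esub> h" for f g h
    by (simp add: ops fun_eq_iff algebra_simps)
qed

lemma smult_one_one_mat: "1 \<cdot>\<^sub>m 1\<^sub>m m = (1\<^sub>m m :: complex mat)"
  by (rule eq_matI) auto

lemma group_SL: "group (SL_group m)"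
proof (rule groupI)
  fix A assume "A \<in> carrier (SL_group m)"
  then have A: "A \<in> carrier_mat m m" "det A = 1" by (simp_all add: SL_group_def)
  note adj = adj_mat[OF A(1)]
  have "det (adj_mat A) * det A = 1" using det_mult[OF adj(1) A(1)] adj(3) A(2) by simp
  then have "adj_mat A \<in> carrier (SL_group m)" using adj(1) A(2) by (simp add: SL_group_def)
  then show "\<exists>B\<in>carrier (SL_group m). B \<otimes>\<^bsub>SL_group m\<^esub> A = \<one>\<^bsub>SL_group m\<^esub>"
    using adj(3) A(2) by (intro bexI[of _ "adj_mat A"]) (simp_all add: SL_group_def smult_one_one_mat)
qed (auto simp: SL_group_def det_mult)

locale free_reps = free_basis G n x
  for G :: "('g, 'b) monoid_scheme" (structure) and n x +
  fixes m :: nat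
  assumes m_ge_2: "2 \<le> m"
begin

abbreviation "Reps \<equiv> reps m G"
abbreviation "RR \<equiv> rep_ring m G"

lemma RR_ops:
  "\<one>\<^bsub>RR\<^esub> = (\<lambda>\<rho>\<in>Reps. 1)" "\<zero>\<^bsub>RR\<^esub> = (\<lambda>\<rho>\<in>Reps. 0)"
  "monoid.mult RR = (\<lambda>f g. \<lambda>\<rho>\<in>Reps. f \<rho> * g \<rho>)" "add RR = (\<lambda>f g. \<lambda>\<rho>\<in>Reps. f \<rho> + g \<rho>)"
  "c \<odot>\<^bsub>RR\<^esub> f = (\<lambda>\<rho>\<in>Reps. of_rat c * f \<rho>)"
  by (simp_all add: rep_ring_def rat_algebra_generated_def fun_algebra_def)

text \<open>Elements of the ring are extensional functions. Restricting here instead of in every formula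
  permits calculations with plain functions.\<close>

definition inR :: "(('g \<Rightarrow> complex mat) \<Rightarrow> complex) \<Rightarrow> bool" where
  "inR f \<longleftrightarrow> restrict f Reps \<in> carrier RR"

lemma cring_fun_algebra: "cring (fun_algebra B)"
  by (rule cring_of_functions[of _ B]) (auto simp: fun_algebra_def)

lemma uminus_fun_algebra:
  assumes "f \<in> carrier (fun_algebra B)"
  shows "\<ominus>\<^bsub>fun_algebra B\<^esub> f = (\<lambda>r\<in>B. - f r)"
proof -
  interpret cring "fun_algebra B" by (rule cring_fun_algebra)
  show ?thesis
    by (rule minus_equality) (use assms in \<open>auto simp: fun_algebra_def\<close>)
qed

lemma rat_subalgebraI:
  assumes "V \<subseteq> B \<rightarrow>\<^sub>E UNIV" "(\<lambda>r\<in>B. 1) \<in> V"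
    and "\<And>f g. \<lbrakk>f \<in> V; g \<in> V\<rbrakk> \<Longrightarrow> (\<lambda>r\<in>B. f r * g r) \<in> V"
    and "\<And>f g. \<lbrakk>f \<in> V; g \<in> V\<rbrakk> \<Longrightarrow> (\<lambda>r\<in>B. f r + g r) \<in> V"
    and "\<And>q f. f \<in> V \<Longrightarrow> (\<lambda>r\<in>B. of_rat q * f r) \<in> V"
  shows "rat_subalgebra (fun_algebra B) V"
proof -
  interpret cring "fun_algebra B" by (rule cring_fun_algebra)
  have neg: "\<ominus>\<^bsub>fun_algebra B\<^esub> f \<in> V" if "f \<in> V" for f
  proof -
    have "\<ominus>\<^bsub>fun_algebra B\<^esub> f = (\<lambda>r\<in>B. of_rat (- 1) * f r)"
      using that assms(1) by (subst uminus_fun_algebra) (auto simp: fun_algebra_def)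
    then show ?thesis using assms(5)[OF that, of "- 1"] by simp
  qed
  have "subring V (fun_algebra B)"
    by (rule subringI) (use assms neg in \<open>auto simp: fun_algebra_def\<close>)
  then show ?thesis
    using assms(5) by (auto simp: rat_subalgebra_def fun_algebra_def)
qed

lemma rat_subalgebra_RR: "rat_subalgebra (fun_algebra Reps) (carrier RR)"
proof -
  interpret cring "fun_algebra Reps" by (rule cring_fun_algebra)
  let ?S = "{entry_fun m G p y | p y. p \<in> {..<m} \<times> {..<m} \<and> y \<in> carrier G}"
  have "rat_subalgebra (fun_algebra Reps) (Reps \<rightarrow>\<^sub>E UNIV)"
    by (rule rat_subalgebraI) auto
  moreover have "?S \<subseteq> Reps \<rightarrow>\<^sub>E UNIV" by (auto simp: entry_fun_def)
  ultimately have ne: "{V. rat_subalgebra (fun_algebra Reps) V \<and> ?S \<subseteq> V} \<noteq> {}" by blast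
  have car: "carrier RR = \<Inter> {V. rat_subalgebra (fun_algebra Reps) V \<and> ?S \<subseteq> V}"
    by (simp add: rep_ring_def rat_algebra_generated_def)
  have "subring (carrier RR) (fun_algebra Reps)"
    unfolding car using ne by (intro subring_Inter) (auto simp: rat_subalgebra_def)
  then show ?thesis
    unfolding rat_subalgebra_def car by (auto simp: rat_subalgebra_def)
qed

lemma entry_fun_RR:
  "\<lbrakk>p \<in> {..<m} \<times> {..<m}; y \<in> carrier G\<rbrakk> \<Longrightarrow> entry_fun m G p y \<in> carrier RR"
  by (auto simp: rep_ring_def rat_algebra_generated_def)

lemma RR_least:
  assumes "rat_subalgebra (fun_algebra Reps) V"
    and "\<And>p y. \<lbrakk>p \<in> {..<m} \<times> {..<m}; y \<in> carrier G\<rbrakk> \<Longrightarrow> entry_fun m G p y \<in> V"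
  shows "carrier RR \<subseteq> V"
proof -
  have "V \<in> {V. rat_subalgebra (fun_algebra Reps) V \<and>
      {entry_fun m G p y | p y. p \<in> {..<m} \<times> {..<m} \<and> y \<in> carrier G} \<subseteq> V}"
    using assms by auto
  then show ?thesis unfolding rep_ring_def rat_algebra_generated_def by auto
qed

lemma RR_subset: "carrier RR \<subseteq> Reps \<rightarrow>\<^sub>E UNIV"
  using rat_subalgebra_RR subringE(1) by (fastforce simp: rat_subalgebra_def fun_algebra_def)

lemma RR_restrict: "f \<in> carrier RR \<Longrightarrow> restrict f Reps = f"
  using RR_subset by (intro extensional_restrict) (auto simp: PiE_iff)

lemma RR_closed:
  "\<one>\<^bsub>RR\<^esub> \<in> carrier RR" "\<zero>\<^bsub>RR\<^esub> \<in> carrier RR"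
  "\<lbrakk>f \<in> carrier RR; g \<in> carrier RR\<rbrakk> \<Longrightarrow> f \<otimes>\<^bsub>RR\<^esub> g \<in> carrier RR"
  "\<lbrakk>f \<in> carrier RR; g \<in> carrier RR\<rbrakk> \<Longrightarrow> f \<oplus>\<^bsub>RR\<^esub> g \<in> carrier RR"
  "f \<in> carrier RR \<Longrightarrow> c \<odot>\<^bsub>RR\<^esub> f \<in> carrier RR"
  using rat_subalgebra_RR subringE(2,3,6,7)
  by (fastforce simp: rat_subalgebra_def fun_algebra_def RR_ops)+

lemma cring_RR: "cring RR"
proof (rule cring_of_functions[OF RR_subset RR_ops(1-4) RR_closed(1-4)])
  show "(\<lambda>\<rho>\<in>Reps. - f \<rho>) \<in> carrier RR" if "f \<in> carrier RR" for f
    using RR_closed(5)[OF that, of "- 1"] by (simp add: RR_ops)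
qed

sublocale RR: cring RR
  by (rule cring_RR)

lemma inR_iff: "f \<in> carrier RR \<Longrightarrow> inR f"
  by (simp add: inR_def RR_restrict)

lemma inR_rat: "inR (\<lambda>\<rho>. of_rat q)"
  using RR_closed(5)[OF RR_closed(1), of q]
  by (simp add: inR_def RR_ops cong: restrict_cong)

abbreviation "J k \<equiv> J_power m G n x k"

lemma ideal_J_ideal: "ideal (J_ideal m G n x) RR"
proof -
  have "{s_fun m G p (x l) | p l. p \<in> {..<m} \<times> {..<m} \<and> l < n} \<subseteq> carrier RR"
    by (auto simp: s_fun_def intro!: RR.minus_closed entry_fun_RR)
  then show ?thesis unfolding J_ideal_def by (rule RR.genideal_ideal)
qed

lemma J_0: "J 0 = carrier RR"
  by (simp add: J_power_def nat_pow_def ideals_set_def)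

lemma J_Suc: "J (Suc k) = ideal_prod RR (J k) (J_ideal m G n x)"
  by (simp add: J_power_def nat_pow_def ideals_set_def)

lemma ideal_J: "ideal (J k) RR"
  by (induction k) (simp_all add: J_0 J_Suc RR.oneideal RR.ideal_prod_is_ideal ideal_J_ideal)

lemma J_subset: "J k \<subseteq> carrier RR"
  using ideal.Icarr[OF ideal_J] by blast

lemma J_Suc_subset: "J (Suc k) \<subseteq> J k"
  using RR.ideal_prod_inter[OF ideal_J ideal_J_ideal] by (auto simp: J_Suc)

lemma J_antimono: "k \<le> k' \<Longrightarrow> J k' \<subseteq> J k"
  by (induction rule: dec_induct) (use J_Suc_subset in auto)

lemma J_mult:
  assumes f: "f \<in> J a" and g: "g \<in> J b"
  shows "f \<otimes>\<^bsub>RR\<^esub> g \<in> J (a + b)"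
  using g
proof (induction b arbitrary: g)
  case 0
  then show ?case using ideal.I_r_closed[OF ideal_J f] by (simp add: J_0)
next
  case (Suc b)
  from Suc.prems have "g \<in> ideal_prod RR (J b) (J_ideal m G n x)" by (simp add: J_Suc)
  then have "g \<in> carrier RR \<and> f \<otimes>\<^bsub>RR\<^esub> g \<in> J (a + Suc b)"
  proof induction
    case (prod i j)
    have c: "f \<in> carrier RR" "i \<in> carrier RR" "j \<in> carrier RR"
      using f prod J_subset ideal.Icarr[OF ideal_J_ideal] by blast+
    have "(f \<otimes>\<^bsub>RR\<^esub> i) \<otimes>\<^bsub>RR\<^esub> j \<in> J (Suc (a + b))"
      unfolding J_Suc using Suc.IH[OF prod(1)] prod(2) by (rule ideal_prod.prod)
    then show ?case using c by (simp add: RR.m_assoc)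
  next
    case (sum s1 s2)
    have "f \<in> carrier RR" using f J_subset by blast
    then show ?case
      using sum additive_subgroup.a_closed[OF ideal.axioms(1)[OF ideal_J]] by (simp add: RR.r_distr)
  qed
  then show ?case ..
qed

definition inJ :: "nat \<Rightarrow> (('g \<Rightarrow> complex mat) \<Rightarrow> complex) \<Rightarrow> bool" where
  "inJ k f \<longleftrightarrow> restrict f Reps \<in> J k"

lemma inJ_cong: "(\<And>\<rho>. \<rho> \<in> Reps \<Longrightarrow> f \<rho> = g \<rho>) \<Longrightarrow> inJ k f \<longleftrightarrow> inJ k g"
  by (metis (no_types, lifting) inJ_def restrict_ext)

lemma inJ_iff: "f \<in> carrier RR \<Longrightarrow> inJ k f \<longleftrightarrow> f \<in> J k"
  by (simp add: inJ_def RR_restrict)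

lemma inJ_J: "f \<in> J k \<Longrightarrow> inJ k f"
  using J_subset inJ_iff by blast

lemma inJ_0: "inJ 0 f \<longleftrightarrow> inR f"
  by (simp add: inJ_def inR_def J_0)

lemma inJ_antimono: "\<lbrakk>inJ k' f; k \<le> k'\<rbrakk> \<Longrightarrow> inJ k f"
  using J_antimono by (auto simp: inJ_def)

lemma inJ_add: "\<lbrakk>inJ k f; inJ k g\<rbrakk> \<Longrightarrow> inJ k (\<lambda>\<rho>. f \<rho> + g \<rho>)"
  using additive_subgroup.a_closed[OF ideal.axioms(1)[OF ideal_J], of "restrict f Reps" k "restrict g Reps"]
  by (simp add: inJ_def RR_ops cong: restrict_cong)

lemma inJ_zero: "inJ k (\<lambda>\<rho>. 0)"
  using additive_subgroup.zero_closed[OF ideal.axioms(1)[OF ideal_J], of k]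
  by (simp add: inJ_def RR_ops)

lemma inJ_mult: "\<lbrakk>inJ a f; inJ b g\<rbrakk> \<Longrightarrow> inJ (a + b) (\<lambda>\<rho>. f \<rho> * g \<rho>)"
  using J_mult[of "restrict f Reps" a "restrict g Reps" b]
  by (simp add: inJ_def RR_ops cong: restrict_cong)

lemma inJ_mult_R: "\<lbrakk>inJ a f; inJ 0 g\<rbrakk> \<Longrightarrow> inJ a (\<lambda>\<rho>. f \<rho> * g \<rho>)"
  using inJ_mult[of a f 0 g] by simp

lemma inJ_smult: "inJ k f \<Longrightarrow> inJ k (\<lambda>\<rho>. of_rat q * f \<rho>)"
  using inJ_mult[of 0 "\<lambda>\<rho>. of_rat q" k f] inR_rat by (simp add: inJ_0)

lemma inJ_uminus: "inJ k f \<Longrightarrow> inJ k (\<lambda>\<rho>. - f \<rho>)"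
  using inJ_smult[of k f "- 1"] by simp

lemma inJ_diff: "\<lbrakk>inJ k f; inJ k g\<rbrakk> \<Longrightarrow> inJ k (\<lambda>\<rho>. f \<rho> - g \<rho>)"
  using inJ_add[OF _ inJ_uminus, of k f g] by simp

lemma inJ_one: "inJ 0 (\<lambda>\<rho>. 1)"
  using inR_rat[of 1] by (simp add: inJ_0)

lemma inJ_sum: "(\<And>i. i \<in> A \<Longrightarrow> inJ k (f i)) \<Longrightarrow> inJ k (\<lambda>\<rho>. \<Sum>i\<in>A. f i \<rho>)"
  by (induction A rule: infinite_finite_induct) (simp_all add: inJ_zero inJ_add)

lemma inJ_prod: "(\<And>i. i \<in> A \<Longrightarrow> inJ (d i) (f i)) \<Longrightarrow> inJ (\<Sum>i\<in>A. d i) (\<lambda>\<rho>. \<Prod>i\<in>A. f i \<rho>)"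
  by (induction A rule: infinite_finite_induct) (simp_all add: inJ_one inJ_mult)

lemma inJ_power: "inJ d f \<Longrightarrow> inJ (e * d) (\<lambda>\<rho>. f \<rho> ^ e)"
  using inJ_prod[of "{..<e}" "\<lambda>_. d" "\<lambda>_. f"] by simp

subsection \<open>The entries of a representation\<close>

lemma rep_mat:
  assumes "\<rho> \<in> Reps" "y \<in> carrier G"
  shows "\<rho> y \<in> carrier_mat m m" "det (\<rho> y) = 1"
  using assms by (auto simp: reps_def hom_def SL_group_def)

lemma rep_mult:
  "\<lbrakk>\<rho> \<in> Reps; y \<in> carrier G; z \<in> carrier G\<rbrakk> \<Longrightarrow> \<rho> (y \<otimes> z) = \<rho> y * \<rho> z"
  by (auto simp: reps_def hom_def SL_group_def)

lemma rep_one: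
  assumes \<rho>: "\<rho> \<in> Reps"
  shows "\<rho> \<one> = 1\<^sub>m m"
proof -
  have c: "\<rho> \<one> \<in> carrier_mat m m" and d: "det (\<rho> \<one>) = 1" using rep_mat[OF \<rho>] by auto
  have i: "\<rho> \<one> * \<rho> \<one> = \<rho> \<one>" using rep_mult[OF \<rho>, of \<one> \<one>] by simp
  have a: "adj_mat (\<rho> \<one>) * \<rho> \<one> = 1\<^sub>m m" "adj_mat (\<rho> \<one>) \<in> carrier_mat m m"
    using adj_mat[OF c] d by auto
  have "\<rho> \<one> = adj_mat (\<rho> \<one>) * \<rho> \<one> * \<rho> \<one>" using a c by simp
  also have "\<dots> = adj_mat (\<rho> \<one>) * (\<rho> \<one> * \<rho> \<one>)" using a(2) c by (simp add: assoc_mult_mat)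
  finally show ?thesis using a(1) i by simp
qed

definition sval :: "nat \<times> nat \<Rightarrow> 'g \<Rightarrow> ('g \<Rightarrow> complex mat) \<Rightarrow> complex" where
  "sval p y \<rho> = \<rho> y $$ p - (if fst p = snd p then 1 else 0)"

abbreviation "Pos \<equiv> {..<m} \<times> {..<m}"

lemma inJ_entry: "\<lbrakk>p \<in> Pos; y \<in> carrier G\<rbrakk> \<Longrightarrow> inJ 0 (\<lambda>\<rho>. \<rho> y $$ p)"
  using entry_fun_RR[of p y] by (simp add: inJ_0 inR_def entry_fun_def)

lemma uminus_RR: "f \<in> carrier RR \<Longrightarrow> \<ominus>\<^bsub>RR\<^esub> f = (\<lambda>\<rho>\<in>Reps. - f \<rho>)"
  by (rule RR.minus_equality) (use RR_closed(5)[of f "- 1"] in \<open>auto simp: RR_ops\<close>)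

lemma s_fun_eq:
  assumes "p \<in> Pos" "y \<in> carrier G"
  shows "s_fun m G p y = restrict (sval p y) Reps"
proof -
  have "(if fst p = snd p then \<one>\<^bsub>RR\<^esub> else \<zero>\<^bsub>RR\<^esub>) \<in> carrier RR" by simp
  then show ?thesis
    unfolding s_fun_def RR.minus_eq
    by (simp add: uminus_RR) (auto simp: RR_ops entry_fun_def sval_def fun_eq_iff)
qed

text \<open>\<open>Y Z - 1 = (Y - 1) + (Z - 1) + (Y - 1) (Z - 1)\<close>, in components.\<close>

lemma sval_mult:
  assumes "\<rho> \<in> Reps" "y \<in> carrier G" "z \<in> carrier G" "i < m" "j < m"
  shows "sval (i, j) (y \<otimes> z) \<rho> =
    sval (i, j) y \<rho> + sval (i, j) z \<rho> + (\<Sum>l<m. sval (i, l) y \<rho> * sval (l, j) z \<rho>)"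
proof -
  define d :: "nat \<Rightarrow> nat \<Rightarrow> complex" where "d i j = (if i = j then 1 else 0)" for i j
  have e: "\<rho> u $$ (i, j) = sval (i, j) u \<rho> + d i j" for u i j
    by (simp add: sval_def d_def)
  have "\<rho> (y \<otimes> z) $$ (i, j) = (\<Sum>l<m. \<rho> y $$ (i, l) * \<rho> z $$ (l, j))"
    using assms rep_mat(1)[OF assms(1,2)] rep_mat(1)[OF assms(1,3)]
    by (simp add: rep_mult scalar_prod_def atLeast0LessThan)
  also have "\<dots> = (\<Sum>l<m. sval (i, l) y \<rho> * sval (l, j) z \<rho>) + (\<Sum>l<m. sval (i, l) y \<rho> * d l j)
      + (\<Sum>l<m. d i l * sval (l, j) z \<rho>) + (\<Sum>l<m. d i l * d l j)"
    by (simp add: e algebra_simps sum.distrib)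
  also have "(\<Sum>l<m. sval (i, l) y \<rho> * d l j) = (\<Sum>l<m. if l = j then sval (i, j) y \<rho> else 0)"
    by (rule sum.cong) (auto simp: d_def)
  also have "(\<Sum>l<m. d i l * sval (l, j) z \<rho>) = (\<Sum>l<m. if l = i then sval (i, j) z \<rho> else 0)"
    by (rule sum.cong) (auto simp: d_def)
  also have "(\<Sum>l<m. d i l * d l j) = (\<Sum>l<m. if l = i then d i j else 0)"
    by (rule sum.cong) (auto simp: d_def)
  finally show ?thesis using assms(4,5) by (simp add: sval_def d_def)
qed

lemma sval_one: "\<lbrakk>\<rho> \<in> Reps; p \<in> Pos\<rbrakk> \<Longrightarrow> sval p \<one> \<rho> = 0"
  by (auto simp: sval_def rep_one)

lemma sval_inv:
  assumes "\<rho> \<in> Reps" "y \<in> carrier G" "i < m" "j < m"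
  shows "sval (i, j) (inv y) \<rho> = - (\<Sum>l<m. sval (i, l) y \<rho> * \<rho> (inv y) $$ (l, j))"
proof -
  have "0 = sval (i, j) y \<rho> + sval (i, j) (inv y) \<rho> + (\<Sum>l<m. sval (i, l) y \<rho> * sval (l, j) (inv y) \<rho>)"
    using sval_mult[OF assms(1,2), of "inv y" i j] sval_one[OF assms(1), of "(i, j)"] assms by simp
  moreover have "(\<Sum>l<m. sval (i, l) y \<rho> * \<rho> (inv y) $$ (l, j)) =
      (\<Sum>l<m. sval (i, l) y \<rho> * sval (l, j) (inv y) \<rho> + (if l = j then sval (i, j) y \<rho> else 0))"
    by (rule sum.cong) (auto simp: sval_def algebra_simps)
  ultimately show ?thesis using assms(4) by (simp add: sum.distrib algebra_simps add_eq_0_iff)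
qed

lemma J_ideal_subset_J:
  assumes f: "f \<in> J_ideal m G n x"
  shows "inJ 1 f"
proof -
  have "\<one>\<^bsub>RR\<^esub> \<otimes>\<^bsub>RR\<^esub> f \<in> ideal_prod RR (J 0) (J_ideal m G n x)"
    using f by (intro ideal_prod.prod) (simp_all add: J_0)
  then show ?thesis using f ideal.Icarr[OF ideal_J_ideal] by (intro inJ_J) (simp add: J_Suc)
qed

lemma inJ_sval_x:
  assumes "p \<in> Pos" "l < n"
  shows "inJ 1 (sval p (x l))"
proof -
  have S: "{s_fun m G p (x l) | p l. p \<in> Pos \<and> l < n} \<subseteq> carrier RR"
    by (auto simp: s_fun_def intro!: RR.minus_closed entry_fun_RR)
  have "s_fun m G p (x l) \<in> J_ideal m G n x"
    unfolding J_ideal_def using RR.genideal_self[OF S] assms by blast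
  from J_ideal_subset_J[OF this] show ?thesis
    using inJ_cong[of "restrict (sval p (x l)) Reps" "sval p (x l)" 1] s_fun_eq[OF assms(1), of "x l"] assms(2)
    by simp
qed

text \<open>The matrix of \<open>y z\<close> minus \<open>1\<close> is \<open>S(y) + S(z) + S(y) S(z)\<close>, and that of the inverse of \<open>y\<close> is
  \<open>- S(y)\<close> times the matrix of the inverse. So the ideal contains the entries of \<open>S(y)\<close> for all
  \<open>y\<close> once it contains them on a basis.\<close>

lemma inJ_sval:
  assumes "p \<in> Pos" "y \<in> carrier G"
  shows "inJ 1 (sval p y)"
proof -
  have "\<forall>p\<in>Pos. inJ 1 (sval p y)"
    using assms(2)
  proof (induction rule: generator_induct)
    case one
    have "inJ 1 (sval p \<one>)" if "p \<in> Pos" for p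
      using inJ_cong[of "sval p \<one>" "\<lambda>_. 0" 1] sval_one that inJ_zero by simp
    then show ?case by blast
  next
    case (gen l)
    then show ?case using inJ_sval_x by blast
  next
    case (inv l)
    have "inJ 1 (sval (i, j) (inv (x l)))" if ij: "i < m" "j < m" for i j
    proof -
      have "inJ 1 (\<lambda>\<rho>. - (\<Sum>r<m. sval (i, r) (x l) \<rho> * \<rho> (inv (x l)) $$ (r, j)))"
        using inv ij by (intro inJ_uminus inJ_sum inJ_mult_R inJ_sval_x inJ_entry) auto
      then show ?thesis
        using inJ_cong[of "sval (i, j) (inv (x l))" "\<lambda>\<rho>. - (\<Sum>r<m. sval (i, r) (x l) \<rho> * \<rho> (inv (x l)) $$ (r, j))" 1]
          sval_inv[of _ "x l" i j] inv ij by simp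
    qed
    then show ?case by auto
  next
    case (mult y z)
    have "inJ 1 (sval (i, j) (y \<otimes> z))" if ij: "i < m" "j < m" for i j
    proof -
      have "inJ 1 (\<lambda>\<rho>. sval (i, r) y \<rho> * sval (r, j) z \<rho>)" if "r < m" for r
        using mult.IH that ij inJ_mult[of 1 "sval (i, r) y" 1 "sval (r, j) z"]
          inJ_antimono[of 2 _ 1] by (simp add: numeral_2_eq_2)
      then have "inJ 1 (\<lambda>\<rho>. sval (i, j) y \<rho> + sval (i, j) z \<rho> + (\<Sum>r<m. sval (i, r) y \<rho> * sval (r, j) z \<rho>))"
        using mult.IH ij by (intro inJ_add inJ_sum) auto
      then show ?thesis
        using inJ_cong[of "sval (i, j) (y \<otimes> z)" "\<lambda>\<rho>. sval (i, j) y \<rho> + sval (i, j) z \<rho> + (\<Sum>r<m. sval (i, r) y \<rho> * sval (r, j) z \<rho>)" 1]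
          sval_mult[OF _ mult.hyps ij] by simp
    qed
    then show ?case by auto
  qed
  with assms(1) show ?thesis by blast
qed

lemma sval_mult_mod_J2:
  assumes "y \<in> carrier G" "z \<in> carrier G" "p \<in> Pos"
  shows "inJ 2 (\<lambda>\<rho>. sval p (y \<otimes> z) \<rho> - sval p y \<rho> - sval p z \<rho>)"
proof -
  obtain i j where p: "p = (i, j)" "i < m" "j < m" using assms(3) by auto
  have "inJ (1 + 1) (\<lambda>\<rho>. sval (i, r) y \<rho> * sval (r, j) z \<rho>)" if "r < m" for r
    using that p assms by (intro inJ_mult inJ_sval) auto
  then have "inJ 2 (\<lambda>\<rho>. \<Sum>r<m. sval (i, r) y \<rho> * sval (r, j) z \<rho>)"
    by (intro inJ_sum) (simp add: numeral_2_eq_2)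
  then show ?thesis
    using inJ_cong[of "\<lambda>\<rho>. sval p (y \<otimes> z) \<rho> - sval p y \<rho> - sval p z \<rho>"
        "\<lambda>\<rho>. \<Sum>r<m. sval (i, r) y \<rho> * sval (r, j) z \<rho>" 2] sval_mult[OF _ assms(1,2) p(2,3)] p(1) by simp
qed

text \<open>The linear part of the equation \<open>det = 1\<close>. In the Leibniz formula a permutation other than the
  identity moves at least two indices and contributes a product of two off-diagonal entries.\<close>

lemma trace_mod_J2:
  assumes y: "y \<in> carrier G"
  shows "inJ 2 (\<lambda>\<rho>. \<Sum>i<m. sval (i, i) y \<rho>)"
proof -
  have diag: "inJ 2 (\<lambda>\<rho>. (\<Prod>i\<in>A. 1 + sval (i, i) y \<rho>) - 1 - (\<Sum>i\<in>A. sval (i, i) y \<rho>))"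
    if "finite A" "A \<subseteq> {..<m}" for A
    using that
  proof induction
    case empty
    then show ?case by (simp add: inJ_zero)
  next
    case (insert i A)
    have s: "inJ 1 (sval (r, r) y)" if "r \<in> insert i A" for r
      using that insert.prems y by (intro inJ_sval) auto
    have "inJ 2 (\<lambda>\<rho>. ((\<Prod>i\<in>A. 1 + sval (i, i) y \<rho>) - 1 - (\<Sum>i\<in>A. sval (i, i) y \<rho>)) * (1 + sval (i, i) y \<rho>)
        + sval (i, i) y \<rho> * (\<Sum>i\<in>A. sval (i, i) y \<rho>))"
    proof (rule inJ_add)
      show "inJ 2 (\<lambda>\<rho>. ((\<Prod>i\<in>A. 1 + sval (i, i) y \<rho>) - 1 - (\<Sum>i\<in>A. sval (i, i) y \<rho>)) * (1 + sval (i, i) y \<rho>))"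
        using insert s by (intro inJ_mult_R inJ_add inJ_one inJ_antimono[OF s]) auto
      have "inJ (1 + 1) (\<lambda>\<rho>. sval (i, i) y \<rho> * (\<Sum>i\<in>A. sval (i, i) y \<rho>))"
        using s by (intro inJ_mult inJ_sum) auto
      then show "inJ 2 (\<lambda>\<rho>. sval (i, i) y \<rho> * (\<Sum>i\<in>A. sval (i, i) y \<rho>))"
        by (simp add: numeral_2_eq_2)
    qed
    moreover have "((\<Prod>i\<in>A. 1 + sval (i, i) y \<rho>) - 1 - (\<Sum>i\<in>A. sval (i, i) y \<rho>)) * (1 + sval (i, i) y \<rho>)
        + sval (i, i) y \<rho> * (\<Sum>i\<in>A. sval (i, i) y \<rho>) =
        (\<Prod>i\<in>insert i A. 1 + sval (i, i) y \<rho>) - 1 - (\<Sum>i\<in>insert i A. sval (i, i) y \<rho>)" for \<rho>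
      using insert.hyps by (simp add: algebra_simps)
    ultimately show ?case by simp
  qed
  define Off where "Off = {\<pi>. \<pi> permutes {0..<m}} - {id}"
  have off: "inJ 2 (\<lambda>\<rho>. signof \<pi> * (\<Prod>i = 0..<m. \<rho> y $$ (i, \<pi> i)))" if "\<pi> \<in> Off" for \<pi>
  proof -
    have \<pi>: "\<pi> permutes {0..<m}" "\<pi> \<noteq> id" using that by (auto simp: Off_def)
    define d where "d i = (if \<pi> i = i then 0 else 1 :: nat)" for i
    have img: "\<pi> i < m" if "i < m" for i using permutes_in_image[OF \<pi>(1), of i] that by simp
    have "inJ (d i) (\<lambda>\<rho>. \<rho> y $$ (i, \<pi> i))" if i: "i < m" for i
    proof (cases "\<pi> i = i")
      case True
      then show ?thesis using i y inJ_entry[of "(i, i)" y] by (simp add: d_def)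
    next
      case False
      then have "sval (i, \<pi> i) y = (\<lambda>\<rho>. \<rho> y $$ (i, \<pi> i))" by (auto simp: sval_def fun_eq_iff)
      then show ?thesis using False i img[OF i] y inJ_sval[of "(i, \<pi> i)" y] by (simp add: d_def)
    qed
    then have 1: "inJ (\<Sum>i = 0..<m. d i) (\<lambda>\<rho>. \<Prod>i = 0..<m. \<rho> y $$ (i, \<pi> i))"
      by (intro inJ_prod) simp
    have "\<exists>i. \<pi> i \<noteq> i" using \<pi>(2) by (auto simp: fun_eq_iff)
    then obtain i where i: "\<pi> i \<noteq> i" by blast
    \<comment> \<open>a permutation moving \<open>i\<close> also moves \<open>\<pi> i\<close>\<close>
    have im: "i \<in> {0..<m}" using i \<pi>(1) by (auto simp: permutes_def)
    have "\<pi> (\<pi> i) \<noteq> \<pi> i" using i permutes_inj[OF \<pi>(1)] by (auto dest: injD)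
    then have "(\<Sum>r\<in>{i, \<pi> i}. d r) = 2" using i by (simp add: d_def)
    moreover have "(\<Sum>r\<in>{i, \<pi> i}. d r) \<le> (\<Sum>i = 0..<m. d i)"
      using im img[of i] by (intro sum_mono2) auto
    ultimately have "inJ 2 (\<lambda>\<rho>. \<Prod>i = 0..<m. \<rho> y $$ (i, \<pi> i))"
      using 1 by (intro inJ_antimono[OF 1]) simp
    then show ?thesis
      using inJ_uminus[of 2 "\<lambda>\<rho>. \<Prod>i = 0..<m. \<rho> y $$ (i, \<pi> i)"] by (cases "evenperm \<pi>") (simp_all add: sign_def)
  qed
  have det: "(\<Sum>i<m. sval (i, i) y \<rho>) =
      - (\<Sum>\<pi>\<in>Off. signof \<pi> * (\<Prod>i = 0..<m. \<rho> y $$ (i, \<pi> i)))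
      - ((\<Prod>i<m. 1 + sval (i, i) y \<rho>) - 1 - (\<Sum>i<m. sval (i, i) y \<rho>))" if \<rho>: "\<rho> \<in> Reps" for \<rho>
  proof -
    have "1 = (\<Sum>\<pi> | \<pi> permutes {0..<m}. signof \<pi> * (\<Prod>i = 0..<m. \<rho> y $$ (i, \<pi> i)))"
      using rep_mat[OF \<rho> y] det_def'[of "\<rho> y" m] by simp
    also have "\<dots> = (\<Prod>i = 0..<m. \<rho> y $$ (i, i)) + (\<Sum>\<pi>\<in>Off. signof \<pi> * (\<Prod>i = 0..<m. \<rho> y $$ (i, \<pi> i)))"
      unfolding Off_def
      by (subst sum.remove[of _ id]) (auto simp: permutes_id finite_permutations)
    also have "(\<Prod>i = 0..<m. \<rho> y $$ (i, i)) = (\<Prod>i<m. 1 + sval (i, i) y \<rho>)"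
      by (simp add: sval_def atLeast0LessThan)
    finally show ?thesis by (simp add: algebra_simps)
  qed
  have "inJ 2 (\<lambda>\<rho>. - (\<Sum>\<pi>\<in>Off. signof \<pi> * (\<Prod>i = 0..<m. \<rho> y $$ (i, \<pi> i)))
      - ((\<Prod>i<m. 1 + sval (i, i) y \<rho>) - 1 - (\<Sum>i<m. sval (i, i) y \<rho>)))"
    by (intro inJ_diff inJ_uminus inJ_sum off diag) auto
  then show ?thesis using inJ_cong[OF det] by simp
qed

subsection \<open>Monomials span the graded quotients\<close>

definition smono :: "((nat \<times> nat) \<times> nat \<Rightarrow> nat) \<Rightarrow> ('g \<Rightarrow> complex mat) \<Rightarrow> complex" where
  "smono \<epsilon> \<rho> = (\<Prod>p\<in>entry_positions m. \<Prod>l<n. sval p (x l) \<rho> ^ \<epsilon> (p, l))"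

abbreviation "Exps k \<equiv> monomial_exponents m n k"

lemma pow_RR: "f \<in> carrier RR \<Longrightarrow> f [^]\<^bsub>RR\<^esub> (e :: nat) = (\<lambda>\<rho>\<in>Reps. f \<rho> ^ e)"
  by (induction e) (simp_all add: RR_ops fun_eq_iff)

lemma finprod_RR:
  assumes "f \<in> A \<rightarrow> carrier RR" "finite A"
  shows "(\<Otimes>\<^bsub>RR\<^esub>i\<in>A. f i) = (\<lambda>\<rho>\<in>Reps. \<Prod>i\<in>A. f i \<rho>)"
  using assms(2,1)
proof induction
  case (insert i A)
  then show ?case by (simp add: RR_ops fun_eq_iff Pi_iff)
qed (simp add: RR_ops)

lemma entry_positions_Pos: "p \<in> entry_positions m \<Longrightarrow> p \<in> Pos"
  by (simp add: entry_positions_def)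

lemma s_monomial_eq: "s_monomial m G n x \<epsilon> = restrict (smono \<epsilon>) Reps"
proof -
  have s: "s_fun m G p (x l) \<in> carrier RR" "s_fun m G p (x l) = restrict (sval p (x l)) Reps"
    if "p \<in> entry_positions m" "l < n" for p l
    using that s_fun_eq[of p "x l"] inJ_antimono[OF inJ_sval[of p "x l"], of 0] entry_positions_Pos
    by (auto simp: inJ_def J_0)
  have pw: "s_fun m G p (x l) [^]\<^bsub>RR\<^esub> \<epsilon> (p, l) \<in> carrier RR" if "p \<in> entry_positions m" "l < n" for p l
    using s(1)[OF that] by simp
  have inner: "(\<Otimes>\<^bsub>RR\<^esub>l\<in>{..<n}. s_fun m G p (x l) [^]\<^bsub>RR\<^esub> \<epsilon> (p, l)) \<in> carrier RR"
    if "p \<in> entry_positions m" for p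
    using pw[OF that] by (intro RR.finprod_closed) auto
  show ?thesis
  proof
    fix \<rho>
    show "s_monomial m G n x \<epsilon> \<rho> = restrict (smono \<epsilon>) Reps \<rho>"
    proof (cases "\<rho> \<in> Reps")
      case True
      have "(\<Otimes>\<^bsub>RR\<^esub>l\<in>{..<n}. s_fun m G p (x l) [^]\<^bsub>RR\<^esub> \<epsilon> (p, l)) \<rho> = (\<Prod>l<n. sval p (x l) \<rho> ^ \<epsilon> (p, l))"
        if "p \<in> entry_positions m" for p
        using pw[OF that] s[OF that] True by (subst finprod_RR) (auto simp: pow_RR intro!: prod.cong)
      then show ?thesis
        unfolding s_monomial_def using True inner
        by (subst finprod_RR) (auto simp: smono_def intro!: prod.cong)
    next
      case False
      then show ?thesis
        unfolding s_monomial_def using inner by (subst finprod_RR) (auto simp: Pi_iff)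
    qed
  qed
qed

lemma inJ_smono:
  assumes "\<epsilon> \<in> Exps k"
  shows "inJ k (smono \<epsilon>)"
proof -
  have "inJ (\<Sum>p\<in>entry_positions m. \<Sum>l<n. \<epsilon> (p, l) * 1) (smono \<epsilon>)"
    unfolding smono_def using entry_positions_Pos
    by (intro inJ_prod inJ_power inJ_sval) auto
  then show ?thesis using assms by (simp add: monomial_exponents_def)
qed

text \<open>The class of \<open>f\<close> modulo \<open>J (Suc k)\<close> is then in the span of those of the monomials. A plain function is
  easier to handle here than a coset, since products of such functions leave the graded piece.\<close>

definition spanned :: "nat \<Rightarrow> (('g \<Rightarrow> complex mat) \<Rightarrow> complex) \<Rightarrow> bool" where
  "spanned k f \<longleftrightarrow> (\<exists>c. inJ (Suc k) (\<lambda>\<rho>. f \<rho> - (\<Sum>\<epsilon>\<in>Exps k. of_rat (c \<epsilon>) * smono \<epsilon> \<rho>)))"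

lemma spanned_J: "inJ (Suc k) f \<Longrightarrow> spanned k f"
  unfolding spanned_def by (rule exI[of _ "\<lambda>_. 0"]) simp

lemma spanned_add:
  assumes "spanned k f" "spanned k g"
  shows "spanned k (\<lambda>\<rho>. f \<rho> + g \<rho>)"
proof -
  obtain c d where "inJ (Suc k) (\<lambda>\<rho>. f \<rho> - (\<Sum>\<epsilon>\<in>Exps k. of_rat (c \<epsilon>) * smono \<epsilon> \<rho>))"
    "inJ (Suc k) (\<lambda>\<rho>. g \<rho> - (\<Sum>\<epsilon>\<in>Exps k. of_rat (d \<epsilon>) * smono \<epsilon> \<rho>))"
    using assms by (auto simp: spanned_def)
  from inJ_add[OF this] show ?thesis
    unfolding spanned_def
    by (intro exI[of _ "\<lambda>\<epsilon>. c \<epsilon> + d \<epsilon>"]) (simp add: of_rat_add algebra_simps sum.distrib)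
qed

lemma spanned_smult:
  assumes "spanned k f"
  shows "spanned k (\<lambda>\<rho>. of_rat q * f \<rho>)"
proof -
  obtain c where "inJ (Suc k) (\<lambda>\<rho>. f \<rho> - (\<Sum>\<epsilon>\<in>Exps k. of_rat (c \<epsilon>) * smono \<epsilon> \<rho>))"
    using assms by (auto simp: spanned_def)
  from inJ_smult[OF this, of q] show ?thesis
    unfolding spanned_def
    by (intro exI[of _ "\<lambda>\<epsilon>. q * c \<epsilon>"]) (simp add: of_rat_mult algebra_simps sum_distrib_left)
qed

lemma spanned_sum: "(\<And>i. i \<in> A \<Longrightarrow> spanned k (f i)) \<Longrightarrow> spanned k (\<lambda>\<rho>. \<Sum>i\<in>A. f i \<rho>)"
proof (induction A rule: infinite_finite_induct)
  case (insert i A)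
  then show ?case using spanned_add[of k "f i"] by simp
qed (simp_all add: spanned_J inJ_zero)

lemma spanned_cong: "(\<And>\<rho>. \<rho> \<in> Reps \<Longrightarrow> f \<rho> = g \<rho>) \<Longrightarrow> spanned k f \<Longrightarrow> spanned k g"
proof -
  assume eq: "\<And>\<rho>. \<rho> \<in> Reps \<Longrightarrow> f \<rho> = g \<rho>" and "spanned k f"
  then obtain c where "inJ (Suc k) (\<lambda>\<rho>. f \<rho> - (\<Sum>\<epsilon>\<in>Exps k. of_rat (c \<epsilon>) * smono \<epsilon> \<rho>))"
    by (auto simp: spanned_def)
  moreover have "inJ (Suc k) (\<lambda>\<rho>. f \<rho> - (\<Sum>\<epsilon>\<in>Exps k. of_rat (c \<epsilon>) * smono \<epsilon> \<rho>)) \<longleftrightarrow>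
      inJ (Suc k) (\<lambda>\<rho>. g \<rho> - (\<Sum>\<epsilon>\<in>Exps k. of_rat (c \<epsilon>) * smono \<epsilon> \<rho>))"
    by (rule inJ_cong) (simp add: eq)
  ultimately show "spanned k g" unfolding spanned_def by blast
qed

lemma finite_Exps: "finite (Exps k)"
  by (rule finite_monomial_exponents)

lemma spanned_smono:
  assumes "\<epsilon> \<in> Exps k"
  shows "spanned k (smono \<epsilon>)"
  unfolding spanned_def
proof (intro exI)
  have "(\<Sum>\<eta>\<in>Exps k. of_rat (if \<eta> = \<epsilon> then 1 else 0) * smono \<eta> \<rho>) =
      (\<Sum>\<eta>\<in>Exps k. if \<eta> = \<epsilon> then smono \<epsilon> \<rho> else 0)" for \<rho>
    by (rule sum.cong) auto
  then show "inJ (Suc k) (\<lambda>\<rho>. smono \<epsilon> \<rho> - (\<Sum>\<eta>\<in>Exps k. of_rat (if \<eta> = \<epsilon> then 1 else 0) * smono \<eta> \<rho>))"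
    using assms by (simp add: finite_Exps inJ_zero)
qed

lemma smono_mult:
  assumes "\<epsilon> \<in> Exps a" "\<eta> \<in> Exps b"
  shows "\<exists>\<zeta>\<in>Exps (a + b). \<forall>\<rho>. smono \<epsilon> \<rho> * smono \<eta> \<rho> = smono \<zeta> \<rho>"
proof (intro bexI allI)
  let ?\<zeta> = "\<lambda>q\<in>entry_positions m \<times> {..<n}. \<epsilon> q + \<eta> q"
  show "?\<zeta> \<in> Exps (a + b)"
    using assms by (simp add: monomial_exponents_def sum.distrib)
  show "smono \<epsilon> \<rho> * smono \<eta> \<rho> = smono ?\<zeta> \<rho>" for \<rho>
    unfolding smono_def prod.distrib[symmetric] by (intro prod.cong refl) (simp add: power_add)
qed

text \<open>Exchanging \<open>f\<close> and \<open>g\<close> for their combinations of monomials changes the product by terms of higher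
  order.\<close>

lemma spanned_mult:
  assumes f: "inJ a f" "spanned a f" and g: "inJ b g" "spanned b g"
  shows "spanned (a + b) (\<lambda>\<rho>. f \<rho> * g \<rho>)"
proof -
  obtain c d where c: "inJ (Suc a) (\<lambda>\<rho>. f \<rho> - (\<Sum>\<epsilon>\<in>Exps a. of_rat (c \<epsilon>) * smono \<epsilon> \<rho>))"
    and d: "inJ (Suc b) (\<lambda>\<rho>. g \<rho> - (\<Sum>\<epsilon>\<in>Exps b. of_rat (d \<epsilon>) * smono \<epsilon> \<rho>))"
    using f g by (auto simp: spanned_def)
  let ?c = "\<lambda>\<rho>. \<Sum>\<epsilon>\<in>Exps a. of_rat (c \<epsilon>) * smono \<epsilon> \<rho>"
  let ?d = "\<lambda>\<rho>. \<Sum>\<epsilon>\<in>Exps b. of_rat (d \<epsilon>) * smono \<epsilon> \<rho>"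
  have "inJ a ?c" by (intro inJ_sum inJ_smult inJ_smono)
  then have "inJ (Suc (a + b)) (\<lambda>\<rho>. (f \<rho> - ?c \<rho>) * g \<rho> + ?c \<rho> * (g \<rho> - ?d \<rho>))"
    using inJ_mult[OF c g(1)] inJ_mult[OF _ d, of a ?c] by (intro inJ_add) simp_all
  then have 1: "spanned (a + b) (\<lambda>\<rho>. (f \<rho> - ?c \<rho>) * g \<rho> + ?c \<rho> * (g \<rho> - ?d \<rho>))"
    by (rule spanned_J)
  have "spanned (a + b) (\<lambda>\<rho>. of_rat (c \<epsilon> * d \<eta>) * (smono \<epsilon> \<rho> * smono \<eta> \<rho>))"
    if \<epsilon>\<eta>: "\<epsilon> \<in> Exps a" "\<eta> \<in> Exps b" for \<epsilon> \<eta>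
  proof -
    obtain \<zeta> where "\<zeta> \<in> Exps (a + b)" "\<And>\<rho>. smono \<epsilon> \<rho> * smono \<eta> \<rho> = smono \<zeta> \<rho>"
      using smono_mult[OF \<epsilon>\<eta>] by blast
    then show ?thesis using spanned_smult[OF spanned_smono] by simp
  qed
  then have "spanned (a + b) (\<lambda>\<rho>. \<Sum>\<epsilon>\<in>Exps a. \<Sum>\<eta>\<in>Exps b. of_rat (c \<epsilon> * d \<eta>) * (smono \<epsilon> \<rho> * smono \<eta> \<rho>))"
    by (intro spanned_sum)
  moreover have "(\<Sum>\<epsilon>\<in>Exps a. \<Sum>\<eta>\<in>Exps b. of_rat (c \<epsilon> * d \<eta>) * (smono \<epsilon> \<rho> * smono \<eta> \<rho>)) = ?c \<rho> * ?d \<rho>" for \<rho>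
    by (simp add: sum_product of_rat_mult ac_simps)
  ultimately have "spanned (a + b) (\<lambda>\<rho>. ?c \<rho> * ?d \<rho>)" by simp
  from spanned_add[OF 1 this] show ?thesis by (simp add: algebra_simps)
qed

text \<open>Each generator \<open>a\<^bsub>ij\<^esub>(y)\<close> differs from a Kronecker delta by an element of the ideal; hence the ring
  is \<open>\<rat> + J 1\<close>, and multiples of monomials by ring elements are rational multiples modulo higher
  order.\<close>

lemma const_mod_J:
  assumes "f \<in> carrier RR"
  shows "\<exists>q. inJ 1 (\<lambda>\<rho>. f \<rho> - of_rat q)"
proof -
  define V where "V = {f \<in> carrier RR. \<exists>q. inJ 1 (\<lambda>\<rho>. f \<rho> - of_rat q)}"
  have "rat_subalgebra (fun_algebra Reps) V"
  proof (rule rat_subalgebraI)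
    show "V \<subseteq> Reps \<rightarrow>\<^sub>E UNIV" using RR_subset by (auto simp: V_def)
    have "inJ 1 (\<lambda>\<rho>. (\<lambda>\<rho>\<in>Reps. 1) \<rho> - of_rat 1)"
      using inJ_cong[of "\<lambda>\<rho>. (\<lambda>\<rho>\<in>Reps. 1) \<rho> - of_rat 1" "\<lambda>_. 0" 1] by (simp add: inJ_zero)
    then show "(\<lambda>\<rho>\<in>Reps. 1) \<in> V"
      using RR_closed(1) unfolding V_def RR_ops by blast
  next
    fix f g assume "f \<in> V" "g \<in> V"
    then obtain q r where fg: "f \<in> carrier RR" "g \<in> carrier RR" and
      q: "inJ 1 (\<lambda>\<rho>. f \<rho> - of_rat q)" and r: "inJ 1 (\<lambda>\<rho>. g \<rho> - of_rat r)" by (auto simp: V_def)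
    have "inJ 1 (\<lambda>\<rho>. (f \<rho> - of_rat q) * g \<rho> + of_rat q * (g \<rho> - of_rat r))"
      using fg q r inR_iff[OF fg(2)] by (intro inJ_add inJ_mult_R inJ_smult) (simp_all add: inJ_0)
    then have "inJ 1 (\<lambda>\<rho>. (\<lambda>\<rho>\<in>Reps. f \<rho> * g \<rho>) \<rho> - of_rat (q * r))"
      by (subst inJ_cong[of _ "\<lambda>\<rho>. (f \<rho> - of_rat q) * g \<rho> + of_rat q * (g \<rho> - of_rat r)"])
        (simp_all add: of_rat_mult algebra_simps)
    then show "(\<lambda>\<rho>\<in>Reps. f \<rho> * g \<rho>) \<in> V"
      using RR_closed(3)[OF fg] unfolding V_def RR_ops by blast
    have "inJ 1 (\<lambda>\<rho>. (\<lambda>\<rho>\<in>Reps. f \<rho> + g \<rho>) \<rho> - of_rat (q + r))"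
      using inJ_add[OF q r]
      by (subst inJ_cong[of _ "\<lambda>\<rho>. f \<rho> - of_rat q + (g \<rho> - of_rat r)"])
        (simp_all add: of_rat_add algebra_simps)
    then show "(\<lambda>\<rho>\<in>Reps. f \<rho> + g \<rho>) \<in> V"
      using RR_closed(4)[OF fg] unfolding V_def RR_ops by blast
  next
    fix f q' assume "f \<in> V"
    then obtain q where f: "f \<in> carrier RR" and q: "inJ 1 (\<lambda>\<rho>. f \<rho> - of_rat q)" by (auto simp: V_def)
    have "inJ 1 (\<lambda>\<rho>. (\<lambda>\<rho>\<in>Reps. of_rat q' * f \<rho>) \<rho> - of_rat (q' * q))"
      using inJ_smult[OF q, of q']
      by (subst inJ_cong[of _ "\<lambda>\<rho>. of_rat q' * (f \<rho> - of_rat q)"])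
        (simp_all add: of_rat_mult algebra_simps)
    then show "(\<lambda>\<rho>\<in>Reps. of_rat q' * f \<rho>) \<in> V"
      using RR_closed(5)[OF f, of q'] unfolding V_def RR_ops by blast
  qed
  moreover have "entry_fun m G p y \<in> V" if "p \<in> Pos" "y \<in> carrier G" for p y
  proof -
    have "inJ 1 (\<lambda>\<rho>. entry_fun m G p y \<rho> - of_rat (if fst p = snd p then 1 else 0))"
      using inJ_sval[OF that]
      by (subst inJ_cong[of _ "sval p y"]) (auto simp: entry_fun_def sval_def)
    then show ?thesis using entry_fun_RR[OF that] unfolding V_def by blast
  qed
  ultimately have "carrier RR \<subseteq> V" by (rule RR_least)
  with assms show ?thesis by (auto simp: V_def)
qed

lemma spanned_R:
  assumes "inJ 0 f"
  shows "spanned 0 f"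
proof -
  have f: "restrict f Reps \<in> carrier RR" using assms by (simp add: inJ_def J_0)
  obtain q where q: "inJ 1 (\<lambda>\<rho>. restrict f Reps \<rho> - of_rat q)" using const_mod_J[OF f] by blast
  let ?z = "\<lambda>q\<in>entry_positions m \<times> {..<n}. 0 :: nat"
  have z: "?z \<in> Exps 0" by (simp add: monomial_exponents_def)
  have "smono ?z \<rho> = 1" for \<rho> by (simp add: smono_def)
  then have "spanned 0 (\<lambda>\<rho>. of_rat q)"
    using spanned_smult[OF spanned_smono[OF z], of q] by simp
  from spanned_add[OF spanned_J[of 0] this] q have "spanned 0 (\<lambda>\<rho>. restrict f Reps \<rho>)" by fastforce
  then show ?thesis by (rule spanned_cong[rotated]) simp
qed

text \<open>The entry \<open>(m - 1, m - 1)\<close>, which is missing from the monomials, is minus the sum of the other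
  diagonal entries modulo \<open>J 2\<close>.\<close>

lemma spanned_sval_x:
  assumes "p \<in> Pos" "l < n"
  shows "spanned 1 (sval p (x l))"
proof -
  have main: "spanned 1 (sval p (x l))" if p: "p \<in> entry_positions m" for p
  proof -
    let ?e = "\<lambda>q\<in>entry_positions m \<times> {..<n}. if q = (p, l) then 1 else 0 :: nat"
    have "(\<Sum>q\<in>entry_positions m \<times> {..<n}. ?e q) = (\<Sum>q\<in>entry_positions m \<times> {..<n}. if q = (p, l) then 1 else 0)"
      by (rule sum.cong) auto
    also have "\<dots> = 1" using p assms(2) by (simp add: sum.delta)
    finally have e: "?e \<in> Exps 1"
      by (simp add: monomial_exponents_def sum.cartesian_product)
    have "smono ?e = sval p (x l)"
    proof
      fix \<rho>
      have "smono ?e \<rho> = (\<Prod>(p', l')\<in>entry_positions m \<times> {..<n}. sval p' (x l') \<rho> ^ ?e (p', l'))"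
        by (simp only: smono_def prod.cartesian_product)
      also have "\<dots> = (\<Prod>q\<in>entry_positions m \<times> {..<n}. if q = (p, l) then sval p (x l) \<rho> else 1)"
        by (rule prod.cong) (auto split: if_splits)
      also have "\<dots> = sval p (x l) \<rho>" using p assms(2) by (simp add: prod.delta)
      finally show "smono ?e \<rho> = sval p (x l) \<rho>" .
    qed
    then show ?thesis using spanned_smono[OF e] by (simp only:)
  qed
  show ?thesis
  proof (cases "p \<in> entry_positions m")
    case False
    then have p: "p = (m - 1, m - 1)" using assms(1) by (auto simp: entry_positions_def)
    have "spanned 1 (\<lambda>\<rho>. \<Sum>i<m. sval (i, i) (x l) \<rho>)"
      using trace_mod_J2[of "x l"] assms(2) by (intro spanned_J) (simp add: numeral_2_eq_2)
    moreover have "spanned 1 (\<lambda>\<rho>. of_rat (- 1) * (\<Sum>i<m - 1. sval (i, i) (x l) \<rho>))"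
      by (intro spanned_smult spanned_sum main) (auto simp: entry_positions_def)
    ultimately have "spanned 1 (\<lambda>\<rho>. (\<Sum>i<m. sval (i, i) (x l) \<rho>) + of_rat (- 1) * (\<Sum>i<m - 1. sval (i, i) (x l) \<rho>))"
      by (rule spanned_add)
    moreover have "{..<m} = insert (m - 1) {..<m - 1}" using m_ge_2 by auto
    ultimately show ?thesis by (simp add: p)
  qed (rule main)
qed

text \<open>The ideal is minimal among the ideals containing its generators. The two closure conditions are those of an
  ideal, with the operations of the ring spelled out pointwise.\<close>

lemma J_ideal_least:
  assumes "\<And>f g. \<lbrakk>f \<in> carrier RR; g \<in> carrier RR; P f; P g\<rbrakk> \<Longrightarrow> P (\<lambda>\<rho>\<in>Reps. f \<rho> + g \<rho>)"
    and "\<And>f g. \<lbrakk>f \<in> carrier RR; g \<in> carrier RR; P f\<rbrakk> \<Longrightarrow> P (\<lambda>\<rho>\<in>Reps. f \<rho> * g \<rho>)"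
    and "\<And>p l. \<lbrakk>p \<in> Pos; l < n\<rbrakk> \<Longrightarrow> P (restrict (sval p (x l)) Reps)"
    and zero: "P (\<lambda>\<rho>\<in>Reps. 0)"
    and f: "f \<in> J_ideal m G n x"
  shows "P f"
proof -
  let ?I = "{f \<in> carrier RR. P f}"
  have mult: "f \<otimes>\<^bsub>RR\<^esub> g \<in> ?I" if "f \<in> ?I" "g \<in> carrier RR" for f g
    using that assms(2)[of f g] RR_closed(3)[of f g] by (simp add: RR_ops)
  have "ideal ?I RR"
  proof (rule idealI[OF RR.ring_axioms])
    show "subgroup ?I (add_monoid RR)"
    proof (rule RR.add.subgroupI)
      show "\<ominus>\<^bsub>RR\<^esub> f \<in> ?I" if "f \<in> ?I" for f
      proof -
        have m1: "(\<lambda>\<rho>\<in>Reps. - 1) \<in> carrier RR" using inR_rat[of "- 1"] by (simp add: inR_def)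
        have "\<ominus>\<^bsub>RR\<^esub> f = f \<otimes>\<^bsub>RR\<^esub> (\<lambda>\<rho>\<in>Reps. - 1)"
          using that by (simp add: uminus_RR RR_ops fun_eq_iff)
        then show ?thesis using mult[OF that m1] by simp
      qed
      show "f \<oplus>\<^bsub>RR\<^esub> g \<in> ?I" if "f \<in> ?I" "g \<in> ?I" for f g
        using that assms(1)[of f g] RR_closed(4)[of f g] by (simp add: RR_ops)
      show "?I \<noteq> {}" using zero RR_closed(2) unfolding RR_ops by blast
    qed simp
    show "f \<otimes>\<^bsub>RR\<^esub> g \<in> ?I" if "f \<in> ?I" "g \<in> carrier RR" for f g
      by (rule mult[OF that])
    show "g \<otimes>\<^bsub>RR\<^esub> f \<in> ?I" if "f \<in> ?I" "g \<in> carrier RR" for f g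
      by (subst RR.m_comm) (use that mult in auto)
  qed
  moreover have "{s_fun m G p (x l) | p l. p \<in> Pos \<and> l < n} \<subseteq> ?I"
    using s_fun_eq assms(3) inJ_sval[of _ "x _"] inJ_antimono[of 1 _ 0] by (auto simp: inJ_def J_0)
  ultimately have "J_ideal m G n x \<subseteq> ?I"
    unfolding J_ideal_def by (rule RR.genideal_minimal)
  with f show ?thesis by blast
qed

lemma spanned_J_ideal:
  assumes "f \<in> J_ideal m G n x"
  shows "spanned 1 f"
proof -
  have "inJ 1 f \<and> spanned 1 f"
    using assms
  proof (rule J_ideal_least[rotated -1])
    fix f g assume fg: "f \<in> carrier RR" "g \<in> carrier RR" "inJ 1 f \<and> spanned 1 f"
    have g0: "inJ 0 g" using inR_iff[OF fg(2)] by (simp add: inJ_0)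
    have "inJ 1 (\<lambda>\<rho>. f \<rho> * g \<rho>)" "spanned 1 (\<lambda>\<rho>. f \<rho> * g \<rho>)"
      using fg g0 inJ_mult_R spanned_mult[of 1 f 0 g] spanned_R[OF g0] by auto
    then show "inJ 1 (\<lambda>\<rho>\<in>Reps. f \<rho> * g \<rho>) \<and> spanned 1 (\<lambda>\<rho>\<in>Reps. f \<rho> * g \<rho>)"
      using inJ_cong[of "\<lambda>\<rho>\<in>Reps. f \<rho> * g \<rho>" "\<lambda>\<rho>. f \<rho> * g \<rho>" 1]
        spanned_cong[of "\<lambda>\<rho>. f \<rho> * g \<rho>" "\<lambda>\<rho>\<in>Reps. f \<rho> * g \<rho>" 1] by simp
  next
    fix f g assume "inJ 1 f \<and> spanned 1 f" "inJ 1 g \<and> spanned 1 g"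
    then have "inJ 1 (\<lambda>\<rho>. f \<rho> + g \<rho>)" "spanned 1 (\<lambda>\<rho>. f \<rho> + g \<rho>)"
      using inJ_add spanned_add by auto
    then show "inJ 1 (\<lambda>\<rho>\<in>Reps. f \<rho> + g \<rho>) \<and> spanned 1 (\<lambda>\<rho>\<in>Reps. f \<rho> + g \<rho>)"
      using inJ_cong[of "\<lambda>\<rho>\<in>Reps. f \<rho> + g \<rho>" "\<lambda>\<rho>. f \<rho> + g \<rho>" 1]
        spanned_cong[of "\<lambda>\<rho>. f \<rho> + g \<rho>" "\<lambda>\<rho>\<in>Reps. f \<rho> + g \<rho>" 1] by simp
  next
    fix p l assume "p \<in> Pos" "l < n"
    then show "inJ 1 (restrict (sval p (x l)) Reps) \<and> spanned 1 (restrict (sval p (x l)) Reps)"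
      using inJ_sval_x[of p l] spanned_sval_x[of p l]
        inJ_cong[of "restrict (sval p (x l)) Reps" "sval p (x l)" 1]
        spanned_cong[of "sval p (x l)" "restrict (sval p (x l)) Reps" 1] by simp
  next
    show "inJ 1 (\<lambda>\<rho>\<in>Reps. 0) \<and> spanned 1 (\<lambda>\<rho>\<in>Reps. 0)"
      using inJ_zero[of 1] spanned_J[of 1 "\<lambda>_. 0"] inJ_zero[of "Suc 1"]
        inJ_cong[of "\<lambda>\<rho>\<in>Reps. 0" "\<lambda>_. 0" 1] spanned_cong[of "\<lambda>_. 0" "\<lambda>\<rho>\<in>Reps. 0" 1] by simp
  qed
  then show ?thesis ..
qed

text \<open>The filtration by powers is compatible with products, so the case of \<open>J k\<close> follows from those of the
  ring and of the ideal.\<close>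

theorem J_spanned: "f \<in> J k \<Longrightarrow> spanned k f"
proof (induction k arbitrary: f)
  case 0
  then show ?case by (intro spanned_R inJ_J)
next
  case (Suc k)
  then have "f \<in> ideal_prod RR (J k) (J_ideal m G n x)" by (simp add: J_Suc)
  then show ?case
  proof induction
    case (prod i j)
    have "spanned (k + 1) (\<lambda>\<rho>. i \<rho> * j \<rho>)"
      using prod Suc.IH by (intro spanned_mult inJ_J spanned_J_ideal J_ideal_subset_J)
    then show ?case by (intro spanned_cong[of _ "i \<otimes>\<^bsub>RR\<^esub> j"]) (auto simp: RR_ops)
  next
    case (sum s1 s2)
    from spanned_add[OF sum(3,4)] show ?case
      by (rule spanned_cong[rotated]) (simp add: RR_ops)
  qed
qed

section \<open>Leading coefficients along curves of representations\<close>

lemma rep_inv: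
  assumes "\<rho> \<in> Reps" "y \<in> carrier G"
  shows "\<rho> (inv y) = adj_mat (\<rho> y)"
proof -
  note A = rep_mat[OF assms]
  note adj = adj_mat[OF A(1)]
  have B: "\<rho> (inv y) \<in> carrier_mat m m" using assms rep_mat(1) by simp
  have "\<rho> y * \<rho> (inv y) = 1\<^sub>m m"
    using rep_mult[OF assms(1,2), of "inv y"] assms by (simp add: rep_one)
  then have "adj_mat (\<rho> y) = adj_mat (\<rho> y) * (\<rho> y * \<rho> (inv y))" using adj by simp
  also have "\<dots> = (adj_mat (\<rho> y) * \<rho> y) * \<rho> (inv y)" using adj(1) A(1) B by (simp add: assoc_mult_mat)
  also have "\<dots> = \<rho> (inv y)" using adj(3) A(2) B by (simp add: smult_one_one_mat)
  finally show ?thesis ..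
qed

text \<open>The curve in direction \<open>a\<close>: the generator \<open>x l\<close> is sent to \<open>1 + t a\<close>, with last diagonal
  direction \<open>0\<close> and with the last row rescaled to make the determinant \<open>1\<close>. Where the
  determinant vanishes, which does not happen near \<open>t = 0\<close>, the value is immaterial.\<close>

definition line_mat :: "((nat \<times> nat) \<times> nat \<Rightarrow> complex) \<Rightarrow> nat \<Rightarrow> complex \<Rightarrow> complex mat" where
  "line_mat a l t = mat m m (\<lambda>(i, j). (if i = j then 1 else 0) +
     t * (if (i, j) = (m - 1, m - 1) then 0 else a ((i, j), l)))"

definition curve_mat :: "((nat \<times> nat) \<times> nat \<Rightarrow> complex) \<Rightarrow> nat \<Rightarrow> complex \<Rightarrow> complex mat" where
  "curve_mat a l t = (if det (line_mat a l t) = 0 then 1\<^sub>m m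
     else multrow (m - 1) (1 / det (line_mat a l t)) (line_mat a l t))"

lemma line_mat_carrier: "line_mat a l t \<in> carrier_mat m m"
  by (simp add: line_mat_def)

lemma curve_mat_SL: "curve_mat a l t \<in> carrier (SL_group m)"
proof (cases "det (line_mat a l t) = 0")
  case False
  then show ?thesis
    using det_multrow[of "m - 1" m "line_mat a l t" "1 / det (line_mat a l t)"] m_ge_2
    by (simp add: curve_mat_def SL_group_def line_mat_carrier)
qed (simp add: curve_mat_def SL_group_def)

definition curve :: "((nat \<times> nat) \<times> nat \<Rightarrow> complex) \<Rightarrow> complex \<Rightarrow> 'g \<Rightarrow> complex mat" where
  "curve a t = (SOME \<rho>. \<rho> \<in> Reps \<and> (\<forall>l<n. \<rho> (x l) = curve_mat a l t))"

lemma curve_Reps: "curve a t \<in> Reps"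
  and curve_x: "l < n \<Longrightarrow> curve a t (x l) = curve_mat a l t"
proof -
  obtain \<phi> where \<phi>: "\<phi> \<in> hom G (SL_group m)" "\<forall>l<n. \<phi> (x l) = curve_mat a l t"
    using universal_property[OF group_SL, of "\<lambda>l. curve_mat a l t"] curve_mat_SL by blast
  have "restrict \<phi> (carrier G) \<in> Reps \<and> (\<forall>l<n. restrict \<phi> (carrier G) (x l) = curve_mat a l t)"
    using \<phi> by (auto simp: reps_def hom_def Pi_iff)
  then have "\<exists>\<rho>. \<rho> \<in> Reps \<and> (\<forall>l<n. \<rho> (x l) = curve_mat a l t)" by blast
  from someI_ex[OF this] show "curve a t \<in> Reps" "l < n \<Longrightarrow> curve a t (x l) = curve_mat a l t"
    by (simp_all add: curve_def)
qed

lemma det_line_mat: "\<exists>Q :: complex poly. \<forall>t. det (line_mat a l t) = 1 + t * poly Q t"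
proof -
  define P where "P = (\<Sum>\<pi> | \<pi> permutes {0..<m}. [:signof \<pi>:] * (\<Prod>i = 0..<m.
      [:if i = \<pi> i then 1 else 0, if (i, \<pi> i) = (m - 1, m - 1) then 0 else a ((i, \<pi> i), l):]))"
  have P: "det (line_mat a l t) = poly P t" for t
  proof -
    have "line_mat a l t $$ (i, \<pi> i) =
        poly [:if i = \<pi> i then 1 else 0, if (i, \<pi> i) = (m - 1, m - 1) then 0 else a ((i, \<pi> i), l):] t"
      if "\<pi> permutes {0..<m}" "i < m" for \<pi> i
      using permutes_in_image[OF that(1), of i] that(2) by (simp add: line_mat_def)
    then show ?thesis
      unfolding det_def'[OF line_mat_carrier] P_def poly_sum poly_mult poly_prod
      by (intro sum.cong refl arg_cong2[where f = "(*)"] prod.cong) auto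
  qed
  obtain c Q where Q: "P = pCons c Q" by (cases P)
  have "line_mat a l 0 = 1\<^sub>m m" by (rule eq_matI) (auto simp: line_mat_def)
  then have "c = 1" using P[of 0] Q by simp
  then show ?thesis using P Q by (intro exI[of _ Q]) simp
qed

text \<open>Rescaling by \<open>1 / det\<close> alters the entries of the last row in second order only, apart from the last
  diagonal entry. For that one it is enough that a limit exists.\<close>

lemma tendsto_sval_curve:
  assumes p: "p \<in> Pos" and l: "l < n"
  shows "\<exists>v. ((\<lambda>t. sval p (x l) (curve a t) / t) \<longlongrightarrow> v) (at 0)
    \<and> (p \<in> entry_positions m \<longrightarrow> v = a (p, l))"
proof -
  obtain i j where ij: "p = (i, j)" "i < m" "j < m" using p by auto
  obtain Q where Q: "\<And>t. det (line_mat a l t) = 1 + t * poly Q t" using det_line_mat by blast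
  have "isCont (poly Q) 0" by simp
  then have Q0: "((\<lambda>t. poly Q t) \<longlongrightarrow> poly Q 0) (at 0)" by (simp add: isCont_def)
  have "((\<lambda>t. 1 + t * poly Q t) \<longlongrightarrow> 1 + 0 * poly Q 0) (at 0)"
    by (intro tendsto_intros Q0)
  then have D: "((\<lambda>t. 1 + t * poly Q t) \<longlongrightarrow> 1) (at 0)" by simp
  then have ev: "eventually (\<lambda>t. 1 + t * poly Q t \<noteq> 0) (at 0)"
    by (rule tendsto_imp_eventually_ne) simp
  have ev0: "eventually (\<lambda>t :: complex. t \<noteq> 0) (at 0)" by (rule eventually_neq_at_within)
  define v where "v = (if (i, j) = (m - 1, m - 1) then - poly Q 0 else a ((i, j), l))"
  define w where "w t = (if i = m - 1 then
      (if j = m - 1 then - poly Q t / (1 + t * poly Q t) else a ((i, j), l) / (1 + t * poly Q t))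
      else a ((i, j), l))" for t
  have w: "(w \<longlongrightarrow> v) (at 0)"
  proof -
    have "((\<lambda>t. - poly Q t / (1 + t * poly Q t)) \<longlongrightarrow> - poly Q 0 / 1) (at 0)"
      by (intro tendsto_intros Q0 D) simp
    moreover have "((\<lambda>t. a ((i, j), l) / (1 + t * poly Q t)) \<longlongrightarrow> a ((i, j), l) / 1) (at 0)"
      by (intro tendsto_intros D) simp
    ultimately show ?thesis
      by (cases "i = m - 1"; cases "j = m - 1") (simp_all add: w_def[abs_def] v_def)
  qed
  have "eventually (\<lambda>t. w t = sval p (x l) (curve a t) / t) (at 0)"
    using ev ev0
  proof eventually_elim
    case (elim t)
    have "curve a t (x l) $$ (i, j) = (if i = m - 1 then 1 / (1 + t * poly Q t) else 1) * line_mat a l t $$ (i, j)"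
      using elim ij l line_mat_carrier[of a l t] by (auto simp: curve_x curve_mat_def Q)
    also have "line_mat a l t $$ (i, j) = (if i = j then 1 else 0) +
        t * (if (i, j) = (m - 1, m - 1) then 0 else a ((i, j), l))"
      using ij by (simp add: line_mat_def)
    finally show ?case
      using elim by (auto simp: w_def sval_def ij field_simps)
  qed
  with w have "((\<lambda>t. sval p (x l) (curve a t) / t) \<longlongrightarrow> v) (at 0)"
    by (rule Lim_transform_eventually)
  moreover have "p \<in> entry_positions m \<longrightarrow> v = a (p, l)"
    by (auto simp: v_def ij entry_positions_def)
  ultimately show ?thesis by blast
qed

text \<open>Asking for a limit rather than a bound includes the existence of a coefficient of \<open>t\<^sup>k\<close>, which makes
  taking coefficients multiplicative.\<close>

definition conv :: "((nat \<times> nat) \<times> nat \<Rightarrow> complex) \<Rightarrow> nat \<Rightarrow> (('g \<Rightarrow> complex mat) \<Rightarrow> complex) \<Rightarrow> bool" where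
  "conv a k f \<longleftrightarrow> (\<exists>v. ((\<lambda>t. f (curve a t) / t ^ k) \<longlongrightarrow> v) (at 0))"

lemma conv_cong: "(\<And>\<rho>. \<rho> \<in> Reps \<Longrightarrow> f \<rho> = g \<rho>) \<Longrightarrow> conv a k f \<longleftrightarrow> conv a k g"
  by (simp add: conv_def curve_Reps)

lemma conv_add: "\<lbrakk>conv a k f; conv a k g\<rbrakk> \<Longrightarrow> conv a k (\<lambda>\<rho>. f \<rho> + g \<rho>)"
proof -
  assume "conv a k f" "conv a k g"
  then obtain v w where "((\<lambda>t. f (curve a t) / t ^ k) \<longlongrightarrow> v) (at 0)"
    "((\<lambda>t. g (curve a t) / t ^ k) \<longlongrightarrow> w) (at 0)" by (auto simp: conv_def)
  from tendsto_add[OF this] show "conv a k (\<lambda>\<rho>. f \<rho> + g \<rho>)"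
    by (auto simp: conv_def add_divide_distrib)
qed

lemma conv_mult: "\<lbrakk>conv a k f; conv a k' g\<rbrakk> \<Longrightarrow> conv a (k + k') (\<lambda>\<rho>. f \<rho> * g \<rho>)"
proof -
  assume "conv a k f" "conv a k' g"
  then obtain v w where "((\<lambda>t. f (curve a t) / t ^ k) \<longlongrightarrow> v) (at 0)"
    "((\<lambda>t. g (curve a t) / t ^ k') \<longlongrightarrow> w) (at 0)" by (auto simp: conv_def)
  from tendsto_mult[OF this] show "conv a (k + k') (\<lambda>\<rho>. f \<rho> * g \<rho>)"
    by (auto simp: conv_def power_add)
qed

lemma conv_const: "conv a 0 (\<lambda>\<rho>. c)"
  unfolding conv_def by (auto intro: tendsto_const)

lemma conv_zero: "conv a k (\<lambda>\<rho>. 0)"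
  unfolding conv_def by (auto intro: tendsto_const)

lemma conv_smult: "conv a k f \<Longrightarrow> conv a k (\<lambda>\<rho>. c * f \<rho>)"
  using conv_mult[OF conv_const, of a k f c] by simp

lemma conv_sum: "(\<And>i. i \<in> A \<Longrightarrow> conv a k (f i)) \<Longrightarrow> conv a k (\<lambda>\<rho>. \<Sum>i\<in>A. f i \<rho>)"
  by (induction A rule: infinite_finite_induct) (simp_all add: conv_zero conv_add)

lemma conv_prod: "(\<And>i. i \<in> A \<Longrightarrow> conv a 0 (f i)) \<Longrightarrow> conv a 0 (\<lambda>\<rho>. \<Prod>i\<in>A. f i \<rho>)"
  using conv_mult[of a 0 _ 0]
  by (induction A rule: infinite_finite_induct) (simp_all add: conv_const)

lemma conv_Suc_tendsto:
  assumes "conv a (Suc k) f"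
  shows "((\<lambda>t. f (curve a t) / t ^ k) \<longlongrightarrow> 0) (at 0)"
proof -
  obtain v where "((\<lambda>t. f (curve a t) / t ^ Suc k) \<longlongrightarrow> v) (at 0)" using assms by (auto simp: conv_def)
  then have "((\<lambda>t. t * (f (curve a t) / t ^ Suc k)) \<longlongrightarrow> 0 * v) (at 0)" by (intro tendsto_intros)
  moreover have "eventually (\<lambda>t. t * (f (curve a t) / t ^ Suc k) = f (curve a t) / t ^ k) (at 0)"
    using eventually_neq_at_within[of "0 :: complex" 0 UNIV] by eventually_elim simp
  ultimately show ?thesis by (simp add: Lim_transform_eventually)
qed

lemma conv_sval_x: "\<lbrakk>p \<in> Pos; l < n\<rbrakk> \<Longrightarrow> conv a 1 (sval p (x l))"
  using tendsto_sval_curve[of p l a] by (auto simp: conv_def)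

text \<open>Entries of inverses are cofactors, hence polynomials in the entries of a generator.\<close>

lemma conv_entry:
  assumes "p \<in> Pos" "y \<in> carrier G"
  shows "conv a 0 (\<lambda>\<rho>. \<rho> y $$ p)"
proof -
  have entry_x: "conv a 0 (\<lambda>\<rho>. \<rho> (x l) $$ p)" if "p \<in> Pos" "l < n" for p l
  proof -
    have "conv a 0 (sval p (x l))"
      using conv_Suc_tendsto[of a 0 "sval p (x l)"] conv_sval_x[OF that, of a] by (auto simp: conv_def)
    from conv_add[OF this conv_const[of _ "if fst p = snd p then 1 else 0"]] show ?thesis
      by (simp add: sval_def)
  qed
  have "\<forall>p\<in>Pos. conv a 0 (\<lambda>\<rho>. \<rho> y $$ p)"
    using assms(2)
  proof (induction rule: generator_induct)
    case one
    have "conv a 0 (\<lambda>\<rho>. \<rho> \<one> $$ p)" if "p \<in> Pos" for p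
      using conv_cong[of "\<lambda>\<rho>. \<rho> \<one> $$ p" "\<lambda>\<rho>. 1\<^sub>m m $$ p" a 0] conv_const by (simp add: rep_one)
    then show ?case by blast
  next
    case (gen l)
    then show ?case using entry_x by blast
  next
    case (inv l)
    have "conv a 0 (\<lambda>\<rho>. \<rho> (inv (x l)) $$ (i, j))" if ij: "i < m" "j < m" for i j
    proof -
      let ?f = "\<lambda>\<rho>. (- 1) ^ (j + i) * (\<Sum>\<pi> | \<pi> permutes {0..<m - 1}. signof \<pi> * (\<Prod>r = 0..<m - 1.
          \<rho> (x l) $$ (if r < j then r else Suc r, if \<pi> r < i then \<pi> r else Suc (\<pi> r))))"
      have "\<rho> (inv (x l)) $$ (i, j) = ?f \<rho>" if \<rho>: "\<rho> \<in> Reps" for \<rho>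
      proof -
        have A: "\<rho> (x l) \<in> carrier_mat m m" using rep_mat(1)[OF \<rho>] inv by simp
        then have d: "mat_delete (\<rho> (x l)) j i \<in> carrier_mat (m - 1) (m - 1)" by (simp add: mat_delete_def)
        have "\<rho> (inv (x l)) $$ (i, j) = cofactor (\<rho> (x l)) j i"
          using rep_inv[OF \<rho>, of "x l"] inv A ij by (simp add: adj_mat_def)
        also have "\<dots> = ?f \<rho>"
          unfolding cofactor_def det_def'[OF d]
        proof (intro arg_cong2[where f = "(*)"] refl sum.cong prod.cong)
          fix \<pi> r assume "\<pi> \<in> {\<pi>. \<pi> permutes {0..<m - 1}}" "r \<in> {0..<m - 1}"
          then have "r < m - 1" "\<pi> r < m - 1" using permutes_in_image[of \<pi> "{0..<m - 1}" r] by auto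
          then show "mat_delete (\<rho> (x l)) j i $$ (r, \<pi> r) =
              \<rho> (x l) $$ (if r < j then r else Suc r, if \<pi> r < i then \<pi> r else Suc (\<pi> r))"
            using A by (simp add: mat_delete_def)
        qed
        finally show ?thesis .
      qed
      moreover have "conv a 0 ?f"
      proof (intro conv_smult conv_sum conv_prod entry_x)
        fix \<pi> r assume "\<pi> \<in> {\<pi>. \<pi> permutes {0..<m - 1}}" "r \<in> {0..<m - 1}"
        then have "r < m - 1" "\<pi> r < m - 1" using permutes_in_image[of \<pi> "{0..<m - 1}" r] by auto
        then show "(if r < j then r else Suc r, if \<pi> r < i then \<pi> r else Suc (\<pi> r)) \<in> Pos" by auto
      qed (rule inv)
      ultimately show ?thesis using conv_cong[of "\<lambda>\<rho>. \<rho> (inv (x l)) $$ (i, j)" ?f a 0] by simp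
    qed
    then show ?case by auto
  next
    case (mult y z)
    have "conv a 0 (\<lambda>\<rho>. \<rho> (y \<otimes> z) $$ (i, j))" if ij: "i < m" "j < m" for i j
    proof -
      have "conv a 0 (\<lambda>\<rho>. \<Sum>r<m. \<rho> y $$ (i, r) * \<rho> z $$ (r, j))"
        using mult.IH ij conv_mult[of a 0 _ 0] by (intro conv_sum) auto
      moreover have "\<rho> (y \<otimes> z) $$ (i, j) = (\<Sum>r<m. \<rho> y $$ (i, r) * \<rho> z $$ (r, j))" if "\<rho> \<in> Reps" for \<rho>
        using that ij mult.hyps rep_mat(1)[OF that mult.hyps(1)] rep_mat(1)[OF that mult.hyps(2)]
        by (simp add: rep_mult scalar_prod_def atLeast0LessThan)
      ultimately show ?thesis
        using conv_cong[of "\<lambda>\<rho>. \<rho> (y \<otimes> z) $$ (i, j)" "\<lambda>\<rho>. \<Sum>r<m. \<rho> y $$ (i, r) * \<rho> z $$ (r, j)" a 0] by simp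
    qed
    then show ?case by auto
  qed
  with assms(1) show ?thesis by blast
qed

lemma conv_restrict: "conv a k (restrict f Reps) \<longleftrightarrow> conv a k f"
  by (rule conv_cong) simp

lemma conv_RR:
  assumes "f \<in> carrier RR"
  shows "conv a 0 f"
proof -
  define V where "V = {f \<in> Reps \<rightarrow>\<^sub>E UNIV. conv a 0 f}"
  have "rat_subalgebra (fun_algebra Reps) V"
    by (rule rat_subalgebraI)
      (use conv_const conv_add conv_smult conv_mult[of a 0 _ 0] in \<open>auto simp: V_def conv_restrict\<close>)
  moreover have "entry_fun m G p y \<in> V" if "p \<in> Pos" "y \<in> carrier G" for p y
    using conv_entry[OF that] by (simp add: V_def entry_fun_def conv_restrict)
  ultimately have "carrier RR \<subseteq> V" by (rule RR_least)
  with assms show ?thesis by (auto simp: V_def)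
qed

text \<open>Orders of vanishing add up in products, and generators of the ideal vanish to order \<open>1\<close>.\<close>

lemma conv_J: "f \<in> J k \<Longrightarrow> conv a k f"
proof (induction k arbitrary: f)
  case 0
  then show ?case by (simp add: J_0 conv_RR)
next
  case (Suc k)
  have ideal: "conv a 1 f" if "f \<in> J_ideal m G n x" for f
    using that
  proof (rule J_ideal_least[rotated -1])
    show "conv a 1 (\<lambda>\<rho>\<in>Reps. f \<rho> * g \<rho>)" if "g \<in> carrier RR" "conv a 1 f" for f g
      using conv_mult[OF that(2) conv_RR[OF that(1)]] by (simp add: conv_restrict)
  qed (simp_all only: conv_restrict conv_zero conv_add conv_sval_x)
  from Suc.prems have "f \<in> ideal_prod RR (J k) (J_ideal m G n x)" by (simp add: J_Suc)
  then show ?case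
  proof induction
    case (prod i j)
    then show ?case using conv_mult[OF Suc.IH ideal, of i j] by (simp add: RR_ops conv_restrict del: restrict_apply)
  next
    case (sum s1 s2)
    then show ?case by (simp add: RR_ops conv_restrict conv_add del: restrict_apply)
  qed
qed

text \<open>For a function vanishing to order \<open>k\<close> this is the coefficient of \<open>t\<^sup>k\<close> along the curve.\<close>

definition lead :: "nat \<Rightarrow> ((nat \<times> nat) \<times> nat \<Rightarrow> complex) \<Rightarrow> (('g \<Rightarrow> complex mat) \<Rightarrow> complex) \<Rightarrow> complex" where
  "lead k a f = Lim (at 0) (\<lambda>t. f (curve a t) / t ^ k)"

lemma lead_eqI: "((\<lambda>t. f (curve a t) / t ^ k) \<longlongrightarrow> v) (at 0) \<Longrightarrow> lead k a f = v"
  unfolding lead_def by (rule tendsto_Lim) simp_all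

lemma tendsto_lead: "conv a k f \<Longrightarrow> ((\<lambda>t. f (curve a t) / t ^ k) \<longlongrightarrow> lead k a f) (at 0)"
  using lead_eqI by (auto simp: conv_def)

lemma inJ_conv: "inJ k f \<Longrightarrow> conv a k f"
  using conv_J[of "restrict f Reps" k a] by (simp add: inJ_def conv_restrict)

lemma lead_cong: "(\<And>\<rho>. \<rho> \<in> Reps \<Longrightarrow> f \<rho> = g \<rho>) \<Longrightarrow> lead k a f = lead k a g"
  by (simp add: lead_def curve_Reps)

lemma lead_restrict: "lead k a (restrict f Reps) = lead k a f"
  by (rule lead_cong) simp

lemma lead_add: "\<lbrakk>conv a k f; conv a k g\<rbrakk> \<Longrightarrow> lead k a (\<lambda>\<rho>. f \<rho> + g \<rho>) = lead k a f + lead k a g"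
  by (rule lead_eqI) (simp add: add_divide_distrib tendsto_add tendsto_lead)

lemma lead_smult: "conv a k f \<Longrightarrow> lead k a (\<lambda>\<rho>. c * f \<rho>) = c * lead k a f"
  using tendsto_mult_left[OF tendsto_lead, of a k f c] by (intro lead_eqI) simp

lemma lead_mult: "\<lbrakk>conv a k f; conv a k' g\<rbrakk> \<Longrightarrow> lead (k + k') a (\<lambda>\<rho>. f \<rho> * g \<rho>) = lead k a f * lead k' a g"
  using tendsto_mult[OF tendsto_lead tendsto_lead, of a k f a k' g] by (intro lead_eqI) (simp add: power_add)

lemma lead_zero: "lead k a (\<lambda>\<rho>. 0) = 0"
  by (rule lead_eqI) simp

lemma lead_sum:
  "(\<And>i. i \<in> A \<Longrightarrow> conv a k (f i)) \<Longrightarrow> lead k a (\<lambda>\<rho>. \<Sum>i\<in>A. f i \<rho>) = (\<Sum>i\<in>A. lead k a (f i))"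
  by (induction A rule: infinite_finite_induct) (simp_all add: lead_zero lead_add conv_sum)

lemma lead_one: "lead 0 a (\<lambda>\<rho>. 1) = 1"
  by (rule lead_eqI) simp

lemma conv_prod_lead:
  assumes "\<And>i. i \<in> A \<Longrightarrow> conv a (d i) (f i)"
  shows "conv a (\<Sum>i\<in>A. d i) (\<lambda>\<rho>. \<Prod>i\<in>A. f i \<rho>) \<and>
    lead (\<Sum>i\<in>A. d i) a (\<lambda>\<rho>. \<Prod>i\<in>A. f i \<rho>) = (\<Prod>i\<in>A. lead (d i) a (f i))"
  using assms
  by (induction A rule: infinite_finite_induct) (simp_all add: conv_const lead_one conv_mult lead_mult)

lemma lead_J_Suc: "inJ (Suc k) f \<Longrightarrow> lead k a f = 0"
  by (intro lead_eqI conv_Suc_tendsto inJ_conv)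

lemma lead_sval_x: "\<lbrakk>p \<in> entry_positions m; l < n\<rbrakk> \<Longrightarrow> lead 1 a (sval p (x l)) = a (p, l)"
  using tendsto_sval_curve[of p l a] entry_positions_Pos[of p] by (auto intro: lead_eqI)

text \<open>Modulo \<open>J 2\<close> the function \<open>sval p\<close> turns products into sums, so that its linear coefficient
  is determined by exponent sums.\<close>

lemma lead_sval:
  assumes p: "p \<in> entry_positions m" and y: "y \<in> carrier G"
  shows "lead 1 a (sval p y) = (\<Sum>j<n. of_int (expo j y) * a (p, j))"
proof -
  have P: "p \<in> Pos" by (rule entry_positions_Pos[OF p])
  have one: "lead 1 a (sval p \<one>) = 0"
    using lead_cong[of "sval p \<one>" "\<lambda>_. 0" 1 a] sval_one P by (simp add: lead_zero)
  have add: "lead 1 a (sval p (y \<otimes> z)) = lead 1 a (sval p y) + lead 1 a (sval p z)"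
    if yz: "y \<in> carrier G" "z \<in> carrier G" for y z
  proof -
    note c = inJ_conv[OF inJ_sval[OF P]]
    have "lead 1 a (\<lambda>\<rho>. (sval p (y \<otimes> z) \<rho> - sval p y \<rho> - sval p z \<rho>) + (sval p y \<rho> + sval p z \<rho>)) =
        0 + (lead 1 a (sval p y) + lead 1 a (sval p z))"
      using sval_mult_mod_J2[OF yz P] inJ_antimono[OF sval_mult_mod_J2[OF yz P], of 1] c yz
      by (subst lead_add) (simp_all add: inJ_conv conv_add lead_add lead_J_Suc numeral_2_eq_2)
    then show ?thesis by simp
  qed
  from y show ?thesis
  proof (induction rule: generator_induct)
    case one
    have "expo j \<one> = 0" for j using expo_mult[of \<one> \<one> j] by simp
    then show ?case using \<open>lead 1 a (sval p \<one>) = 0\<close> by simp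
  next
    case (gen l)
    have "(\<Sum>j<n. of_int (expo j (x l)) * a (p, j)) = (\<Sum>j<n. if j = l then a (p, l) else 0)"
      by (rule sum.cong) (use gen in \<open>auto simp: expo_x\<close>)
    then show ?case using lead_sval_x[OF p gen, of a] gen by simp
  next
    case (inv l)
    have "(\<Sum>j<n. of_int (expo j (inv (x l))) * a (p, j)) = (\<Sum>j<n. if j = l then - a (p, l) else 0)"
      by (rule sum.cong) (use inv in \<open>auto simp: expo_inv expo_x\<close>)
    moreover have "lead 1 a (sval p (inv (x l))) = - a (p, l)"
      using add[of "x l" "inv (x l)"] one inv lead_sval_x[OF p inv, of a] by (simp add: add_eq_0_iff)
    ultimately show ?case using inv by simp
  next
    case (mult y z)
    then show ?case using add[OF mult.hyps] by (simp add: expo_mult algebra_simps sum.distrib)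
  qed
qed

section \<open>The graded quotients\<close>

abbreviation "Jmod k \<equiv> RR\<lparr>carrier := J k\<rparr>"

lemma J_restrict: "f \<in> J k \<Longrightarrow> restrict f Reps = f"
  using J_subset RR_restrict by blast

lemma J_add: "\<lbrakk>f \<in> J k; g \<in> J k\<rbrakk> \<Longrightarrow> (\<lambda>\<rho>\<in>Reps. f \<rho> + g \<rho>) \<in> J k"
  using inJ_add[of k f g] inJ_J by (simp add: inJ_def[of k "\<lambda>\<rho>. f \<rho> + g \<rho>"])

lemma J_smult: "f \<in> J k \<Longrightarrow> (\<lambda>\<rho>\<in>Reps. of_rat c * f \<rho>) \<in> J k"
  using inJ_smult[of k f c] inJ_J by (simp add: inJ_def[of k "\<lambda>\<rho>. of_rat c * f \<rho>"])

lemma J_zero: "(\<lambda>\<rho>\<in>Reps. 0) \<in> J k"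
  using inJ_zero[of k] by (simp add: inJ_def)

lemma vectorspace_Jmod: "vectorspace class_ring (Jmod k)"
proof (rule rat_vectorspaceI)
  fix f assume "f \<in> carrier (Jmod k)"
  then have f: "restrict f Reps = f" using J_restrict by simp
  have "f \<oplus>\<^bsub>Jmod k\<^esub> \<zero>\<^bsub>Jmod k\<^esub> = restrict f Reps" by (simp add: RR_ops fun_eq_iff)
  then show "f \<oplus>\<^bsub>Jmod k\<^esub> \<zero>\<^bsub>Jmod k\<^esub> = f" using f by simp
  have "1 \<odot>\<^bsub>Jmod k\<^esub> f = restrict f Reps" by (simp add: RR_ops fun_eq_iff)
  then show "1 \<odot>\<^bsub>Jmod k\<^esub> f = f" using f by simp
qed (simp_all add: RR_ops J_add J_smult J_zero del: restrict_apply,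
    simp_all add: fun_eq_iff of_rat_mult of_rat_add algebra_simps)

lemma submodule_J_Suc: "LinearCombinations.submodule (class_ring :: rat ring) (J (Suc k)) (Jmod k)"
proof (rule LinearCombinations.submodule.intro)
  show "Module.module (class_ring :: rat ring) (Jmod k)"
    using vectorspace_Jmod by (rule vectorspace.axioms(1))
qed (use J_Suc_subset in \<open>simp_all add: RR_ops J_add J_smult J_zero subset_iff\<close>)

sublocale gr: quotient "Jmod k" "J (Suc k)" for k
  by (intro quotient.intro vectorspace_Jmod quotient_axioms.intro submodule_J_Suc)

abbreviation "gr k \<equiv> gr_J m G n x k"

lemma gr_eq: "gr k = quot_module (Jmod k) (J (Suc k))"
  by (simp add: gr_J_def)

lemma gr_class_eq: "gr_class m G n x k f = J (Suc k) +>\<^bsub>Jmod k\<^esub> f"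
  by (simp add: gr_class_def a_r_coset_def r_coset_def)

lemma Jmod_minus:
  assumes "f \<in> J k" "g \<in> J k"
  shows "f \<ominus>\<^bsub>Jmod k\<^esub> g = (\<lambda>\<rho>\<in>Reps. f \<rho> - g \<rho>)"
proof -
  have "f \<ominus>\<^bsub>Jmod k\<^esub> g = f \<oplus>\<^bsub>Jmod k\<^esub> (- 1) \<odot>\<^bsub>Jmod k\<^esub> g"
    using rat_smult_minus_one[OF vectorspace_Jmod, of g k] assms by (simp add: a_minus_def)
  then show ?thesis by (simp add: RR_ops fun_eq_iff)
qed

lemma functional_lead: "functional (Jmod k) (lead k a)"
proof (rule functional.intro)
  fix f g assume "f \<in> carrier (Jmod k)" "g \<in> carrier (Jmod k)"
  then show "lead k a (f \<oplus>\<^bsub>Jmod k\<^esub> g) = lead k a f + lead k a g"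
    by (simp add: RR_ops lead_restrict lead_add conv_J del: restrict_apply)
next
  fix f c assume "f \<in> carrier (Jmod k)"
  then show "lead k a (c \<odot>\<^bsub>Jmod k\<^esub> f) = of_rat c * lead k a f"
    by (simp add: RR_ops lead_restrict lead_smult conv_J del: restrict_apply)
qed

definition gr_fun :: "nat \<Rightarrow> ((nat \<times> nat) \<times> nat \<Rightarrow> complex) \<Rightarrow> _ \<Rightarrow> complex" where
  "gr_fun k a = gr.quot_fun (lead k a)"

lemma lead_J_Suc': "f \<in> J (Suc k) \<Longrightarrow> lead k a f = 0"
  by (intro lead_J_Suc inJ_J)

lemma gr_fun_class: "f \<in> J k \<Longrightarrow> gr_fun k a (J (Suc k) +>\<^bsub>Jmod k\<^esub> f) = lead k a f"
  unfolding gr_fun_def by (rule gr.quot_fun_coset[OF functional_lead lead_J_Suc']) simp_all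

lemma functional_gr_fun: "functional (gr k) (gr_fun k a)"
  unfolding gr_fun_def gr_eq by (rule gr.functional_quot_fun[OF functional_lead lead_J_Suc'])

lemma conv_power_lead:
  assumes "conv a 1 f"
  shows "conv a e (\<lambda>\<rho>. f \<rho> ^ e) \<and> lead e a (\<lambda>\<rho>. f \<rho> ^ e) = lead 1 a f ^ e"
  using conv_prod_lead[of "{..<e}" a "\<lambda>_. 1" "\<lambda>_. f"] assms by simp

text \<open>Stated for arbitrary group elements instead of the basis, as an automorphism takes the monomials in the basis
  to monomials in its image.\<close>

lemma lead_monomial:
  assumes y: "\<And>l. l < n \<Longrightarrow> y l \<in> carrier G" and \<epsilon>: "\<epsilon> \<in> Exps k"
  shows "lead k a (\<lambda>\<rho>. \<Prod>p\<in>entry_positions m. \<Prod>l<n. sval p (y l) \<rho> ^ \<epsilon> (p, l)) =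
    (\<Prod>p\<in>entry_positions m. \<Prod>l<n. (\<Sum>j<n. of_int (expo j (y l)) * a (p, j)) ^ \<epsilon> (p, l))"
proof -
  have pw: "conv a (\<epsilon> (p, l)) (\<lambda>\<rho>. sval p (y l) \<rho> ^ \<epsilon> (p, l)) \<and>
      lead (\<epsilon> (p, l)) a (\<lambda>\<rho>. sval p (y l) \<rho> ^ \<epsilon> (p, l)) =
        (\<Sum>j<n. of_int (expo j (y l)) * a (p, j)) ^ \<epsilon> (p, l)"
    if "p \<in> entry_positions m" "l < n" for p l
    using conv_power_lead[OF inJ_conv[OF inJ_sval[OF entry_positions_Pos[OF that(1)] y[OF that(2)]]]]
      lead_sval[OF that(1) y[OF that(2)]] by metis
  have row: "conv a (\<Sum>l<n. \<epsilon> (p, l)) (\<lambda>\<rho>. \<Prod>l<n. sval p (y l) \<rho> ^ \<epsilon> (p, l)) \<and>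
      lead (\<Sum>l<n. \<epsilon> (p, l)) a (\<lambda>\<rho>. \<Prod>l<n. sval p (y l) \<rho> ^ \<epsilon> (p, l)) =
        (\<Prod>l<n. (\<Sum>j<n. of_int (expo j (y l)) * a (p, j)) ^ \<epsilon> (p, l))"
    if p: "p \<in> entry_positions m" for p
    using conv_prod_lead[of "{..<n}" a "\<lambda>l. \<epsilon> (p, l)" "\<lambda>l \<rho>. sval p (y l) \<rho> ^ \<epsilon> (p, l)"] pw[OF p] by simp
  have "(\<Sum>p\<in>entry_positions m. \<Sum>l<n. \<epsilon> (p, l)) = k"
    using \<epsilon> by (simp add: monomial_exponents_def)
  then show ?thesis
    using conv_prod_lead[of "entry_positions m" a "\<lambda>p. \<Sum>l<n. \<epsilon> (p, l)"
        "\<lambda>p \<rho>. \<Prod>l<n. sval p (y l) \<rho> ^ \<epsilon> (p, l)"] row by simp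
qed

lemma lead_smono:
  assumes "\<epsilon> \<in> Exps k"
  shows "lead k a (smono \<epsilon>) = mono_eval m n a \<epsilon>"
proof -
  have "(\<Sum>j<n. of_int (expo j (x l)) * a (p, j)) = a (p, l)" if "l < n" for p l
  proof -
    have "(\<Sum>j<n. of_int (expo j (x l)) * a (p, j)) = (\<Sum>j<n. if j = l then a (p, l) else 0)"
      by (rule sum.cong) (use that in \<open>auto simp: expo_x\<close>)
    then show ?thesis using that by simp
  qed
  then show ?thesis
    using lead_monomial[of x, OF x_closed assms, of a] by (simp add: smono_def[abs_def] mono_eval_def)
qed

lemma s_monomial_J: "\<epsilon> \<in> Exps k \<Longrightarrow> s_monomial m G n x \<epsilon> \<in> J k"
  using inJ_smono[of \<epsilon> k] by (simp add: s_monomial_eq inJ_def)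

text \<open>The reformulation of \<open>J_spanned\<close> in terms of cosets.\<close>

lemma lin_gen_gr:
  "carrier (gr k) \<subseteq> lin_gen (gr k) ((\<lambda>\<epsilon>. gr_class m G n x k (s_monomial m G n x \<epsilon>)) ` Exps k)"
proof
  let ?L = "lin_gen (gr k) ((\<lambda>\<epsilon>. gr_class m G n x k (s_monomial m G n x \<epsilon>)) ` Exps k)"
  fix C assume "C \<in> carrier (gr k)"
  then obtain f where f: "f \<in> J k" "C = J (Suc k) +>\<^bsub>Jmod k\<^esub> f"
    unfolding gr_eq by (rule gr.cosetE) simp
  obtain c where c: "inJ (Suc k) (\<lambda>\<rho>. f \<rho> - (\<Sum>\<epsilon>\<in>Exps k. of_rat (c \<epsilon>) * smono \<epsilon> \<rho>))"
    using J_spanned[OF f(1)] by (auto simp: spanned_def)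
  define g where "g A = (\<lambda>\<rho>\<in>Reps. \<Sum>\<epsilon>\<in>A. of_rat (c \<epsilon>) * smono \<epsilon> \<rho>)" for A
  have gJ: "g A \<in> J k" if "A \<subseteq> Exps k" for A
  proof -
    have "inJ k (\<lambda>\<rho>. \<Sum>\<epsilon>\<in>A. of_rat (c \<epsilon>) * smono \<epsilon> \<rho>)"
      using that by (intro inJ_sum inJ_smult inJ_smono) auto
    then show ?thesis by (simp add: inJ_def g_def)
  qed
  have "J (Suc k) +>\<^bsub>Jmod k\<^esub> g A \<in> ?L" if "finite A" "A \<subseteq> Exps k" for A
    using that
  proof induction
    case empty
    have "J (Suc k) +>\<^bsub>Jmod k\<^esub> g {} = \<zero>\<^bsub>gr k\<^esub>"
      unfolding gr_eq gr.zero_Q by (simp add: g_def RR_ops)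
    then show ?case by (simp add: lin_gen.zero)
  next
    case (insert \<epsilon> A)
    have s: "s_monomial m G n x \<epsilon> \<in> J k" using insert.prems by (intro s_monomial_J) auto
    have "g (insert \<epsilon> A) = (c \<epsilon> \<odot>\<^bsub>Jmod k\<^esub> s_monomial m G n x \<epsilon>) \<oplus>\<^bsub>Jmod k\<^esub> g A"
      using insert.hyps by (simp add: g_def RR_ops s_monomial_eq fun_eq_iff)
    moreover have "c \<epsilon> \<odot>\<^bsub>Jmod k\<^esub> s_monomial m G n x \<epsilon> \<in> J k"
      using J_smult[OF s] by (simp add: RR_ops)
    ultimately have "J (Suc k) +>\<^bsub>Jmod k\<^esub> g (insert \<epsilon> A) =
        (c \<epsilon> \<odot>\<^bsub>gr k\<^esub> (J (Suc k) +>\<^bsub>Jmod k\<^esub> s_monomial m G n x \<epsilon>)) \<oplus>\<^bsub>gr k\<^esub> (J (Suc k) +>\<^bsub>Jmod k\<^esub> g A)"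
      unfolding gr_eq using gJ[of A] insert.prems s by (simp add: gr.add_Q gr.smult_Q)
    moreover have "J (Suc k) +>\<^bsub>Jmod k\<^esub> s_monomial m G n x \<epsilon> \<in> ?L"
      using insert.prems by (intro lin_gen.base) (auto simp: gr_class_eq)
    ultimately show ?case using insert by (simp add: lin_gen.add lin_gen.smult)
  qed
  from this[OF finite_Exps subset_refl] have "J (Suc k) +>\<^bsub>Jmod k\<^esub> g (Exps k) \<in> ?L" .
  moreover have "J (Suc k) +>\<^bsub>Jmod k\<^esub> f = J (Suc k) +>\<^bsub>Jmod k\<^esub> g (Exps k)"
  proof -
    have "f \<ominus>\<^bsub>Jmod k\<^esub> g (Exps k) = (\<lambda>\<rho>\<in>Reps. f \<rho> - (\<Sum>\<epsilon>\<in>Exps k. of_rat (c \<epsilon>) * smono \<epsilon> \<rho>))"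
      using f(1) gJ[of "Exps k"] by (simp add: Jmod_minus) (simp add: g_def fun_eq_iff)
    then show ?thesis
      using c f(1) gJ[of "Exps k"] by (subst gr.coset_eq_iff) (simp_all add: inJ_def)
  qed
  ultimately show "C \<in> ?L" using f(2) by simp
qed

text \<open>Taking coefficients kills \<open>J (Suc k)\<close> and sends the class of a monomial in the \<open>s_fun\<close> to the same
  monomial in the coordinates of \<open>a\<close>.\<close>

lemma monomial_space_gr:
  "monomial_space (gr k) (Exps k) (\<lambda>\<epsilon>. gr_class m G n x k (s_monomial m G n x \<epsilon>))
     (mono_eval m n) (gr_fun k)"
proof (intro monomial_space.intro monomial_space_axioms.intro finite_Exps lin_gen_gr functional_gr_fun)
  show "vectorspace class_ring (gr k)"
    unfolding gr_eq by (rule gr.vectorspace_Q)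
  show "(\<lambda>\<epsilon>. gr_class m G n x k (s_monomial m G n x \<epsilon>)) \<in> Exps k \<rightarrow> carrier (gr k)"
    unfolding gr_eq gr_class_eq by (auto intro!: gr.coset_closed s_monomial_J)
  show "gr_fun k a (gr_class m G n x k (s_monomial m G n x \<epsilon>)) = mono_eval m n a \<epsilon>"
    if "\<epsilon> \<in> Exps k" for a \<epsilon>
    using that by (simp add: gr_class_eq gr_fun_class s_monomial_J)
      (simp add: s_monomial_eq lead_restrict lead_smono)
qed (rule mono_eval_independent)

subsection \<open>The action of automorphisms\<close>

abbreviation "pull \<sigma> \<rho> \<equiv> compose (carrier G) \<rho> \<sigma>"

lemma pull_Reps:
  assumes "\<sigma> \<in> auto G" "\<rho> \<in> Reps"
  shows "pull \<sigma> \<rho> \<in> Reps"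
  using assms auto_closed[OF assms(1)]
  by (auto simp: reps_def hom_def Pi_iff compose_def auto_def)

lemma inJ_pull_R:
  assumes \<sigma>: "\<sigma> \<in> auto G" and f: "f \<in> carrier RR"
  shows "inJ 0 (\<lambda>\<rho>. f (pull \<sigma> \<rho>))"
proof -
  define V where "V = {f \<in> Reps \<rightarrow>\<^sub>E UNIV. inJ 0 (\<lambda>\<rho>. f (pull \<sigma> \<rho>))}"
  have V: "restrict f Reps \<in> V \<longleftrightarrow> inJ 0 (\<lambda>\<rho>. f (pull \<sigma> \<rho>))" for f
    using inJ_cong[of "\<lambda>\<rho>. restrict f Reps (pull \<sigma> \<rho>)" "\<lambda>\<rho>. f (pull \<sigma> \<rho>)" 0]
    by (simp add: V_def pull_Reps[OF \<sigma>])
  have VD: "inJ 0 (\<lambda>\<rho>. f (pull \<sigma> \<rho>))" if "f \<in> V" for f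
    using that by (simp add: V_def)
  have "rat_subalgebra (fun_algebra Reps) V"
    by (rule rat_subalgebraI)
      (use VD inJ_one inJ_add inJ_smult inJ_mult[of 0 _ 0] in \<open>simp_all add: V del: restrict_apply\<close>,
       simp add: V_def)
  moreover have "entry_fun m G p y \<in> V" if "p \<in> Pos" "y \<in> carrier G" for p y
    using inJ_entry[OF that(1) auto_closed[OF \<sigma> that(2)]] that(2)
    unfolding entry_fun_def V by (simp add: compose_def)
  ultimately have "carrier RR \<subseteq> V" by (rule RR_least)
  with f VD show ?thesis by blast
qed

text \<open>Precomposition with \<open>\<sigma>\<close> takes the generators \<open>s\<^bsub>ij\<^esub>(x l)\<close> to \<open>s\<^bsub>ij\<^esub>(\<sigma> (x l))\<close>, which are in the ideal by
  \<open>inJ_sval\<close>.\<close>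

lemma inJ_pull:
  assumes \<sigma>: "\<sigma> \<in> auto G"
  shows "f \<in> J k \<Longrightarrow> inJ k (\<lambda>\<rho>. f (pull \<sigma> \<rho>))"
proof (induction k arbitrary: f)
  case 0
  then show ?case by (intro inJ_pull_R[OF \<sigma>]) (simp add: J_0)
next
  case (Suc k)
  have cong: "inJ k (\<lambda>\<rho>. restrict f Reps (pull \<sigma> \<rho>)) \<longleftrightarrow> inJ k (\<lambda>\<rho>. f (pull \<sigma> \<rho>))" for f k
    by (rule inJ_cong) (simp add: pull_Reps[OF \<sigma>])
  have ideal: "inJ 1 (\<lambda>\<rho>. f (pull \<sigma> \<rho>))" if "f \<in> J_ideal m G n x" for f
    using that
  proof (rule J_ideal_least[rotated -1, where P = "\<lambda>f. inJ 1 (\<lambda>\<rho>. f (pull \<sigma> \<rho>))"])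
    fix f g assume "g \<in> carrier RR" "inJ 1 (\<lambda>\<rho>. f (pull \<sigma> \<rho>))"
    then show "inJ 1 (\<lambda>\<rho>. (\<lambda>\<rho>\<in>Reps. f \<rho> * g \<rho>) (pull \<sigma> \<rho>))"
      unfolding cong by (intro inJ_mult_R inJ_pull_R[OF \<sigma>])
  next
    fix f g assume "inJ 1 (\<lambda>\<rho>. f (pull \<sigma> \<rho>))" "inJ 1 (\<lambda>\<rho>. g (pull \<sigma> \<rho>))"
    then show "inJ 1 (\<lambda>\<rho>. (\<lambda>\<rho>\<in>Reps. f \<rho> + g \<rho>) (pull \<sigma> \<rho>))"
      unfolding cong by (rule inJ_add)
  next
    fix p l assume pl: "p \<in> Pos" "l < n"
    then have "inJ 1 (sval p (\<sigma> (x l)))" by (intro inJ_sval auto_closed[OF \<sigma>]) auto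
    then show "inJ 1 (\<lambda>\<rho>. restrict (sval p (x l)) Reps (pull \<sigma> \<rho>))"
      unfolding cong using pl by (simp add: sval_def[abs_def] compose_def)
  qed (simp only: cong inJ_zero)
  from Suc.prems have "f \<in> ideal_prod RR (J k) (J_ideal m G n x)" by (simp add: J_Suc)
  then show ?case
  proof induction
    case (prod i j)
    then show ?case
      unfolding RR_ops cong using inJ_mult[OF Suc.IH ideal, of i j] by simp
  next
    case (sum s1 s2)
    then show ?case unfolding RR_ops cong by (intro inJ_add)
  qed
qed

lemma
  assumes \<sigma>: "\<sigma> \<in> auto G"
  shows linear_endo_aut_act: "linear_endo (Jmod k) (aut_act m G \<sigma>)"
    and aut_act_J: "f \<in> J k \<Longrightarrow> aut_act m G \<sigma> f \<in> J k"
proof -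
  show J: "aut_act m G \<sigma> f \<in> J k" if "f \<in> J k" for f k
    using inJ_pull[OF \<sigma> that] by (simp add: aut_act_def inJ_def)
  show "linear_endo (Jmod k) (aut_act m G \<sigma>)"
    by (rule linear_endo.intro)
      (use J pull_Reps[OF \<sigma>] in \<open>simp_all add: aut_act_def RR_ops fun_eq_iff\<close>)
qed

text \<open>By \<open>J_spanned\<close> it suffices to consider monomials, whose factors are treated in \<open>lead_sval\<close>.\<close>

lemma lead_pull:
  assumes \<sigma>: "realizes \<sigma> A" and f: "f \<in> J k"
  shows "lead k a (\<lambda>\<rho>. f (pull \<sigma> \<rho>)) = lead k (subst_all A a) f"
proof -
  have au: "\<sigma> \<in> auto G" using \<sigma> by (simp add: realizes_def)
  obtain c where c: "inJ (Suc k) (\<lambda>\<rho>. f \<rho> - (\<Sum>\<epsilon>\<in>Exps k. of_rat (c \<epsilon>) * smono \<epsilon> \<rho>))"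
    using J_spanned[OF f] by (auto simp: spanned_def)
  let ?h = "\<lambda>\<rho>. f \<rho> - (\<Sum>\<epsilon>\<in>Exps k. of_rat (c \<epsilon>) * smono \<epsilon> \<rho>)"
  have mono: "lead k b (\<lambda>\<rho>. \<Sum>\<epsilon>\<in>Exps k. of_rat (c \<epsilon>) * smono \<epsilon> \<rho>) =
      (\<Sum>\<epsilon>\<in>Exps k. of_rat (c \<epsilon>) * mono_eval m n b \<epsilon>)" for b
    using inJ_conv[OF inJ_smono] by (subst lead_sum) (auto simp: lead_smult lead_smono conv_smult)
  have cm: "conv b k (\<lambda>\<rho>. \<Sum>\<epsilon>\<in>Exps k. of_rat (c \<epsilon>) * smono \<epsilon> \<rho>)" for b
    by (intro conv_sum conv_smult inJ_conv[OF inJ_smono])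
  have 1: "lead k b f = (\<Sum>\<epsilon>\<in>Exps k. of_rat (c \<epsilon>) * mono_eval m n b \<epsilon>)" for b
  proof -
    have "lead k b (\<lambda>\<rho>. ?h \<rho> + (\<Sum>\<epsilon>\<in>Exps k. of_rat (c \<epsilon>) * smono \<epsilon> \<rho>)) =
        0 + (\<Sum>\<epsilon>\<in>Exps k. of_rat (c \<epsilon>) * mono_eval m n b \<epsilon>)"
      using c cm by (subst lead_add) (simp_all add: lead_J_Suc mono inJ_conv[OF inJ_antimono[OF c]])
    then show ?thesis by simp
  qed
  have pull_smono: "smono \<epsilon> (pull \<sigma> \<rho>) =
      (\<Prod>p\<in>entry_positions m. \<Prod>l<n. sval p (\<sigma> (x l)) \<rho> ^ \<epsilon> (p, l))" for \<epsilon> \<rho>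
    by (simp add: smono_def sval_def compose_def)
  have h: "inJ (Suc k) (\<lambda>\<rho>. ?h (pull \<sigma> \<rho>))"
  proof -
    have "restrict ?h Reps \<in> J (Suc k)" using c by (simp add: inJ_def)
    from inJ_pull[OF au this] show ?thesis
      by (subst inJ_cong[of _ "\<lambda>\<rho>. restrict ?h Reps (pull \<sigma> \<rho>)"]) (simp_all add: pull_Reps[OF au])
  qed
  have cp: "conv a k (\<lambda>\<rho>. smono \<epsilon> (pull \<sigma> \<rho>))" if "\<epsilon> \<in> Exps k" for \<epsilon>
  proof -
    have "restrict (smono \<epsilon>) Reps \<in> J k" using inJ_smono[OF that] by (simp add: inJ_def)
    from inJ_conv[OF inJ_pull[OF au this], of a] show ?thesis
      by (subst conv_cong[of _ "\<lambda>\<rho>. restrict (smono \<epsilon>) Reps (pull \<sigma> \<rho>)"]) (simp_all add: pull_Reps[OF au])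
  qed
  have Lp: "lead k a (\<lambda>\<rho>. smono \<epsilon> (pull \<sigma> \<rho>)) = mono_eval m n (subst_all A a) \<epsilon>" if "\<epsilon> \<in> Exps k" for \<epsilon>
  proof -
    have "lead k a (\<lambda>\<rho>. smono \<epsilon> (pull \<sigma> \<rho>)) =
        (\<Prod>p\<in>entry_positions m. \<Prod>l<n. (\<Sum>j<n. of_int (expo j (\<sigma> (x l))) * a (p, j)) ^ \<epsilon> (p, l))"
      unfolding pull_smono using that by (intro lead_monomial auto_closed[OF au]) auto
    also have "\<dots> = mono_eval m n (subst_all A a) \<epsilon>"
      unfolding mono_eval_def subst_matrix_def
      by (intro prod.cong refl) (use \<sigma> in \<open>simp add: realizes_def\<close>)
    finally show ?thesis .
  qed
  have "lead k a (\<lambda>\<rho>. ?h (pull \<sigma> \<rho>) + (\<Sum>\<epsilon>\<in>Exps k. of_rat (c \<epsilon>) * smono \<epsilon> (pull \<sigma> \<rho>))) =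
      0 + (\<Sum>\<epsilon>\<in>Exps k. of_rat (c \<epsilon>) * mono_eval m n (subst_all A a) \<epsilon>)"
    using h cp Lp inJ_conv[OF inJ_antimono[OF h]]
    by (subst lead_add) (simp_all add: lead_J_Suc conv_sum conv_smult lead_sum lead_smult)
  then show ?thesis by (simp add: 1)
qed

lemma
  assumes \<sigma>: "realizes \<sigma> A" and C: "C \<in> carrier (gr k)"
  shows gr_aut_act_closed: "gr_aut_act m G n x k \<sigma> C \<in> carrier (gr k)"
    and gr_fun_aut_act: "gr_fun k a (gr_aut_act m G n x k \<sigma> C) = gr_fun k (subst_all A a) C"
proof -
  have au: "\<sigma> \<in> auto G" using \<sigma> by (simp add: realizes_def)
  note endo = linear_endo_aut_act[OF au, of k]
  have img: "aut_act m G \<sigma> ` J (Suc k) \<subseteq> J (Suc k)" using aut_act_J[OF au] by blast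
  obtain f where f: "f \<in> J k" "C = J (Suc k) +>\<^bsub>Jmod k\<^esub> f"
    using C unfolding gr_eq by (rule gr.cosetE) simp
  have act: "gr_aut_act m G n x k \<sigma> C = J (Suc k) +>\<^bsub>Jmod k\<^esub> aut_act m G \<sigma> f"
    unfolding gr_aut_act_def f(2) using f(1) by (intro gr.quot_map_coset[OF endo img]) simp
  show "gr_aut_act m G n x k \<sigma> C \<in> carrier (gr k)"
    unfolding act gr_eq using aut_act_J[OF au f(1)] by (intro gr.coset_closed) simp
  show "gr_fun k a (gr_aut_act m G n x k \<sigma> C) = gr_fun k (subst_all A a) C"
  proof -
    have "gr_fun k a (gr_aut_act m G n x k \<sigma> C) = lead k a (aut_act m G \<sigma> f)"
      unfolding act by (rule gr_fun_class[OF aut_act_J[OF au f(1)]])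
    also have "\<dots> = lead k (subst_all A a) f"
      unfolding aut_act_def lead_restrict by (rule lead_pull[OF \<sigma> f(1)])
    also have "\<dots> = gr_fun k (subst_all A a) C"
      unfolding f(2) by (rule gr_fun_class[OF f(1), symmetric])
    finally show ?thesis .
  qed
qed

text \<open>All lifts of an automorphism of the abelianization act on \<open>gr k\<close> by the same substitution, which
  makes the description in \<open>gr_ab_act\<close> proper.\<close>

lemma gr_ab_act_eq:
  assumes \<sigma>: "realizes \<sigma> A" and C: "C \<in> carrier (gr k)"
  shows "gr_ab_act m G n x k (ab_aut G \<sigma>) C = gr_aut_act m G n x k \<sigma> C"
proof -
  interpret V: monomial_space "gr k" "Exps k" "\<lambda>\<epsilon>. gr_class m G n x k (s_monomial m G n x \<epsilon>)"
    "mono_eval m n" "gr_fun k"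
    by (rule monomial_space_gr)
  have au: "\<sigma> \<in> auto G" using \<sigma> by (simp add: realizes_def)
  have same: "gr_aut_act m G n x k \<tau> C = gr_aut_act m G n x k \<sigma> C"
    if "\<tau> \<in> auto G" "ab_aut G \<tau> = ab_aut G \<sigma>" for \<tau>
  proof (rule V.L_determines)
    have \<tau>: "realizes \<tau> A" by (rule realizes_ab_aut[OF \<sigma> that])
    show "gr_aut_act m G n x k \<tau> C \<in> carrier (gr k)" by (rule gr_aut_act_closed[OF \<tau> C])
    show "gr_aut_act m G n x k \<sigma> C \<in> carrier (gr k)" by (rule gr_aut_act_closed[OF \<sigma> C])
    show "gr_fun k a (gr_aut_act m G n x k \<tau> C) = gr_fun k a (gr_aut_act m G n x k \<sigma> C)" for a
      by (simp only: gr_fun_aut_act[OF \<tau> C] gr_fun_aut_act[OF \<sigma> C])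
  qed
  show ?thesis
    unfolding gr_ab_act_def
    by (rule the_equality) (use same au in blast)+
qed

text \<open>On both sides the action of \<open>A\<close> is seen by the functionals as the same substitution
  \<open>subst_all A\<close> of \<open>a\<close>.\<close>

theorem equivariant_isomorphism:
  "\<exists>\<phi>. linear_map class_ring (gr k) (sym_sum m G k) \<phi> \<and>
     bij_betw \<phi> (carrier (gr k)) (carrier (sym_sum m G k)) \<and>
     (\<forall>A\<in>GL_int n. \<forall>C\<in>carrier (gr k).
        \<phi> (gr_ab_act m G n x k (GL_aut G n x A) C) = sym_sum_act m G k (GL_aut G n x A) (\<phi> C))"
proof -
  interpret W: monomial_space "sym_sum m G k" "Exps k" "sym_sum_monomial m k" "mono_eval m n" "sym_sum_fun m k"
    by (rule monomial_space_sym_sum)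
  obtain \<phi> where \<phi>: "linear_map class_ring (gr k) (sym_sum m G k) \<phi>"
      "bij_betw \<phi> (carrier (gr k)) (carrier (sym_sum m G k))"
      "\<forall>C\<in>carrier (gr k). \<forall>a. sym_sum_fun m k a (\<phi> C) = gr_fun k a C"
    using monomial_spaces_isomorphic[OF monomial_space_gr monomial_space_sym_sum] by blast
  have cl: "\<phi> C \<in> carrier (sym_sum m G k)" if "C \<in> carrier (gr k)" for C
    using \<phi>(2) that by (auto simp: bij_betw_def)
  have "\<phi> (gr_ab_act m G n x k (GL_aut G n x A) C) = sym_sum_act m G k (GL_aut G n x A) (\<phi> C)"
    if A: "A \<in> GL_int n" and C: "C \<in> carrier (gr k)" for A C
  proof -
    obtain \<sigma> where \<sigma>: "realizes \<sigma> (\<lambda>i j. A $$ (i, j))" "GL_aut G n x A = ab_aut G \<sigma>"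
      using GL_aut_lift[OF A] by blast
    note D = gr_aut_act_closed[OF \<sigma>(1) C]
    show ?thesis
      unfolding \<sigma>(2) gr_ab_act_eq[OF \<sigma>(1) C]
    proof (rule W.L_determines)
      show "\<phi> (gr_aut_act m G n x k \<sigma> C) \<in> carrier (sym_sum m G k)" by (rule cl[OF D])
      show "sym_sum_act m G k (ab_aut G \<sigma>) (\<phi> C) \<in> carrier (sym_sum m G k)"
        by (rule sym_sum_act_closed[OF \<sigma>(1) cl[OF C]])
      show "sym_sum_fun m k a (\<phi> (gr_aut_act m G n x k \<sigma> C)) =
          sym_sum_fun m k a (sym_sum_act m G k (ab_aut G \<sigma>) (\<phi> C))" for a
        using \<phi>(3) C D by (simp only: sym_sum_fun_act[OF \<sigma>(1) cl[OF C]] gr_fun_aut_act[OF \<sigma>(1) C])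
    qed
  qed
  with \<phi>(1,2) show ?thesis by blast
qed

end

section \<open>The theorem\<close>

theorem theorem1:
  fixes G :: "('g, 'b) monoid_scheme" and x :: "nat \<Rightarrow> 'g" and m n k :: nat
  assumes "m \<ge> 2"
    and "free_group_with_basis G n x"
    and "k \<ge> 1"
  shows "vectorspace class_ring (gr_J m G n x k) \<and>
     s_monomial m G n x ` monomial_exponents m n k \<subseteq> J_power m G n x k \<and>
     inj_on (\<lambda>e. gr_class m G n x k (s_monomial m G n x e)) (monomial_exponents m n k) \<and>
     vectorspace.basis class_ring (gr_J m G n x k)
       ((\<lambda>e. gr_class m G n x k (s_monomial m G n x e)) ` monomial_exponents m n k) \<and>
     (n \<ge> 2 \<longrightarrow>
       (\<exists>\<phi>. linear_map class_ring (gr_J m G n x k) (sym_sum m G k) \<phi> \<and>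
            bij_betw \<phi> (carrier (gr_J m G n x k)) (carrier (sym_sum m G k)) \<and>
            (\<forall>A\<in>GL_int n. \<forall>C\<in>carrier (gr_J m G n x k).
               \<phi> (gr_ab_act m G n x k (GL_aut G n x A) C) =
               sym_sum_act m G k (GL_aut G n x A) (\<phi> C))))"
proof -
  interpret free_reps G n x m
    using assms(1,2)
    by (simp add: free_reps_def free_reps_axioms_def free_basis_def free_basis_axioms_def
        free_group_with_basis_def)
  interpret V: monomial_space "gr_J m G n x k" "monomial_exponents m n k"
    "\<lambda>e. gr_class m G n x k (s_monomial m G n x e)" "mono_eval m n" "gr_fun k"
    by (rule monomial_space_gr)
  show ?thesis
    using V.vectorspace_axioms s_monomial_J V.inj_on_\<beta> V.basis_\<beta> equivariant_isomorphism by blast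
qed

end
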